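(* Let $a,b,N$ be nonnegative integers with $1\le b\le a\le N$, let $\mathcal M=\{M_0,\dots,M_{b-1}\}$ be a (indexed) set of $b$ real parameters with $M_i\ne 0,1$, and let $U$ be a finite set of complex numbers, with $n_U$ elements, such that $u+v\ne -a-b-1$ for all $u,v\in U$. Let $$\nu_{a,b,N}^{\mathcal M,U}=\prod_{u\in U}(x-\lambda^{a,b}(u))\,\nu_{a,b,N}^{\mathcal M},$$ where $\nu_{a,b,N}^{\mathcal M}$ is defined in the context, and let $n_S$ be the number of elements of $\{\lambda^{a,b}(i):i=-b,\dots,N\}\setminus\{\lambda^{a,b}(u):u\in U\}$; assume $n_S>0$. Let $\Phi_n^{a,b,N;\mathcal M,U}$ be the determinant of the $(a+n_U)\times(a+n_U)$ matrix with columns $j=1,\dots,a+n_U$ whose first $a$ rows, indexed by $g=b,b+1,\dots,a+b-1$ in increasing order, have entries $$(b+N-n-n_U+j+1)_{a+n_U-j}\,W_g^{a,b,N;\mathcal M}(-n-n_U+j-1),$$ and whose last $n_U$ rows, indexed by $u\in U$ in increasing lexicographic order, have entries $(-1)^jR_{n+n_U-j}^{a,b,N}(\lambda^{a,b}(u))$. Then the measure $\nu_{a,b,N}^{\mathcal M,U}$ has a sequence $(p_n)_{n=0}^{n_S-1}$ of orthogonal polynomials if and only if $$\Phi_n^{a,b,N;\mathcal M,U}\ne0,\qquad n=0,1,\dots,n_S .$$ In that case, define $q_n^{a,b,N;\mathcal M,U}(x)$, $n=0,\dots,n_S-1$, as the quotient by $\prod_{u\in U}(x-\lambda^{a,b}(u))$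 of the determinant of the $(a+n_U+1)\times(a+n_U+1)$ matrix with columns $j=1,\dots,a+n_U+1$ whose first row has entries $(-1)^{j-1}R_{n+n_U-j+1}^{a,b,N}(x)$, whose next $a$ rows, indexed by $g=b,\dots,a+b-1$, have entries $$(b+N-n-n_U+j)_{a+n_U+1-j}\,W_g^{a,b,N;\mathcal M}(-n-n_U+j-2),$$ and whose last $n_U$ rows, indexed by $u\in U$, have entries $(-1)^{j-1}R_{n+n_U-j+1}^{a,b,N}(\lambda^{a,b}(u))$. Then the $(q_n^{a,b,N;\mathcal M,U})_{n=0}^{n_S-1}$ are polynomials, orthogonal with respect to $\nu_{a,b,N}^{\mathcal M,U}$, with $$\langle q_n^{a,b,N;\mathcal M,U},q_n^{a,b,N;\mathcal M,U}\rangle_{\nu_{a,b,N}^{\mathcal M,U}}=\frac{(-1)^{n_U}\,n!\,(N+b)!^2\,(N+a+b-n)^a}{(n+n_U)!\,(N+a-n)!\,(N+a+b-n)!}\,\Phi_n^{a,b,N;\mathcal M,U}\,\Phi_{n+1}^{a,b,N;\mathcal M,U}.$$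
   Context: Notation. $(x)_m=x(x+1)\cdots(x+m-1)$ is the Pochhammer symbol, $(x,y)_m=(x)_m(y)_m$. $\lceil\cdot\rceil$ is the ceiling function. $\delta_y$ is the unit point mass at $y$. $\lambda^{a,b}(x)=x(x+a+b+1)$. Lexicographic order on $\mathbb C$: $u<w$ if $\Re u<\Re w$, or $\Re u=\Re w$ and $\Im u<\Im w$. Orthogonality. For a (not necessarily positive, possibly complex) measure $\mu$, $\langle p,q\rangle_\mu=\int pq\,d\mu$ (bilinear). A sequence $(p_n)_{n=0}^K$ with $\deg p_n=n$ is orthogonal with respect to $\mu$ if $\langle p_n,p_m\rangle_\mu=0$ for $n\ne m$ and $\langle p_n,p_n\rangle_\mu\neq0$ for all $n\le K$. Dual Hahn polynomials: for $n\ge 0$, $$R_n^{a,b,N}(x)=\sum_{j=0}^n\frac{(-n)_j(-N+j)_{n-j}(a+j+1)_{n-j}}{n!\,(-1)^j\,j!}\prod_{i=0}^{j-1}\big(x-i(a+b+1+i)\big),$$ and $R_n^{a,b,N}=0$ for $n<0$. Hahn polynomials (for arbitrary real parameters $a,b,N$): $$h_n^{a,b,N}(x)=\sum_{j=0}^n\frac{(-n)_j(a+b+n+1)_j(-N+j)_{n-j}(a+j+1)_{n-j}(-x)_j}{j!}.$$ Dual Hahn masses: for $x=0,\dots,N$, $$\rho_{b,a,N}(x)=\frac{(2x+a+b+1)(b+1)_x(-N)_x\,N!}{(-1)^x(x+a+b+1)_{N+1}(a+1)_x\,x!}.$$ The measure: $$\nu_{a,b,N}^{\mathcal M}=\sum_{x=-b}^{-1}\frac{(2x+a+b+1)(N+1-x)_{x+b}}{(N+b+1)_{x+a+1}}M_{x+b}\,\delta_{\lambda^{a,b}(x)}+\frac{((N+1)_b)^2}{(b+1)_{a-b}}\sum_{x=0}^N\frac{\rho_{b,a,N}(x)}{\prod_{i=0}^{b-1}(x+a+i+1)(x+b-i)}\,\delta_{\lambda^{a,b}(x)}.$$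 For a polynomial $r$ and a measure $\mu$, $r\mu$ is the measure with density $r$ with respect to $\mu$ (the mass at each point $y$ is multiplied by $r(y)$). Auxiliary functions: for $u\in\mathbb N$, $$\varphi_u^{a,b,N}(s,x)=(-a+1,-N)_{\max(u,a+b-u-1)}\sum_{j=0}^u\frac{(-u)_j(u-s-a-b+1)_j(-x)_j}{(-a-s+1)_j(-N)_j\,j!}.$$ Polynomials $W_g^{a,b,N;\mathcal M}(x)$, $g\ge 0$: - if $\lceil\frac{a+b}2\rceil\le g\le a-1$: $W_g^{a,b,N;\mathcal M}(x)=\frac{\partial}{\partial s}\varphi_g^{a,b,-2-N}(0,x)-\frac{\partial}{\partial s}\varphi_{a+b-g-1}^{a,b,-2-N}(0,x)$; - if $a\le g\le a+b-1$: $$W_g^{a,b,N;\mathcal M}(x)=(-1)^{b+g}(g-b)!\Big[(b+a-g-1)!\,(-x)_a\,h_{g-a}^{a,-b,-2-N-a}(x-a)+\frac{(g-a)!\,(N+a+b+1-g)_{2g-a-b+1}}{M_{g-a}-1}\,h_{a+b-g-1}^{-a,-b,-2-N}(x)\Big];$$ - otherwise $W_g^{a,b,N;\mathcal M}(x)=h_g^{-a,-b,-2-N}(x)$. *)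

theory Defs
  imports
    "HOL-Analysis.Derivative"
    "HOL-Computational_Algebra.Polynomial"
    "HOL-Library.Poly_Mapping"
    "Jordan_Normal_Form.Determinant"
begin

text \<open>
  All measures in play are finite complex combinations of unit point masses. Such a measure is a
  finitely supported function sending each point to its mass; \<open>Poly_Mapping.single y m\<close> is
  m times the unit point mass at y, and measures are added pointwise.
\<close>

type_synonym point_measure = "complex \<Rightarrow>\<^sub>0 complex"

definition pm_integral :: "point_measure \<Rightarrow> (complex \<Rightarrow> complex) \<Rightarrow> complex" where
  "pm_integral \<mu> f = (\<Sum>y\<in>Poly_Mapping.keys \<mu>. f y * Poly_Mapping.lookup \<mu> y)"

definition pm_density :: "complex poly \<Rightarrow> point_measure \<Rightarrow> point_measure" where
  "pm_density r \<mu> = Poly_Mapping.mapp (\<lambda>y m. poly r y * m) \<mu>"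

lemma lookup_pm_density:
  "Poly_Mapping.lookup (pm_density r \<mu>) y = poly r y * Poly_Mapping.lookup \<mu> y"
  by (simp add: pm_density_def lookup_mapp when_def in_keys_iff)

text \<open>The pairing is bilinear: there is no complex conjugation.\<close>

definition pairing :: "point_measure \<Rightarrow> complex poly \<Rightarrow> complex poly \<Rightarrow> complex" where
  "pairing \<mu> p q = pm_integral \<mu> (\<lambda>x. poly p x * poly q x)"

definition orthogonal_seq :: "point_measure \<Rightarrow> nat \<Rightarrow> (nat \<Rightarrow> complex poly) \<Rightarrow> bool" where
  "orthogonal_seq \<mu> K p \<longleftrightarrow>
     (\<forall>n\<le>K. degree (p n) = n) \<and>
     (\<forall>n\<le>K. \<forall>m\<le>K. n \<noteq> m \<longrightarrow> pairing \<mu> (p n) (p m) = 0) \<and>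
     (\<forall>n\<le>K. pairing \<mu> (p n) (p n) \<noteq> 0)"

definition lex_less :: "complex \<Rightarrow> complex \<Rightarrow> bool" where
  "lex_less u w \<longleftrightarrow> Re u < Re w \<or> (Re u = Re w \<and> Im u < Im w)"

definition lex_le :: "complex \<Rightarrow> complex \<Rightarrow> bool" where
  "lex_le u w \<longleftrightarrow> lex_less u w \<or> u = w"

lemma linorder_lex: "class.linorder lex_le lex_less"
  by unfold_locales (auto simp: lex_le_def lex_less_def complex_eq_iff)

definition lex_list :: "complex set \<Rightarrow> complex list" where
  "lex_list U = linorder.sorted_list_of_set lex_le U"

lemma lex_list:
  assumes "finite U"
  shows "set (lex_list U) = U" "sorted_wrt lex_less (lex_list U)" "length (lex_list U) = card U"
  using assms
  by (simp_all add: lex_list_def linorder.set_sorted_list_of_set[OF linorder_lex]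
      linorder.strict_sorted_list_of_set[OF linorder_lex]
      linorder.length_sorted_list_of_set[OF linorder_lex])

definition lam :: "complex \<Rightarrow> complex \<Rightarrow> complex \<Rightarrow> complex" where
  "lam a b x = x * (x + a + b + 1)"

definition dual_hahn :: "complex \<Rightarrow> complex \<Rightarrow> complex \<Rightarrow> int \<Rightarrow> complex poly" where
  "dual_hahn a b N k =
     (if k < 0 then 0 else
        let n = nat k in
        \<Sum>j\<le>n. smult
          (pochhammer (- of_nat n) j * pochhammer (- N + of_nat j) (n - j)
             * pochhammer (a + of_nat j + 1) (n - j) / (fact n * (-1) ^ j * fact j))
          (\<Prod>i<j. [:- (of_nat i * (a + b + 1 + of_nat i)), 1:]))"

definition hahn :: "complex \<Rightarrow> complex \<Rightarrow> complex \<Rightarrow> nat \<Rightarrow> complex \<Rightarrow> complex" where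
  "hahn a b N n x =
     (\<Sum>j\<le>n. pochhammer (- of_nat n) j * pochhammer (a + b + of_nat n + 1) j
        * pochhammer (- N + of_nat j) (n - j) * pochhammer (a + of_nat j + 1) (n - j)
        * pochhammer (- x) j / fact j)"

text \<open>The subscripts of the masses are in the order b, a, N.\<close>

definition dual_hahn_mass :: "nat \<Rightarrow> nat \<Rightarrow> nat \<Rightarrow> nat \<Rightarrow> complex" where
  "dual_hahn_mass b a N x =
     of_nat (2 * x + a + b + 1) * pochhammer (of_nat b + 1) x * pochhammer (- of_nat N) x * fact N
     / ((-1) ^ x * pochhammer (of_nat (x + a + b + 1)) (N + 1) * pochhammer (of_nat a + 1) x
          * fact x)"

definition nu :: "nat \<Rightarrow> nat \<Rightarrow> nat \<Rightarrow> (nat \<Rightarrow> real) \<Rightarrow> point_measure" where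
  "nu a b N M =
     (\<Sum>x\<in>{- int b..- 1}.
        Poly_Mapping.single (lam (of_nat a) (of_nat b) (of_int x))
          (of_int (2 * x + int a + int b + 1)
             * pochhammer (of_int (int N + 1 - x)) (nat (x + int b))
             / pochhammer (of_nat (N + b + 1)) (nat (x + int a + 1))
             * complex_of_real (M (nat (x + int b)))))
   + (\<Sum>x\<in>{0..N}.
        Poly_Mapping.single (lam (of_nat a) (of_nat b) (of_nat x))
          ((pochhammer (of_nat N + 1) b)\<^sup>2 / pochhammer (of_nat b + 1) (a - b)
             * (dual_hahn_mass b a N x
                  / (\<Prod>i<b. (of_nat x + of_nat a + of_nat i + 1)
                             * (of_nat x + of_nat b - of_nat i)))))"

definition christoffel_poly :: "nat \<Rightarrow> nat \<Rightarrow> complex set \<Rightarrow> complex poly" where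
  "christoffel_poly a b U = (\<Prod>u\<in>U. [:- lam (of_nat a) (of_nat b) u, 1:])"

definition nu_U :: "nat \<Rightarrow> nat \<Rightarrow> nat \<Rightarrow> (nat \<Rightarrow> real) \<Rightarrow> complex set \<Rightarrow> point_measure" where
  "nu_U a b N M U = pm_density (christoffel_poly a b U) (nu a b N M)"

definition n_S :: "nat \<Rightarrow> nat \<Rightarrow> nat \<Rightarrow> complex set \<Rightarrow> nat" where
  "n_S a b N U =
     card ((\<lambda>i. lam (of_nat a) (of_nat b) (of_int i)) ` {- int b..int N}
           - lam (of_nat a) (of_nat b) ` U)"

text \<open>
  When \<open>a + b - u - 1\<close> is negative the maximum below is u, which truncated subtraction respects.
\<close>

definition phi :: "nat \<Rightarrow> nat \<Rightarrow> complex \<Rightarrow> nat \<Rightarrow> complex \<Rightarrow> complex \<Rightarrow> complex" where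
  "phi a b N u s x =
     pochhammer (- of_nat a + 1) (max u (a + b - u - 1))
     * pochhammer (- N) (max u (a + b - u - 1))
     * (\<Sum>j\<le>u. pochhammer (- of_nat u) j * pochhammer (of_nat u - s - of_nat a - of_nat b + 1) j
                * pochhammer (- x) j
                / (pochhammer (- of_nat a - s + 1) j * pochhammer (- N) j * fact j))"

definition W_fun :: "nat \<Rightarrow> nat \<Rightarrow> nat \<Rightarrow> (nat \<Rightarrow> real) \<Rightarrow> nat \<Rightarrow> complex \<Rightarrow> complex" where
  "W_fun a b N M g x =
     (if \<lceil>(real a + real b) / 2\<rceil> \<le> int g \<and> int g \<le> int a - 1 then
        deriv (\<lambda>s. phi a b (- 2 - of_nat N) g s x) 0
        - deriv (\<lambda>s. phi a b (- 2 - of_nat N) (a + b - g - 1) s x) 0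
      else if a \<le> g \<and> int g \<le> int a + int b - 1 then
        (-1) ^ (b + g) * fact (g - b) *
          (fact (b + a - g - 1) * pochhammer (- x) a
             * hahn (of_nat a) (- of_nat b) (- 2 - of_nat N - of_nat a) (g - a) (x - of_nat a)
           + fact (g - a) * pochhammer (of_nat N + of_nat a + of_nat b + 1 - of_nat g)
                                       (2 * g - a - b + 1)
               / (complex_of_real (M (g - a)) - 1)
             * hahn (- of_nat a) (- of_nat b) (- 2 - of_nat N) (a + b - g - 1) x)
      else hahn (- of_nat a) (- of_nat b) (- 2 - of_nat N) g x)"

text \<open>
  Library matrices are indexed from 0; the column number j below runs from 1.
\<close>

definition Phi :: "nat \<Rightarrow> nat \<Rightarrow> nat \<Rightarrow> (nat \<Rightarrow> real) \<Rightarrow> complex set \<Rightarrow> nat \<Rightarrow> complex" where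
  "Phi a b N M U n = (let nU = card U in
     Determinant.det (Matrix.mat (a + nU) (a + nU) (\<lambda>(r, c). let j = c + 1 in
       if r < a then
         pochhammer (of_int (int b + int N - int n - int nU + int j + 1)) (a + nU - j)
           * W_fun a b N M (b + r) (of_int (- int n - int nU + int j - 1))
       else
         (-1) ^ j * poly (dual_hahn (of_nat a) (of_nat b) (of_nat N) (int n + int nU - int j))
                         (lam (of_nat a) (of_nat b) (lex_list U ! (r - a))))))"

definition q_num ::
    "nat \<Rightarrow> nat \<Rightarrow> nat \<Rightarrow> (nat \<Rightarrow> real) \<Rightarrow> complex set \<Rightarrow> nat \<Rightarrow> complex poly" where
  "q_num a b N M U n = (let nU = card U in
     Determinant.det (Matrix.mat (a + nU + 1) (a + nU + 1) (\<lambda>(r, c). let j = c + 1 in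
       if r = 0 then
         (-1) ^ (j - 1) * dual_hahn (of_nat a) (of_nat b) (of_nat N) (int n + int nU - int j + 1)
       else if r \<le> a then
         [:pochhammer (of_int (int b + int N - int n - int nU + int j)) (a + nU + 1 - j)
             * W_fun a b N M (b + (r - 1)) (of_int (- int n - int nU + int j - 2)):]
       else
         [:(-1) ^ (j - 1)
             * poly (dual_hahn (of_nat a) (of_nat b) (of_nat N) (int n + int nU - int j + 1))
                    (lam (of_nat a) (of_nat b) (lex_list U ! (r - a - 1))):])))"

definition q_poly :: "nat \<Rightarrow> nat \<Rightarrow> nat \<Rightarrow> (nat \<Rightarrow> real) \<Rightarrow> complex set \<Rightarrow> nat \<Rightarrow> complex poly" where
  "q_poly a b N M U n = q_num a b N M U n div christoffel_poly a b U"

end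

theory Submission
  imports Defs
begin

text \<open>
  For all parameters equal to 1 the masses of \<open>nu\<close> at \<open>lam x\<close>, \<open>- b \<le> x \<le> N\<close>, share one formula,
  \<open>(2 x + a + b + 1) (N + b)!^2 / ((N - x)! (N + x + a + b + 1)!)\<close>, and summation by parts gives
  the moments of the dual Hahn polynomials \<open>R_m\<close> in closed form:
  \<open>(-1)^m / (N + b - m)!\<close> times a polynomial of degree \<open>a - 1\<close> in \<open>m\<close>.
  In the variable \<open>x = - m - 1\<close> the three-term recurrence of \<open>R_m\<close> becomes the Hahn difference
  operator, for which the span of the W is invariant; the values of \<open>R_m\<close> at the \<open>b\<close> free points
  account for the parameters. Hence all moments \<open>\<langle>R_m, y^k\<rangle>\<close> with \<open>m > k - a\<close> are combinations of
  the W rows, and a determinant with a row of moments on top vanishes for \<open>k < n\<close>. For \<open>k = n\<close> only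
  its last column survives; the cofactor there is \<open>Phi (n + 1)\<close>, while the leading coefficient is
  \<open>Phi n\<close>. Since \<open>Phi 0\<close> never vanishes, existence of the orthogonal sequence forces all \<open>Phi n\<close>
  to be nonzero by induction.
\<close>

text \<open>The obstacle is that eigenvalues of the Hahn operator coincide: the degrees
  \<open>j\<close> and \<open>a + b - 1 - j\<close> share one. For \<open>b <= g < a\<close> the
  partner degree lies in the same range, Hahn polynomials alone do not span the degrees below
  \<open>a\<close>, and the derivative in \<open>s\<close> supplies the missing generalised
  eigenvectors. For \<open>g = a + i\<close> the partner is \<open>b - 1 - i\<close>, and there are
  two honest eigenfunctions: a polynomial of degree \<open>b - 1 - i\<close>, and a multiple of
  \<open>pochhammer (- x) a\<close>, which in the variable \<open>m\<close> is the sequence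
  \<open>R_m\<close> at the i-th free point. Neither of them is a row by itself;
  \<open>W_(a+i)\<close> is one combination of the two, with a ratio that depends on
  \<open>M i - 1\<close>. The moments fit into the span of the rows because the coefficient of the
  degree \<open>b - 1 - i\<close> polynomial in \<open>pochhammer (- x) (a - 1)\<close> has exactly
  the right value. Computing that coefficient is the central calculation.\<close>

definition inv_fact :: "int \<Rightarrow> complex" where
  "inv_fact k = (if k < 0 then 0 else 1 / fact (nat k))"

lemma inv_fact_of_nat [simp]: "inv_fact (int n) = 1 / fact n"
  by (simp add: inv_fact_def)

lemma inv_fact_0 [simp]: "inv_fact 0 = 1"
  by (simp add: inv_fact_def)

lemma inv_fact_neg [simp]: "k < 0 \<Longrightarrow> inv_fact k = 0"
  by (simp add: inv_fact_def)

text \<open>\<open>inv_fact k\<close> is \<open>1 / Gamma (k + 1)\<close> restricted to the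
  integers. With the value 0 below zero this step relation crosses the edge as well, so the weights
  obey their recurrences past \<open>m = N + b\<close>.\<close>

lemma inv_fact_pred: "inv_fact (k - 1) = of_int k * inv_fact k"
proof (cases "k \<le> 0")
  case True
  then show ?thesis by (auto simp: inv_fact_def)
next
  case False
  define n where "n = nat (k - 1)"
  have "k = int (Suc n)" using False by (simp add: n_def)
  then have "k - 1 = int n" by simp
  then show ?thesis
    by (simp only: \<open>k = int (Suc n)\<close> inv_fact_of_nat)
      (simp add: field_simps of_nat_neq_0 del: of_nat_Suc flip: of_nat_Suc)
qed

lemma inv_fact_succ: "of_int (k + 1) * inv_fact (k + 1) = inv_fact k"
  using inv_fact_pred[of "k + 1"] by simp

text \<open>If \<open>k < 0\<close>, the product runs through zero and both sides vanish. This turns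
  the Pochhammer factors of the matrix entries into the reciprocal factorials of the
  weights.\<close>

lemma pochhammer_eq_inv_fact:
  assumes "0 \<le> k + int t"
  shows "pochhammer (of_int (k + 1)) t = fact (nat (k + int t)) * inv_fact k"
  using assms
proof (induction t arbitrary: k)
  case 0
  then show ?case by (auto simp: inv_fact_def)
next
  case (Suc t)
  have "pochhammer (of_int (k + 1) :: complex) (Suc t)
      = of_int (k + 1) * pochhammer (of_int ((k + 1) + 1)) t"
    by (simp add: pochhammer_rec add_ac)
  also have "\<dots> = of_int (k + 1) * (fact (nat (k + int (Suc t))) * inv_fact (k + 1))"
    using Suc.IH[of "k + 1"] Suc.prems by (simp add: add_ac)
  also have "\<dots> = fact (nat (k + int (Suc t))) * inv_fact k"
    using inv_fact_succ[of k] by (simp add: mult_ac)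
  finally show ?case .
qed

section \<open>Reflection and Vandermonde sums for Pochhammer symbols\<close>

lemma pochhammer_flip: "pochhammer x n = (-1) ^ n * pochhammer (1 - x - of_nat n) n"
  for x :: "'a :: comm_ring_1"
  using pochhammer_minus[of "- x" n] by (simp add: algebra_simps)

text \<open>Reflecting the second Pochhammer symbol turns the alternating sum into the binomial
  theorem for rising factorials. It yields the boundary value in the summation by parts and the
  normalisation of \<open>shifted_hahn\<close>.\<close>

lemma pochhammer_vandermonde:
  fixes A B :: "'a :: comm_ring_1"
  shows "(\<Sum>j\<le>n. of_nat (n choose j) * (-1) ^ j * pochhammer A j * pochhammer (B + of_nat j) (n - j))
    = pochhammer (B - A) n"
proof -
  have "(\<Sum>j\<le>n. of_nat (n choose j) * (-1) ^ j * pochhammer A j * pochhammer (B + of_nat j) (n - j))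
      = (\<Sum>j\<le>n. (-1) ^ n * (of_nat (n choose j) * pochhammer A j * pochhammer (1 - B - of_nat n) (n - j)))"
  proof (rule sum.cong, goal_cases)
    case (2 j)
    then have "pochhammer (B + of_nat j) (n - j) = (-1) ^ (n - j) * pochhammer (1 - B - of_nat n) (n - j)"
      by (subst pochhammer_flip) (simp add: of_nat_diff algebra_simps)
    moreover have "(-1 :: 'a) ^ n = (-1) ^ j * (-1) ^ (n - j)"
      using 2 by (simp flip: power_add)
    ultimately show ?case by (simp add: mult_ac)
  qed simp
  also have "\<dots> = (-1) ^ n * pochhammer (A + (1 - B - of_nat n)) n"
    by (simp add: pochhammer_binomial_sum sum_distrib_left)
  also have "\<dots> = pochhammer (B - A) n"
    by (subst (2) pochhammer_flip) (simp add: algebra_simps)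
  finally show ?thesis .
qed

lemma pochhammer_minus_of_nat:
  "pochhammer (- of_nat n) j / fact j = (-1) ^ j * (of_nat (n choose j) :: 'a :: field_char_0)"
  using gbinomial_pochhammer[of "of_nat n :: 'a" j] by (simp add: binomial_gbinomial)

subsection \<open>Dual Hahn polynomials\<close>

text \<open>The factor \<open>pochhammer (- n) j / (fact n * (-1) ^ j)\<close> of
  \<open>dual_hahn\<close> collapses to \<open>1 / fact (n - j)\<close>. With the value 0 for
  \<open>j > k\<close>, the degree \<open>k\<close> may be any integer.\<close>

definition dh_coef :: "complex \<Rightarrow> complex \<Rightarrow> int \<Rightarrow> nat \<Rightarrow> complex" where
  "dh_coef a N k j = (if int j \<le> k then
     pochhammer (- N + of_nat j) (nat k - j) * pochhammer (a + of_nat j + 1) (nat k - j)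
       / (fact (nat k - j) * fact j) else 0)"

text \<open>The Newton basis with nodes \<open>lam a b i\<close>.\<close>

definition dh_basis :: "complex \<Rightarrow> complex \<Rightarrow> nat \<Rightarrow> complex poly" where
  "dh_basis a b j = (\<Prod>i<j. [:- (of_nat i * (a + b + 1 + of_nat i)), 1:])"

text \<open>The bound \<open>J\<close> is free so that three neighbouring degrees can be expanded
  over one common range.\<close>

lemma dual_hahn_expand:
  assumes "k < int J"
  shows "dual_hahn a b N k = (\<Sum>j<J. smult (dh_coef a N k j) (dh_basis a b j))"
proof (cases "k < 0")
  case True
  then show ?thesis by (simp add: dual_hahn_def dh_coef_def)
next
  case False
  define n where "n = nat k"
  have k: "k = int n" using False by (simp add: n_def)
  have c: "pochhammer (- of_nat n) j * pochhammer (- N + of_nat j) (n - j)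
             * pochhammer (a + of_nat j + 1) (n - j) / (fact n * (-1) ^ j * fact j)
           = dh_coef a N k j" if "j \<le> n" for j
  proof -
    have "pochhammer (- of_nat n) j / (fact n * (-1) ^ j * fact j) = (of_nat (n choose j) :: complex) / fact n"
      using pochhammer_minus_of_nat[of n j, where 'a = complex] by (simp add: field_simps)
    also have "\<dots> = 1 / (fact (n - j) * fact j)"
      using that by (simp add: binomial_fact field_simps)
    finally show ?thesis using that by (simp add: dh_coef_def k field_simps)
  qed
  have "dual_hahn a b N k = (\<Sum>j\<le>n. smult (dh_coef a N k j) (dh_basis a b j))"
    using False c by (simp add: dual_hahn_def n_def dh_basis_def Let_def)
  also have "\<dots> = (\<Sum>j<J. smult (dh_coef a N k j) (dh_basis a b j))"
    using assms by (intro sum.mono_neutral_left) (auto simp: dh_coef_def k)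
  finally show ?thesis .
qed

lemma poly_dh_basis_Suc:
  "poly (dh_basis a b (Suc j)) y = (y - of_nat j * (a + b + 1 + of_nat j)) * poly (dh_basis a b j) y"
  by (simp add: dh_basis_def algebra_simps)

lemma poly_dual_hahn:
  assumes "k < int J"
  shows "poly (dual_hahn a b N k) y = (\<Sum>j<J. dh_coef a N k j * poly (dh_basis a b j) y)"
  by (simp add: dual_hahn_expand[OF assms] poly_sum)

lemma dual_hahn_neg: "k < 0 \<Longrightarrow> dual_hahn a b N k = 0"
  by (simp add: dual_hahn_def)

lemma dual_hahn_0: "dual_hahn a b N 0 = 1"
  by (simp add: dual_hahn_def)

lemma dh_basis_degree: "degree (dh_basis a b j) = j" and dh_basis_coeff: "coeff (dh_basis a b j) j = 1"
proof -
  have "degree (dh_basis a b j) = j \<and> coeff (dh_basis a b j) j = 1"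
  proof (induction j)
    case 0
    then show ?case by (simp add: dh_basis_def)
  next
    case (Suc j)
    have e: "dh_basis a b (Suc j) = dh_basis a b j * [:- (of_nat j * (a + b + 1 + of_nat j)), 1:]"
      by (simp add: dh_basis_def mult_ac)
    have nz: "dh_basis a b j \<noteq> 0" using Suc by auto
    have d: "degree (dh_basis a b (Suc j)) = Suc j"
      unfolding e using nz Suc by (subst degree_mult_eq) auto
    have "lead_coeff (dh_basis a b (Suc j)) = 1"
      unfolding e lead_coeff_mult using Suc by simp
    then show ?case using d by simp
  qed
  then show "degree (dh_basis a b j) = j" "coeff (dh_basis a b j) j = 1" by auto
qed


lemma dual_hahn_degree_le: "degree (dual_hahn a b N k) \<le> nat k"
proof -
  have "k < int (Suc (nat k))" by simp
  show ?thesis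
    unfolding dual_hahn_expand[OF \<open>k < int (Suc (nat k))\<close>]
    by (intro degree_sum_le) (auto intro!: order_trans[OF degree_smult_le] simp: dh_basis_degree)
qed

lemma dual_hahn_coeff: "coeff (dual_hahn a b N (int k)) k = 1 / fact k"
proof -
  have "int k < int (Suc k)" by simp
  have "coeff (dual_hahn a b N (int k)) k
      = (\<Sum>j<Suc k. dh_coef a N (int k) j * coeff (dh_basis a b j) k)"
    unfolding dual_hahn_expand[OF \<open>int k < int (Suc k)\<close>] by (simp add: coeff_sum)
  also have "\<dots> = dh_coef a N (int k) k"
    by (simp add: dh_basis_coeff dh_basis_degree coeff_eq_0)
  also have "\<dots> = 1 / fact k" by (simp add: dh_coef_def)
  finally show ?thesis .
qed

definition rec_B :: "complex \<Rightarrow> complex \<Rightarrow> complex \<Rightarrow> complex \<Rightarrow> complex" where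
  "rec_B a b N m = - (m + a + 1) * (m - N) - m * (m - b - N - 1)"

definition rec_C :: "complex \<Rightarrow> complex \<Rightarrow> complex \<Rightarrow> complex \<Rightarrow> complex" where
  "rec_C a b N m = (m - b - N - 1) * (m - N - 1) * (m + a)"

lemma dh_coef_shift:
  "dh_coef a N (int (j + s)) j
    = pochhammer (- N + of_nat j) s * pochhammer (a + of_nat j + 1) s / (fact s * fact j)"
  by (simp add: dh_coef_def nat_add_distrib)

text \<open>The three-term recurrence, read coefficientwise: multiplication by \<open>y\<close>
  sends the basis element \<open>j\<close> to the element \<open>j + 1\<close> plus its node times
  itself, hence the neighbour \<open>j - 1\<close> on the left.\<close>

lemma dh_coef_rec:
  "(if j = 0 then 0 else dh_coef a N k (j - 1)) + of_nat j * (a + b + 1 + of_nat j) * dh_coef a N k j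
    = of_int (k + 1) * dh_coef a N (k + 1) j + rec_B a b N (of_int k) * dh_coef a N k j
      + rec_C a b N (of_int k) * dh_coef a N (k - 1) j"
proof -
  consider "int j > k + 1" | "int j = k + 1" | s where "k = int (j + s)"
    by (metis add_diff_cancel_left' linorder_not_less nat_int_comparison(2) not_less_iff_gr_or_eq of_nat_add zle_iff_zadd zless_imp_add1_zle)
  then show ?thesis
  proof cases
    case 1
    then show ?thesis by (auto simp: dh_coef_def)
  next
    case 2
    then have k: "k = int j - 1" by simp
    show ?thesis
    proof (cases j)
      case 0
      then show ?thesis by (simp add: k dh_coef_def)
    next
      case (Suc i)
      moreover have "(1 + of_nat i :: complex) \<noteq> 0"
        using of_nat_neq_0[of i, where 'a = complex] by simp
      ultimately show ?thesis
        by (simp add: k dh_coef_def divide_simps)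
    qed
  next
    case 3
    define x where "x = - N + of_nat j"
    define z where "z = a + of_nat j + 1"
    have N: "N = of_nat j - x" and a: "a = z - of_nat j - 1" by (simp_all add: x_def z_def)
    have c0: "dh_coef a N k j = pochhammer x s * pochhammer z s / (fact s * fact j)"
      using dh_coef_shift[of a N j s] by (simp add: 3 x_def z_def)
    have c1: "dh_coef a N (k + 1) j = pochhammer x (Suc s) * pochhammer z (Suc s) / (fact (Suc s) * fact j)"
      using dh_coef_shift[of a N j "Suc s"] by (simp add: 3 x_def z_def add_ac)
    have cj: "(if j = 0 then 0 else dh_coef a N k (j - 1))
        = of_nat j * (pochhammer (x - 1) (Suc s) * pochhammer (z - 1) (Suc s)) / (fact (Suc s) * fact j)"
    proof (cases j)
      case (Suc i)
      have "dh_coef a N k i = pochhammer (- N + of_nat i) (Suc s) * pochhammer (a + of_nat i + 1) (Suc s)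
          / (fact (Suc s) * fact i)"
        using dh_coef_shift[of a N i "Suc s"] by (simp add: 3 Suc add_ac)
      moreover have "(1 + of_nat i :: complex) \<noteq> 0"
        using of_nat_neq_0[of i, where 'a = complex] by simp
      moreover have e: "x - 1 = - N + of_nat i" "z - 1 = a + of_nat i + 1"
        by (simp_all add: x_def z_def Suc)
      ultimately show ?thesis unfolding e fact_Suc of_nat_Suc Suc by (simp add: mult.assoc)
    qed simp
    have km: "of_int k = (of_nat j + of_nat s :: complex)" by (simp add: 3)
    have px: "pochhammer (x - 1) (Suc s) = (x - 1) * pochhammer x s"
      and pz: "pochhammer (z - 1) (Suc s) = (z - 1) * pochhammer z s" by (simp_all add: pochhammer_rec)
    have sn: "(1 + of_nat s :: complex) \<noteq> 0"
      using of_nat_neq_0[of s, where 'a = complex] by simp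
    show ?thesis
    proof (cases s)
      case 0
      have "dh_coef a N (k - 1) j = 0" by (simp add: 3 0 dh_coef_def)
      then show ?thesis unfolding c0 c1 cj km px pz
        using km by (simp add: 0 rec_B_def rec_C_def N a field_simps)
    next
      case (Suc t)
      have cm: "dh_coef a N (k - 1) j = pochhammer x t * pochhammer z t / (fact t * fact j)"
        using dh_coef_shift[of a N j t] by (simp add: 3 Suc x_def z_def)
      have tn: "(1 + of_nat t :: complex) \<noteq> 0" "(2 + of_nat t :: complex) \<noteq> 0"
        using of_nat_neq_0[of t, where 'a = complex] of_nat_neq_0[of "Suc t", where 'a = complex] by simp_all
      \<comment> \<open>All coefficients are rational multiples of \<open>Q\<close>, the one at
        \<open>k - 1\<close>, which leaves an identity of rational functions. For
        \<open>s = 0\<close> the coefficient at \<open>k - 1\<close> is 0 and cannot serve as the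
        unit; hence the separate case above.\<close>
      define Q where "Q = pochhammer x t * pochhammer z t / (fact t * fact j)"
      have e0: "dh_coef a N k j = Q * ((x + of_nat t) * (z + of_nat t) / (1 + of_nat t))"
        unfolding c0 Q_def by (simp add: Suc pochhammer_Suc mult_ac)
      have e1: "dh_coef a N (k + 1) j = Q * ((x + of_nat t) * (z + of_nat t) * (x + of_nat t + 1) * (z + of_nat t + 1)
          / ((1 + of_nat t) * (2 + of_nat t)))"
        unfolding c1 Q_def by (simp add: Suc pochhammer_Suc add_ac mult_ac)
      have ej: "(if j = 0 then 0 else dh_coef a N k (j - 1))
        = Q * (of_nat j * (x - 1) * (z - 1) * (x + of_nat t) * (z + of_nat t)
          / ((1 + of_nat t) * (2 + of_nat t)))"
        unfolding cj px pz Q_def by (simp add: Suc pochhammer_Suc mult_ac)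
      have km': "of_int k = (of_nat j + of_nat t + 1 :: complex)" by (simp add: km Suc)
      have em: "dh_coef a N (k - 1) j = Q" by (simp add: cm Q_def)
      define u v w where "u = (of_nat j :: complex)" and "v = (of_nat t :: complex)" and "w = 1 + v"
      have core: "u * (x - 1) * (z - 1) * (x + v) * (z + v) / ((1 + v) * (2 + v))
           + u * (a + b + 1 + u) * ((x + v) * (z + v) / (1 + v))
         = (u + v + 2) * ((x + v) * (z + v) * (x + v + 1) * (z + v + 1) / ((1 + v) * (2 + v)))
           + rec_B a b N (u + v + 1) * ((x + v) * (z + v) / (1 + v)) + rec_C a b N (u + v + 1)"
        using tn unfolding rec_B_def rec_C_def N a u_def[symmetric] v_def[symmetric]
        by (simp add: divide_simps) (simp add: algebra_simps)
      have "Q * (u * (x - 1) * (z - 1) * (x + v) * (z + v) / ((1 + v) * (2 + v)))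
           + u * (a + b + 1 + u) * (Q * ((x + v) * (z + v) / (1 + v)))
         = (u + v + 2) * (Q * ((x + v) * (z + v) * (x + v + 1) * (z + v + 1) / ((1 + v) * (2 + v))))
           + rec_B a b N (u + v + 1) * (Q * ((x + v) * (z + v) / (1 + v))) + rec_C a b N (u + v + 1) * Q"
        using arg_cong[OF core, of "\<lambda>r. Q * r"] by (simp add: algebra_simps)
      then show ?thesis
        unfolding ej e0 e1 em of_int_add km' u_def v_def by (simp add: add_ac)
    qed
  qed
qed

text \<open>This holds for every integer \<open>k\<close>: at \<open>k = - 1\<close> the factor
  \<open>k + 1\<close> removes \<open>R_0\<close>, and below that all terms vanish.\<close>

lemma dual_hahn_rec:
  "y * poly (dual_hahn a b N k) y
    = of_int (k + 1) * poly (dual_hahn a b N (k + 1)) y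
      + rec_B a b N (of_int k) * poly (dual_hahn a b N k) y
      + rec_C a b N (of_int k) * poly (dual_hahn a b N (k - 1)) y"
proof -
  define J where "J = nat (k + 1) + 1"
  define P where "P j = poly (dh_basis a b j) y" for j
  define r where "r = dh_coef a N k"
  have J: "k < int J" "k + 1 < int J" "k - 1 < int J" by (auto simp: J_def)
  have "y * poly (dual_hahn a b N k) y
      = (\<Sum>j<J. r j * P (Suc j)) + (\<Sum>j<J. of_nat j * (a + b + 1 + of_nat j) * r j * P j)"
    unfolding poly_dual_hahn[OF J(1)] sum_distrib_left sum.distrib[symmetric]
    by (intro sum.cong) (simp_all add: P_def r_def poly_dh_basis_Suc algebra_simps)
  also have "(\<Sum>j<J. r j * P (Suc j)) = (\<Sum>j<Suc J. (if j = 0 then 0 else r (j - 1)) * P j)"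
    by (simp only: sum.lessThan_Suc_shift) simp
  \<comment> \<open>The top term \<open>j = J\<close> drops because
    \<open>J - 1 = nat (k + 1)\<close> exceeds \<open>k\<close>.\<close>
  also have "\<dots> = (\<Sum>j<J. (if j = 0 then 0 else r (j - 1)) * P j)"
    by (simp add: J_def r_def dh_coef_def)
  also have "\<dots> + (\<Sum>j<J. of_nat j * (a + b + 1 + of_nat j) * r j * P j)
     = (\<Sum>j<J. ((if j = 0 then 0 else r (j - 1)) + of_nat j * (a + b + 1 + of_nat j) * r j) * P j)"
    by (simp add: sum.distrib ring_distribs)
  also have "\<dots> = of_int (k + 1) * poly (dual_hahn a b N (k + 1)) y
      + rec_B a b N (of_int k) * poly (dual_hahn a b N k) y
      + rec_C a b N (of_int k) * poly (dual_hahn a b N (k - 1)) y"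
    unfolding r_def dh_coef_rec
    unfolding poly_dual_hahn[OF J(1)] poly_dual_hahn[OF J(2)] poly_dual_hahn[OF J(3)]
    by (simp add: P_def sum_distrib_left ring_distribs sum.distrib mult_ac)
  finally show ?thesis .
qed

text \<open>\<open>lam a b z - lam a b i\<close> factors as
  \<open>(z - i) * (z + i + a + b + 1)\<close>.\<close>

lemma poly_dh_basis_lam:
  "poly (dh_basis a b j) (lam a b z) = (-1) ^ j * pochhammer (- z) j * pochhammer (z + a + b + 1) j"
proof (induction j)
  case 0
  then show ?case by (simp add: dh_basis_def)
next
  case (Suc j)
  then show ?case
    by (simp add: poly_dh_basis_Suc pochhammer_Suc lam_def algebra_simps)
qed

text \<open>At neighbouring lattice points the products \<open>pochhammer (- z) j\<close> and
  \<open>pochhammer (z + a + b + 1) j\<close> share all but their outermost factors. The difference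
  of a basis element is therefore a multiple of the element one degree lower with \<open>a\<close>
  raised by one, and the coefficients fit once \<open>N\<close> is lowered by one.\<close>

lemma dual_hahn_forward_shift:
  "poly (dual_hahn a b N (int (Suc m))) (lam a b z) - poly (dual_hahn a b N (int (Suc m))) (lam a b (z - 1))
    = (2 * z + a + b) * poly (dual_hahn (a + 1) b (N - 1) (int m)) (lam (a + 1) b (z - 1))"
proof -
  have "poly (dual_hahn a b N (int (Suc m))) (lam a b z) - poly (dual_hahn a b N (int (Suc m))) (lam a b (z - 1))
     = (\<Sum>j<Suc (Suc m). dh_coef a N (int (Suc m)) j
        * (poly (dh_basis a b j) (lam a b z) - poly (dh_basis a b j) (lam a b (z - 1))))"
    by (simp only: poly_dual_hahn[of "int (Suc m)" "Suc (Suc m)"] sum_subtractf right_diff_distrib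
        lessI of_nat_less_iff)
  also have "\<dots> = (\<Sum>j<Suc m. dh_coef a N (int (Suc m)) (Suc j)
        * (poly (dh_basis a b (Suc j)) (lam a b z) - poly (dh_basis a b (Suc j)) (lam a b (z - 1))))"
    by (subst sum.lessThan_Suc_shift) (simp add: dh_basis_def)
  also have "\<dots> = (\<Sum>j<Suc m. (2 * z + a + b) * (dh_coef (a + 1) (N - 1) (int m) j
        * poly (dh_basis (a + 1) b j) (lam (a + 1) b (z - 1))))"
  proof (rule sum.cong, goal_cases)
    case (2 j)
    have n: "(1 + of_nat j :: complex) \<noteq> 0"
      using of_nat_neq_0[of j, where 'a = complex] by simp
    have c: "dh_coef a N (int (Suc m)) (Suc j) * (1 + of_nat j) = dh_coef (a + 1) (N - 1) (int m) j"
    proof -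
      have e: "- N + of_nat (Suc j) = - (N - 1) + of_nat j" "a + of_nat (Suc j) + 1 = a + 1 + of_nat j + 1"
        by simp_all
      show ?thesis using n 2
        unfolding dh_coef_def nat_int diff_Suc_Suc of_nat_le_iff e
        unfolding fact_Suc of_nat_Suc by simp
    qed
    define p q where "p = pochhammer (1 - z) j" and "q = pochhammer (z + a + b + 1) j"
    have p1: "pochhammer (- z) (Suc j) = - z * p" by (simp add: pochhammer_rec p_def)
    have p2: "pochhammer (- (z - 1)) (Suc j) = p * (1 - z + of_nat j)"
      by (simp add: pochhammer_Suc p_def)
    have q1: "pochhammer (z + a + b + 1) (Suc j) = q * (z + a + b + 1 + of_nat j)"
      by (simp add: pochhammer_Suc q_def)
    have q2: "pochhammer (z - 1 + a + b + 1) (Suc j) = (z + a + b) * q"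
    proof -
      have "z - 1 + a + b + 1 = z + a + b" by simp
      then show ?thesis unfolding q_def by (simp only: pochhammer_rec)
    qed
    have b2: "poly (dh_basis (a + 1) b j) (lam (a + 1) b (z - 1)) = (-1) ^ j * p * q"
      unfolding poly_dh_basis_lam by (simp add: p_def q_def algebra_simps)
    have "poly (dh_basis a b (Suc j)) (lam a b z) - poly (dh_basis a b (Suc j)) (lam a b (z - 1))
        = (2 * z + a + b) * (1 + of_nat j) * ((-1) ^ j * p * q)"
      unfolding poly_dh_basis_lam p1 p2 q1 q2 by (simp add: algebra_simps)
    then show ?case unfolding b2 by (simp add: c[symmetric])
  qed simp
  also have "\<dots> = (2 * z + a + b) * poly (dual_hahn (a + 1) b (N - 1) (int m)) (lam (a + 1) b (z - 1))"
    by (simp only: poly_dual_hahn[of "int m" "Suc m"] sum_distrib_left lessI of_nat_less_iff)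
  finally show ?thesis .
qed

text \<open>At \<open>z = - b\<close> the second factor of the basis starts at \<open>a + 1\<close>
  and merges with that of the coefficients, which leaves a Vandermonde sum. This is the boundary
  term at the lowest support point.\<close>

lemma dual_hahn_at_minus_b:
  "poly (dual_hahn a b N (int m)) (lam a b (- b))
    = pochhammer (a + 1) m * pochhammer (- N - b) m / fact m"
proof -
  have "poly (dual_hahn a b N (int m)) (lam a b (- b))
      = (\<Sum>j<Suc m. dh_coef a N (int m) j * ((-1) ^ j * pochhammer b j * pochhammer (a + 1) j))"
    by (simp add: poly_dual_hahn[of "int m" "Suc m"] poly_dh_basis_lam del: sum.lessThan_Suc)
  also have "\<dots> = (\<Sum>j\<le>m. pochhammer (a + 1) m / fact m * (of_nat (m choose j) * (-1) ^ j * pochhammer b j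
      * pochhammer (- N + of_nat j) (m - j)))"
  proof (rule sum.cong, goal_cases)
    case (2 j)
    then have "j \<le> m" by simp
    then have "pochhammer (a + 1) m = pochhammer (a + 1) j * pochhammer (a + of_nat j + 1) (m - j)"
      using pochhammer_product[of j m "a + 1"] by (simp add: algebra_simps)
    then show ?case using \<open>j \<le> m\<close>
      by (simp add: dh_coef_def binomial_fact field_simps)
  qed auto
  also have "\<dots> = pochhammer (a + 1) m / fact m * pochhammer (- N - b) m"
    by (subst sum_distrib_left[symmetric]) (simp only: pochhammer_vandermonde)
  finally show ?thesis by simp
qed


section \<open>Summation by parts and the moments for unit parameters\<close>

lemma sum_by_parts:
  fixes F R :: "nat \<Rightarrow> 'a :: comm_ring_1"
  shows "(\<Sum>y<n. (F y - F (Suc y)) * R y) + F n * R n = F 0 * R 0 + (\<Sum>y<n. F (Suc y) * (R (Suc y) - R y))"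
  by (induction n) (auto simp: algebra_simps)

lemma pochhammer_minus_eq_inv_fact:
  "pochhammer (- of_nat K) n = (-1) ^ n * fact K * inv_fact (int K - int n)"
  using pochhammer_eq_inv_fact[of "int K - int n" n]
  by (subst pochhammer_flip) (simp add: algebra_simps)

text \<open>
  Summation by parts against \<open>1 / ((K - y)! (K + c + y)!)\<close>, whose difference is the weight,
  together with the forward shift reduces the degree of the dual Hahn polynomial by one.
\<close>
lemma dual_hahn_unit_moment:
  fixes b :: complex
  shows "(\<Sum>y\<le>K. of_nat (2 * y + c + 1) / (fact (K - y) * fact (K + c + y + 1))
      * poly (dual_hahn (b + of_nat c) b (of_nat K - b) (int m)) (lam (b + of_nat c) b (of_nat y - b)))
    = (-1) ^ m * pochhammer (b + of_nat c) m / (fact m * fact (K + c)) * inv_fact (int K - int m)"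
proof -
  have parts: "(\<Sum>y\<le>K. of_nat (2 * y + c + 1) / (fact (K - y) * fact (K + c + y + 1)) * R y)
      = R 0 / (fact K * fact (K + c))
        + (\<Sum>y<K. (R (Suc y) - R y) / (fact (K - Suc y) * fact (K + c + Suc y)))"
    for K c and R :: "nat \<Rightarrow> complex"
  proof -
    define F where "F y = 1 / (fact (K - y) * fact (K + c + y) :: complex)" for y
    have w: "of_nat (2 * y + c + 1) / (fact (K - y) * fact (K + c + y + 1)) = F y - F (Suc y)"
      if "y < K" for y
    proof -
      obtain d where K: "K = Suc (y + d)" using \<open>y < K\<close> less_imp_Suc_add by blast
      have n: "(1 + of_nat d :: complex) \<noteq> 0" "(of_nat (Suc (K + c + y)) :: complex) \<noteq> 0"
        using of_nat_neq_0[of d, where 'a = complex] by (simp, simp only: of_nat_neq_0)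
      have f1: "fact (K - y) = (1 + of_nat d) * (fact d :: complex)"
        and f2: "fact (K + c + y + 1) = of_nat (Suc (K + c + y)) * (fact (K + c + y) :: complex)"
        and f3: "K - Suc y = d" "K + c + Suc y = K + c + y + 1"
        by (simp_all add: K)
      have "of_nat (2 * y + c + 1) = (of_nat (Suc (K + c + y)) - (1 + of_nat d) :: complex)"
        by (simp add: K)
      moreover have "(A - D) / ((D * f) * (A * g)) = 1 / ((D * f) * g) - 1 / (f * (A * g))"
        if "A \<noteq> 0" "D \<noteq> 0" "f \<noteq> 0" "g \<noteq> 0" for A D f g :: complex
        using that by (simp add: field_simps)
      ultimately show ?thesis unfolding F_def f3 f1 f2 using n by (simp del: of_nat_Suc)
    qed
    \<comment> \<open>At the last node the weight is \<open>F K\<close> itself and not a difference,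
      so the boundary term of the summation by parts is exactly the last summand.\<close>
    have "of_nat (2 * K + c + 1) / (fact (K - K) * fact (K + c + K + 1)) = F K"
    proof -
      have "fact (K + c + K + 1) = of_nat (2 * K + c + 1) * (fact (K + c + K) :: complex)"
        by (simp add: algebra_simps)
      moreover have "(of_nat (2 * K + c + 1) :: complex) \<noteq> 0" by (simp only: of_nat_eq_0_iff)
      moreover have "r / (1 * (r * f)) = 1 / (1 * f)" if "r \<noteq> 0" for r f :: complex
        using that by simp
      ultimately show ?thesis unfolding F_def by (simp only: diff_self_eq_0 fact_0)
    qed
    moreover have "(\<Sum>y<K. of_nat (2 * y + c + 1) / (fact (K - y) * fact (K + c + y + 1)) * R y)
        = (\<Sum>y<K. (F y - F (Suc y)) * R y)"
      by (rule sum.cong) (simp_all only: w lessThan_iff)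
    ultimately have "(\<Sum>y\<le>K. of_nat (2 * y + c + 1) / (fact (K - y) * fact (K + c + y + 1)) * R y)
        = (\<Sum>y<K. (F y - F (Suc y)) * R y) + F K * R K"
      by (simp only: lessThan_Suc_atMost[symmetric] sum.lessThan_Suc)
    also have "\<dots> = F 0 * R 0 + (\<Sum>y<K. F (Suc y) * (R (Suc y) - R y))"
      by (rule sum_by_parts)
    finally show ?thesis by (simp add: F_def)
  qed
  show ?thesis
  \<comment> \<open>The forward shift trades \<open>(K, c)\<close> for
    \<open>(K - 1, c + 1)\<close>, while \<open>K + c\<close>, \<open>b\<close> and the lattice
    offset stay fixed.\<close>
  proof (induction m arbitrary: K c)
    case 0
    then show ?case unfolding parts by (simp add: dual_hahn_0)
  next
    case (Suc m)
    define R where "R y = poly (dual_hahn (b + of_nat c) b (of_nat K - b) (int (Suc m)))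
        (lam (b + of_nat c) b (of_nat y - b))" for y
    define P where "P = pochhammer (b + of_nat c + 1) m"
    have "R 0 = pochhammer (b + of_nat c + 1) (Suc m) * pochhammer (- of_nat K) (Suc m) / fact (Suc m)"
      using dual_hahn_at_minus_b[of "b + of_nat c" b "of_nat K - b" "Suc m"] by (simp add: R_def)
    then have R0: "R 0 / (fact K * fact (K + c))
        = - ((b + of_nat c + 1 + of_nat m) * P * (-1) ^ m * inv_fact (int K - int (Suc m)) / (fact (Suc m) * fact (K + c)))"
      unfolding pochhammer_minus_eq_inv_fact by (simp add: pochhammer_Suc P_def mult_ac)
    have "(\<Sum>y<K. (R (Suc y) - R y) / (fact (K - Suc y) * fact (K + c + Suc y)))
        = (-1) ^ m * P / (fact m * fact (K + c)) * inv_fact (int K - int (Suc m))"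
    \<comment> \<open>For \<open>K = 0\<close> the sum is empty and the reciprocal factorial on the
      right is 0.\<close>
    proof (cases K)
      case (Suc K')
      have "(R (Suc y) - R y) / (fact (K - Suc y) * fact (K + c + Suc y))
         = of_nat (2 * y + Suc c + 1) / (fact (K' - y) * fact (K' + Suc c + y + 1))
      * poly (dual_hahn (b + of_nat (Suc c)) b (of_nat K' - b) (int m))
          (lam (b + of_nat (Suc c)) b (of_nat y - b))" for y
      proof -
        have e: "of_nat (Suc y) - b - 1 = of_nat y - b" "b + of_nat c + 1 = b + of_nat (Suc c)"
          "of_nat K - b - 1 = of_nat K' - b"
          "2 * (of_nat (Suc y) - b) + (b + of_nat c) + b = of_nat (2 * y + Suc c + 1)"
          by (simp_all add: Suc algebra_simps)
        have f: "K - Suc y = K' - y" "K + c + Suc y = K' + Suc c + y + 1" by (simp_all add: Suc)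
        show ?thesis
          using dual_hahn_forward_shift[of "b + of_nat c" b "of_nat K - b" m "of_nat (Suc y) - b"]
          unfolding e f R_def by (simp only: times_divide_eq_left)
      qed
      then have "(\<Sum>y<K. (R (Suc y) - R y) / (fact (K - Suc y) * fact (K + c + Suc y)))
        = (-1) ^ m * pochhammer (b + of_nat (Suc c)) m / (fact m * fact (K' + Suc c)) * inv_fact (int K' - int m)"
        using Suc.IH[of "Suc c" K'] by (simp only: Suc lessThan_Suc_atMost)
      moreover have "b + of_nat (Suc c) = b + of_nat c + 1" "K' + Suc c = K + c"
        "int K' - int m = int K - int (Suc m)" by (simp_all add: Suc)
      ultimately show ?thesis by (simp only: P_def)
    qed simp
    moreover have "(1 + of_nat m :: complex) \<noteq> 0"
      using of_nat_neq_0[of m, where 'a = complex] by simp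
    moreover have "pochhammer (b + of_nat c) (Suc m) = (b + of_nat c) * P"
      by (simp add: pochhammer_rec P_def)
    ultimately show ?case
      unfolding R_def[symmetric] parts[of c K R] R0
      by (simp add: divide_simps) (simp add: algebra_simps)
  qed
qed

lemma pochhammer_Suc_of_nat: "pochhammer (of_nat n + 1 :: complex) t = fact (n + t) / fact n"
  using pochhammer_eq_inv_fact[of "int n" t] by (simp add: nat_add_distrib add_ac)

subsection \<open>The measure\<close>

lemma pm_integral_superset:
  assumes "finite S" "Poly_Mapping.keys \<mu> \<subseteq> S"
  shows "pm_integral \<mu> f = (\<Sum>y\<in>S. f y * Poly_Mapping.lookup \<mu> y)"
  unfolding pm_integral_def using assms by (intro sum.mono_neutral_left) (auto simp: in_keys_iff)

lemma pm_integral_add: "pm_integral (\<mu> + \<nu>) f = pm_integral \<mu> f + pm_integral \<nu> f"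
proof -
  let ?S = "Poly_Mapping.keys \<mu> \<union> Poly_Mapping.keys \<nu>"
  have "Poly_Mapping.keys (\<mu> + \<nu>) \<subseteq> ?S" by (rule Poly_Mapping.keys_add)
  then have "pm_integral (\<mu> + \<nu>) f = (\<Sum>y\<in>?S. f y * Poly_Mapping.lookup (\<mu> + \<nu>) y)"
    by (intro pm_integral_superset) auto
  also have "\<dots> = pm_integral \<mu> f + pm_integral \<nu> f"
    by (simp add: pm_integral_superset[of ?S \<mu>] pm_integral_superset[of ?S \<nu>] lookup_add
        ring_distribs sum.distrib)
  finally show ?thesis .
qed

lemma pm_integral_single: "pm_integral (Poly_Mapping.single y m) f = f y * m"
  by (subst pm_integral_superset[of "{y}"]) auto

lemma pm_integral_sum: "pm_integral (\<Sum>i\<in>A. \<mu> i) f = (\<Sum>i\<in>A. pm_integral (\<mu> i) f)"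
proof (induction A rule: infinite_finite_induct)
  case (insert x F)
  then show ?case by (simp add: pm_integral_add)
qed (simp_all add: pm_integral_def)

lemma pm_integral_density: "pm_integral (pm_density r \<mu>) f = pm_integral \<mu> (\<lambda>y. poly r y * f y)"
proof -
  have "Poly_Mapping.keys (pm_density r \<mu>) \<subseteq> Poly_Mapping.keys \<mu>"
    by (auto simp: in_keys_iff lookup_pm_density)
  then show ?thesis
    by (subst pm_integral_superset[of "Poly_Mapping.keys \<mu>"])
      (auto simp: pm_integral_def lookup_pm_density mult_ac)
qed

lemma pm_integral_linear:
  "pm_integral \<mu> (\<lambda>y. \<Sum>i\<in>A. c i * f i y) = (\<Sum>i\<in>A. c i * pm_integral \<mu> (f i))"
  unfolding pm_integral_def sum_distrib_left sum_distrib_right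
  by (subst sum.swap) (simp add: mult_ac)

text \<open>The index \<open>y = x + b\<close> counts the support points from the lowest, so the
  free points are those with \<open>y < b\<close>.\<close>

definition nu_weight :: "nat \<Rightarrow> nat \<Rightarrow> nat \<Rightarrow> nat \<Rightarrow> complex" where
  "nu_weight a b N y = of_nat (2 * y + (a - b) + 1) * (fact (N + b))\<^sup>2 / (fact (N + b - y) * fact (N + a + y + 1))"

lemma prod_ascending_fact: "(\<Prod>i<b. (of_nat x + of_nat a + of_nat i + 1 :: complex)) = fact (x + a + b) / fact (x + a)"
  using pochhammer_Suc_of_nat[of "x + a" b] by (simp add: pochhammer_prod atLeast0LessThan add_ac)

lemma prod_descending_fact: "(\<Prod>i<b. (of_nat x + of_nat b - of_nat i :: complex)) = fact (x + b) / fact x"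
proof (induction b)
  case (Suc b)
  have "(\<Prod>i<Suc b. (of_nat x + of_nat (Suc b) - of_nat i :: complex))
      = (of_nat x + of_nat b + 1) * (\<Prod>i<b. (of_nat x + of_nat b - of_nat i))"
    by (subst prod.lessThan_Suc_shift) (simp add: add_ac)
  then show ?case unfolding Suc by (simp add: add_ac)
qed simp

text \<open>The two sums in \<open>nu\<close> carry different normalisations; written in factorials
  both become \<open>nu_weight\<close>.\<close>

lemma nu_integral:
  assumes ba: "b \<le> a"
  shows "pm_integral (nu a b N M) f
    = (\<Sum>y\<le>N + b. (if y < b then complex_of_real (M y) else 1) * nu_weight a b N y
        * f (lam (of_nat a) (of_nat b) (of_nat y - of_nat b)))" (is "_ = (\<Sum>y\<le>_. ?g y)")
proof -
  have neg: "(\<Sum>x\<in>{- int b..- 1}. f (lam (of_nat a) (of_nat b) (of_int x)) *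
          (of_int (2 * x + int a + int b + 1)
             * pochhammer (of_int (int N + 1 - x)) (nat (x + int b))
             / pochhammer (of_nat (N + b + 1)) (nat (x + int a + 1))
             * complex_of_real (M (nat (x + int b))))) = (\<Sum>y\<in>{..<b}. ?g y)"
  proof (rule sum.reindex_bij_witness[of _ "\<lambda>y. int y - int b" "\<lambda>x. nat (x + int b)"], goal_cases)
    case (5 x)
    define y where "y = nat (x + int b)"
    have x: "x = int y - int b" and y: "y < b" using 5 by (auto simp: y_def)
    have c1: "(of_int (2 * x + int a + int b + 1) :: complex) = of_nat (2 * y + (a - b) + 1)"
      using ba by (simp add: x of_nat_diff)
    have c2: "pochhammer (of_int (int N + 1 - x)) y = (fact (N + b) / fact (N + b - y) :: complex)"
      using pochhammer_Suc_of_nat[of "N + b - y" y] y by (simp add: x of_nat_diff algebra_simps)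
    have e: "nat (x + int a + 1) = y + (a - b) + 1" using ba by (simp add: x)
    have c3: "pochhammer (of_nat (N + b + 1)) (nat (x + int a + 1)) = (fact (N + a + y + 1) / fact (N + b) :: complex)"
      unfolding e using pochhammer_Suc_of_nat[of "N + b" "y + (a - b) + 1"] ba by (simp add: add_ac)
    have "of_int (2 * x + int a + int b + 1)
             * pochhammer (of_int (int N + 1 - x)) y
             / pochhammer (of_nat (N + b + 1)) (nat (x + int a + 1)) = nu_weight a b N y"
      unfolding c1 c2 c3 nu_weight_def by (simp add: power2_eq_square)
    moreover have "complex_of_int x = of_nat y - of_nat b" by (simp add: x)
    ultimately show ?case using y unfolding y_def[symmetric] by (simp add: mult_ac)
  qed auto
  have pos: "(\<Sum>x\<in>{0..N}. f (lam (of_nat a) (of_nat b) (of_nat x)) *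
          ((pochhammer (of_nat N + 1) b)\<^sup>2 / pochhammer (of_nat b + 1) (a - b)
             * (dual_hahn_mass b a N x
                  / (\<Prod>i<b. (of_nat x + of_nat a + of_nat i + 1)
                             * (of_nat x + of_nat b - of_nat i))))) = (\<Sum>y\<in>{b..N + b}. ?g y)"
  proof (rule sum.reindex_bij_witness[of _ "\<lambda>y. y - b" "\<lambda>x. x + b"], goal_cases)
    case (5 x)
    then have xN: "x \<le> N" by simp
    have m: "pochhammer (- of_nat N) x = ((-1) ^ x * fact N / fact (N - x) :: complex)"
      using xN by (simp add: pochhammer_minus_eq_inv_fact flip: of_nat_diff)
    have p: "pochhammer (of_nat (x + a + b + 1)) (N + 1) = (fact (N + a + (x + b) + 1) / fact (x + a + b) :: complex)"
      using pochhammer_Suc_of_nat[of "x + a + b" "N + 1"] by (simp add: add_ac)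
    have q: "pochhammer (of_nat b + 1) (a - b) = (fact a / fact b :: complex)"
      using ba by (simp add: pochhammer_Suc_of_nat)
    have pN: "pochhammer (of_nat N + 1) b = (fact (N + b) / fact N :: complex)"
      by (rule pochhammer_Suc_of_nat)
    have pb: "pochhammer (of_nat b + 1) x = (fact (b + x) / fact b :: complex)"
      and pa: "pochhammer (of_nat a + 1) x = (fact (a + x) / fact a :: complex)"
      by (rule pochhammer_Suc_of_nat)+
    have w: "(of_nat (2 * x + a + b + 1) :: complex) = of_nat (2 * (x + b) + (a - b) + 1)"
      using ba by (simp add: of_nat_diff)
    have s: "N + b - (x + b) = N - x" by simp
    have alg: "(A / n)\<^sup>2 / (fa / fb) * (W * (B / fb) * (sg * n / r) * n / (sg * (P / Q) * (D / fa) * xf) / (Q / D * (B / xf)))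
        = W * A\<^sup>2 / (r * P)"
      if "A \<noteq> 0" "n \<noteq> 0" "fa \<noteq> 0" "fb \<noteq> 0" "B \<noteq> 0" "sg \<noteq> 0" "r \<noteq> 0" "P \<noteq> 0" "Q \<noteq> 0" "D \<noteq> 0" "xf \<noteq> 0"
      for A n fa fb W B sg r P Q D xf :: complex
      using that by (simp add: field_simps power2_eq_square)
    have "(pochhammer (of_nat N + 1) b)\<^sup>2 / pochhammer (of_nat b + 1) (a - b)
             * (dual_hahn_mass b a N x
                  / (\<Prod>i<b. (of_nat x + of_nat a + of_nat i + 1)
                             * (of_nat x + of_nat b - of_nat i))) = nu_weight a b N (x + b)"
      unfolding dual_hahn_mass_def nu_weight_def prod.distrib prod_ascending_fact prod_descending_fact
        m p q w s pN pb pa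
      using alg[of "fact (N + b)" "fact N" "fact a" "fact b" "fact (x + b)" "(-1) ^ x" "fact (N - x)"
          "fact (N + a + (x + b) + 1)" "fact (x + a + b)" "fact (x + a)" "fact x"
          "of_nat (2 * (x + b) + (a - b) + 1)"]
      by (simp only: fact_nonzero power_eq_0_iff neg_equal_0_iff_equal one_neq_zero simp_thms add.commute[of b x] add.commute[of a x])
    then show ?case by (simp add: mult_ac)
  qed auto
  have "pm_integral (nu a b N M) f = (\<Sum>y\<in>{..<b}. ?g y) + (\<Sum>y\<in>{b..N + b}. ?g y)"
    unfolding nu_def pm_integral_add pm_integral_sum pm_integral_single neg pos ..
  also have "\<dots> = (\<Sum>y\<le>N + b. ?g y)"
    by (subst sum.union_disjoint[symmetric]) (auto intro!: sum.cong)
  finally show ?thesis .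
qed

definition moment :: "nat \<Rightarrow> nat \<Rightarrow> nat \<Rightarrow> (nat \<Rightarrow> real) \<Rightarrow> nat \<Rightarrow> int \<Rightarrow> complex" where
  "moment a b N M k m = pm_integral (nu a b N M)
     (\<lambda>y. y ^ k * poly (dual_hahn (of_nat a) (of_nat b) (of_nat N) m) y)"

text \<open>Multiplication by \<open>y\<close> seen in the index \<open>m\<close>: the Jacobi matrix
  of the dual Hahn polynomials, acting on sequences over all integers.\<close>

definition jacobi_op :: "nat \<Rightarrow> nat \<Rightarrow> nat \<Rightarrow> (int \<Rightarrow> complex) \<Rightarrow> int \<Rightarrow> complex" where
  "jacobi_op a b N f m = of_int (m + 1) * f (m + 1)
     + rec_B (of_nat a) (of_nat b) (of_nat N) (of_int m) * f m
     + rec_C (of_nat a) (of_nat b) (of_nat N) (of_int m) * f (m - 1)"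

lemma moment_Suc: "moment a b N M (Suc k) m = jacobi_op a b N (moment a b N M k) m"
  unfolding moment_def jacobi_op_def pm_integral_def sum_distrib_left sum.distrib[symmetric]
proof (rule sum.cong, goal_cases)
  case (2 y)
  show ?case
    using arg_cong[OF dual_hahn_rec[of y "of_nat a" "of_nat b" "of_nat N" m],
        of "\<lambda>z. y ^ k * z * Poly_Mapping.lookup (nu a b N M) y"]
    by (simp add: algebra_simps)
qed simp

lemma moment_neg: "m < 0 \<Longrightarrow> moment a b N M k m = 0"
  by (simp add: moment_def dual_hahn_neg pm_integral_def)

subsection \<open>The Hahn difference operator\<close>

definition parity_sign :: "int \<Rightarrow> complex" where
  "parity_sign m = (if even m then 1 else - 1)"

lemma parity_sign_simps [simp]: "parity_sign (m + 1) = - parity_sign m" "parity_sign (m - 1) = - parity_sign m" "parity_sign (int n) = (-1) ^ n"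
  "parity_sign m * parity_sign m = 1"
  by (auto simp: parity_sign_def)

definition row_weight :: "nat \<Rightarrow> int \<Rightarrow> complex" where
  "row_weight K m = parity_sign m * inv_fact (int K - m)"

text \<open>The Hahn difference operator for the parameters \<open>- a\<close>, \<open>- b\<close>,
  \<open>- 2 - N\<close>, with the constant \<open>a + b\<close> subtracted so that its eigenvalues
  become values of \<open>lam\<close>.\<close>

definition hahn_op :: "nat \<Rightarrow> nat \<Rightarrow> nat \<Rightarrow> (complex \<Rightarrow> complex) \<Rightarrow> complex \<Rightarrow> complex" where
  "hahn_op a b N f x = (x + 1 - of_nat a) * (x + 2 + of_nat N) * (f (x + 1) - f x)
     + x * (x + 1 + of_nat N + of_nat b) * (f (x - 1) - f x) - (of_nat a + of_nat b) * f x"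

text \<open>\<open>row_weight\<close> is the gauge factor that conjugates one operator into the
  other. Neighbouring weights differ by linear factors, which turn the coefficients of the
  recurrence into those of the difference operator; a step up in \<open>m\<close> is a step down in
  \<open>x\<close>.\<close>

lemma jacobi_op_row_weight:
  "jacobi_op a b N (\<lambda>m. row_weight (N + b) m * f (of_int (- m - 1))) m
    = row_weight (N + b) m * hahn_op a b N f (of_int (- m - 1))"
proof -
  define r where "r = inv_fact (int (N + b) - m + 1)"
  define x where "x = (of_int m :: complex)"
  have r0: "inv_fact (int (N + b) - m) = (of_nat N + of_nat b - x + 1) * r"
    using inv_fact_pred[of "int (N + b) - m + 1"] by (simp add: r_def x_def)
  have "inv_fact (int (N + b) - (m + 1)) = (of_nat N + of_nat b - x) * inv_fact (int (N + b) - m)"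
    using inv_fact_pred[of "int (N + b) - m"] by (simp add: x_def algebra_simps)
  then have k1: "row_weight (N + b) (m + 1) = - parity_sign m * ((of_nat N + of_nat b - x) * ((of_nat N + of_nat b - x + 1) * r))"
    unfolding row_weight_def parity_sign_simps by (simp only: r0 minus_mult_left)
  have k0: "row_weight (N + b) m = parity_sign m * ((of_nat N + of_nat b - x + 1) * r)"
    by (simp only: row_weight_def r0)
  have km: "row_weight (N + b) (m - 1) = - parity_sign m * r"
    by (simp add: row_weight_def r_def algebra_simps)
  have e: "of_int (- m - 1) = - x - 1" "of_int (- (m + 1) - 1) = - x - 1 - 1"
    "of_int (- (m - 1) - 1) = - x - 1 + 1" "of_int (m + 1) = x + 1" "of_int m = x"
    by (simp_all add: x_def)
  show ?thesis
    unfolding jacobi_op_def hahn_op_def k1 k0 km e rec_B_def rec_C_def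
    by (simp add: algebra_simps)
qed

lemma jacobi_op_cmult: "jacobi_op a b N (\<lambda>m. c * f m) m = c * jacobi_op a b N f m"
  by (simp add: jacobi_op_def algebra_simps)

lemma hahn_op_sum: "hahn_op a b N (\<lambda>x. \<Sum>i\<in>A. c i * f i x) x = (\<Sum>i\<in>A. c i * hahn_op a b N (f i) x)"
  unfolding hahn_op_def sum_subtractf[symmetric] sum_distrib_left sum.distrib[symmetric]
  by (intro sum.cong) (simp_all add: algebra_simps)

text \<open>Since \<open>lam\<close> is invariant under the reflection of \<open>x\<close> to
  \<open>- x - a - b - 1\<close>, degree \<open>a + i\<close> receives the support point
  \<open>lam (i - b)\<close>.\<close>

definition hahn_eigenvalue :: "nat \<Rightarrow> nat \<Rightarrow> nat \<Rightarrow> complex" where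
  "hahn_eigenvalue a b j = lam (of_nat a) (of_nat b) (- of_nat (Suc j))"

text \<open>The zero at \<open>j = a\<close> is decisive: nothing flows from index \<open>a\<close>
  down to \<open>a - 1\<close>, so the basis elements of index at least \<open>a\<close> span an
  invariant space too.\<close>

definition hahn_subdiag :: "nat \<Rightarrow> nat \<Rightarrow> nat \<Rightarrow> complex" where
  "hahn_subdiag a N j = - of_nat j * (of_nat j - of_nat a) * (of_nat j + 1 + of_nat N)"

lemma hahn_eigenvalue_diff: "hahn_eigenvalue a b j - hahn_eigenvalue a b n = (of_nat j - of_nat n) * (of_nat j + of_nat n + 1 - of_nat a - of_nat b)"
  by (simp add: hahn_eigenvalue_def lam_def algebra_simps)

lemma hahn_op_pochhammer:
  "hahn_op a b N (\<lambda>x. pochhammer (- x) j) x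
    = hahn_eigenvalue a b j * pochhammer (- x) j + hahn_subdiag a N j * pochhammer (- x) (j - 1)"
proof (cases j)
  case 0
  then show ?thesis by (simp add: hahn_op_def hahn_eigenvalue_def lam_def hahn_subdiag_def algebra_simps)
next
  case (Suc i)
  define Q where "Q = pochhammer (- x) i"
  have p0: "pochhammer (- x) (Suc i) = Q * (of_nat i - x)"
    by (simp add: pochhammer_Suc Q_def)
  have p1: "pochhammer (- (x + 1)) (Suc i) = (- x - 1) * Q"
    by (simp add: pochhammer_rec Q_def)
  \<comment> \<open>The coefficient of the backward shift contains \<open>x\<close>, which is just
    the missing first factor of a longer product.\<close>
  have "x * pochhammer (- (x - 1)) (Suc i) = - pochhammer (- x) (Suc (Suc i))"
    by (simp add: pochhammer_rec[of "- x" "Suc i"])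
  then have p2: "x * pochhammer (- (x - 1)) (Suc i) = - (Q * (of_nat i - x) * (of_nat i + 1 - x))"
    by (simp add: pochhammer_Suc[of _ "Suc i"] p0 add_ac)
  have H: "hahn_op a b N (\<lambda>x. pochhammer (- x) j) x
    = (x + 1 - of_nat a) * (x + 2 + of_nat N) * (pochhammer (- (x + 1)) (Suc i) - pochhammer (- x) (Suc i))
     + (x + 1 + of_nat N + of_nat b) * (x * pochhammer (- (x - 1)) (Suc i) - x * pochhammer (- x) (Suc i))
     - (of_nat a + of_nat b) * pochhammer (- x) (Suc i)"
    by (simp add: hahn_op_def Suc algebra_simps)
  show ?thesis
    unfolding H p0 p1 p2 by (simp add: Suc p0 Q_def[symmetric] hahn_eigenvalue_def lam_def hahn_subdiag_def algebra_simps)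
qed

definition poch_expansion :: "(nat \<Rightarrow> complex) \<Rightarrow> nat \<Rightarrow> complex \<Rightarrow> complex" where
  "poch_expansion p J x = (\<Sum>j<J. p j * pochhammer (- x) j)"

text \<open>Comparison of coefficients in a bidiagonal basis. The last assumption stops the inflow
  from index \<open>J\<close>; it holds when \<open>p J = 0\<close> and also for
  \<open>J = a\<close>.\<close>

lemma hahn_op_poch_expansion:
  assumes e: "\<And>j. j < J \<Longrightarrow> (hahn_eigenvalue a b j - \<theta>) * p j + hahn_subdiag a N (Suc j) * p (Suc j) = e j"
    and J: "hahn_subdiag a N J * p J = 0"
  shows "hahn_op a b N (poch_expansion p J) x = \<theta> * poch_expansion p J x + poch_expansion e J x"
proof -
  have "hahn_op a b N (poch_expansion p J) x = (\<Sum>j<J. p j * hahn_op a b N (\<lambda>x. pochhammer (- x) j) x)"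
    unfolding poch_expansion_def[abs_def] by (rule hahn_op_sum)
  also have "\<dots> = (\<Sum>j<J. hahn_eigenvalue a b j * p j * pochhammer (- x) j)
      + (\<Sum>j<J. hahn_subdiag a N j * p j * pochhammer (- x) (j - 1))"
    by (simp add: hahn_op_pochhammer ring_distribs sum.distrib mult_ac)
  also have "(\<Sum>j<J. hahn_subdiag a N j * p j * pochhammer (- x) (j - 1))
      = (\<Sum>j<Suc J. hahn_subdiag a N j * p j * pochhammer (- x) (j - 1))"
    using J by simp
  also have "\<dots> = (\<Sum>j<J. hahn_subdiag a N (Suc j) * p (Suc j) * pochhammer (- x) j)"
    by (subst sum.lessThan_Suc_shift) (simp add: hahn_subdiag_def)
  also have "(\<Sum>j<J. hahn_eigenvalue a b j * p j * pochhammer (- x) j) + \<dots>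
      = (\<Sum>j<J. (\<theta> * p j + e j) * pochhammer (- x) j)"
    unfolding sum.distrib[symmetric] by (intro sum.cong) (auto simp: e[symmetric] algebra_simps)
  finally show ?thesis
    by (simp add: poch_expansion_def[abs_def] sum.distrib ring_distribs sum_distrib_left mult_ac)
qed

section \<open>Coefficients of Hahn polynomials and the eigenfunctions divisible by
  \<open>pochhammer (- x) a\<close>\<close>

definition hahn_coeff :: "complex \<Rightarrow> complex \<Rightarrow> complex \<Rightarrow> nat \<Rightarrow> nat \<Rightarrow> complex" where
  "hahn_coeff a b N n j = pochhammer (- of_nat n) j * pochhammer (a + b + of_nat n + 1) j
        * pochhammer (- N + of_nat j) (n - j) * pochhammer (a + of_nat j + 1) (n - j) / fact j"

lemma hahn_coeff_eq_0: "n < j \<Longrightarrow> hahn_coeff a b N n j = 0"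
  by (simp add: hahn_coeff_def pochhammer_of_nat_eq_0_iff)

lemma hahn_eq_poch_expansion: "n < J \<Longrightarrow> hahn a b N n x = poch_expansion (hahn_coeff a b N n) J x"
proof -
  assume n: "n < J"
  have "hahn a b N n x = (\<Sum>j\<le>n. hahn_coeff a b N n j * pochhammer (- x) j)"
    by (simp add: hahn_def hahn_coeff_def)
  also have "\<dots> = poch_expansion (hahn_coeff a b N n) J x"
    unfolding poch_expansion_def using n by (intro sum.mono_neutral_left) (auto simp: hahn_coeff_eq_0)
  finally show ?thesis .
qed

text \<open>The ratio of consecutive terms of a hypergeometric series, cleared of denominators; in
  the bidiagonal basis this is the eigenvalue equation.\<close>

lemma hahn_coeff_rec:
  "of_nat (Suc j) * (of_nat (Suc j) + a) * (of_nat j - N) * hahn_coeff a b N n (Suc j)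
    = (of_nat j - of_nat n) * (of_nat j + of_nat n + 1 + a + b) * hahn_coeff a b N n j"
proof (cases "j < n")
  case False
  then show ?thesis by (cases "j = n") (simp_all add: hahn_coeff_eq_0)
next
  case True
  then obtain d where n: "n = Suc (j + d)" using less_imp_Suc_add by blast
  define A B where "A = pochhammer (1 - N + of_nat j) d" and "B = pochhammer (a + of_nat j + 2) d"
  have d: "n - j = Suc d" "n - Suc j = d" by (simp_all add: n)
  have p: "pochhammer (- N + of_nat j) (Suc d) = (of_nat j - N) * A"
    "pochhammer (a + of_nat j + 1) (Suc d) = (a + of_nat j + 1) * B"
    "pochhammer (- N + of_nat (Suc j)) d = A" "pochhammer (a + of_nat (Suc j) + 1) d = B"
    by (simp_all add: pochhammer_rec A_def B_def algebra_simps)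
  have nz: "(of_nat (Suc j) :: complex) \<noteq> 0" by (rule of_nat_neq_0)
  show ?thesis
    unfolding hahn_coeff_def d p unfolding pochhammer_Suc fact_Suc using nz
    by (simp add: divide_simps del: of_nat_Suc) (simp add: algebra_simps)
qed

text \<open>The summand of \<open>W_(a+i)\<close> that vanishes at \<open>x = 0, ..., a - 1\<close>,
  that is, at \<open>m = - 1, ..., - a\<close>, just as \<open>R_m\<close> does.\<close>

definition shifted_hahn :: "nat \<Rightarrow> nat \<Rightarrow> nat \<Rightarrow> nat \<Rightarrow> complex \<Rightarrow> complex" where
  "shifted_hahn a b N i x = pochhammer (- x) a
     * hahn (of_nat a) (- of_nat b) (- 2 - of_nat N - of_nat a) i (x - of_nat a)"

lemma hahn_op_shifted_hahn: "hahn_op a b N (shifted_hahn a b N i) x = hahn_eigenvalue a b (a + i) * shifted_hahn a b N i x"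
proof -
  let ?h = "hahn_coeff (of_nat a) (- of_nat b) (- 2 - of_nat N - of_nat a) i"
  \<comment> \<open>The factor \<open>pochhammer (- x) a\<close> shifts all indices by
    \<open>a\<close>. The eigenvalue equation at \<open>j = a - 1\<close> survives through the zero
    of \<open>hahn_subdiag\<close> at \<open>a\<close>.\<close>
  define p where "p j = (if j < a then 0 else ?h (j - a))" for j
  have h: "shifted_hahn a b N i x = poch_expansion p (a + Suc i) x" for x
  proof -
    have "poch_expansion p (a + Suc i) x = (\<Sum>j\<in>{a..<a + Suc i}. p j * pochhammer (- x) j)"
      unfolding poch_expansion_def by (intro sum.mono_neutral_right) (auto simp: p_def)
    also have "\<dots> = (\<Sum>l<Suc i. p (a + l) * pochhammer (- x) (a + l))"
      by (rule sum.reindex_bij_witness[of _ "\<lambda>l. a + l" "\<lambda>j. j - a"]) auto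
    also have "\<dots> = (\<Sum>l<Suc i. pochhammer (- x) a * (?h l * pochhammer (- (x - of_nat a)) l))"
      by (intro sum.cong) (simp_all add: p_def pochhammer_product' mult_ac)
    also have "\<dots> = shifted_hahn a b N i x"
      by (simp only: shifted_hahn_def hahn_eq_poch_expansion[OF lessI] poch_expansion_def sum_distrib_left)
    finally show ?thesis by simp
  qed
  have "hahn_op a b N (poch_expansion p (a + Suc i)) x = hahn_eigenvalue a b (a + i) * poch_expansion p (a + Suc i) x + poch_expansion (\<lambda>_. 0) (a + Suc i) x"
  proof (rule hahn_op_poch_expansion)
    fix j
    show "(hahn_eigenvalue a b j - hahn_eigenvalue a b (a + i)) * p j + hahn_subdiag a N (Suc j) * p (Suc j) = 0"
    proof (cases "j < a")
      case True
      then show ?thesis by (cases "Suc j = a") (auto simp: p_def hahn_subdiag_def)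
    next
      case False
      then obtain l where j: "j = a + l" using le_Suc_ex not_less by blast
      show ?thesis
        using hahn_coeff_rec[of l "of_nat a" "- 2 - of_nat N - of_nat a" "- of_nat b" i]
        unfolding hahn_eigenvalue_diff hahn_subdiag_def by (simp add: j p_def Suc_diff_le algebra_simps)
    qed
  qed (simp add: p_def hahn_coeff_eq_0)
  moreover have "shifted_hahn a b N i = poch_expansion p (a + Suc i)" by (rule ext) (rule h)
  ultimately show ?thesis by (simp add: poch_expansion_def)
qed

lemma shifted_hahn_eq_0: "k < a \<Longrightarrow> shifted_hahn a b N i (of_nat k) = 0"
  by (simp add: shifted_hahn_def pochhammer_of_nat_eq_0_iff)

text \<open>The point \<open>x = - 1\<close> is \<open>m = 0\<close>, where \<open>R_0 = 1\<close>
  fixes the normalisation. There the products starting at \<open>a + 1\<close> merge and a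
  Vandermonde sum remains.\<close>

lemma shifted_hahn_minus_1:
  assumes "i \<le> N + b"
  shows "shifted_hahn a b N i (- 1) = fact (a + i) * fact (N + b) / fact (N + b - i)"
proof -
  let ?A = "of_nat a - of_nat b + of_nat i + 1 :: complex" and ?B = "of_nat N + 2 + of_nat a :: complex"
  have "hahn (of_nat a) (- of_nat b) (- 2 - of_nat N - of_nat a) i (- 1 - of_nat a)
      = (\<Sum>j\<le>i. pochhammer (of_nat a + 1) i * (of_nat (i choose j) * (-1) ^ j * pochhammer ?A j * pochhammer (?B + of_nat j) (i - j)))"
    unfolding hahn_def
  proof (rule sum.cong, goal_cases)
    case (2 j)
    then have "j \<le> i" by simp
    then have "pochhammer (of_nat a + 1 :: complex) i = pochhammer (of_nat a + 1) j * pochhammer (of_nat a + of_nat j + 1) (i - j)"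
      using pochhammer_product[of j i "of_nat a + 1 :: complex"] by (simp add: add_ac)
    moreover have "pochhammer (- of_nat i) j = (-1) ^ j * of_nat (i choose j) * (fact j :: complex)"
      using pochhammer_minus_of_nat[of i j, where 'a = complex] by (simp add: field_simps)
    ultimately show ?case by (simp add: algebra_simps)
  qed simp
  also have "\<dots> = pochhammer (of_nat a + 1) i * pochhammer (?B - ?A) i"
    by (simp only: sum_distrib_left[symmetric] pochhammer_vandermonde)
  also have "pochhammer (?B - ?A) i = fact (N + b) / fact (N + b - i)"
    using pochhammer_Suc_of_nat[of "N + b - i" i] assms by (simp add: of_nat_diff algebra_simps)
  also have "pochhammer (of_nat a + 1) i = (fact (a + i) / fact a :: complex)"
    by (rule pochhammer_Suc_of_nat)
  finally show ?thesis by (simp add: shifted_hahn_def pochhammer_fact[symmetric])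
qed

text \<open>
  Both sides are annihilated by \<open>jacobi_op - lam (i - b)\<close> and vanish at \<open>m = -1\<close>,
  so they are determined by their value at \<open>m = 0\<close>.
\<close>
lemma dual_hahn_eq_shifted_hahn:
  assumes a: "1 \<le> a" and i: "i \<le> N + b" and m: "- int a \<le> m"
  shows "poly (dual_hahn (of_nat a) (of_nat b) (of_nat N) m) (lam (of_nat a) (of_nat b) (of_nat i - of_nat b))
    = fact (N + b - i) / fact (a + i) * (row_weight (N + b) m * shifted_hahn a b N i (of_int (- m - 1)))"
proof -
  define L where "L = lam (of_nat a) (of_nat b) (of_nat i - of_nat b)"
  define f where "f m = poly (dual_hahn (of_nat a) (of_nat b) (of_nat N) m) L" for m
  define g where "g m = fact (N + b - i) / fact (a + i) * (row_weight (N + b) m * shifted_hahn a b N i (of_int (- m - 1)))" for m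
  have L: "L = hahn_eigenvalue a b (a + i)" by (simp add: L_def hahn_eigenvalue_def lam_def algebra_simps)
  have fr: "jacobi_op a b N f m = L * f m" for m
    using dual_hahn_rec[of L "of_nat a" "of_nat b" "of_nat N" m] by (simp add: jacobi_op_def f_def)
  have gr: "jacobi_op a b N g m = L * g m" for m
    unfolding g_def jacobi_op_cmult jacobi_op_row_weight hahn_op_shifted_hahn L by simp
  have neg: "f m = g m" if "- int a \<le> m" "m < 0" for m
  proof -
    have "of_int (- m - 1) = (of_nat (nat (- m - 1)) :: complex)" using that by simp
    then have "shifted_hahn a b N i (of_int (- m - 1)) = 0"
      by (simp only:) (rule shifted_hahn_eq_0, use that in linarith)
    then show ?thesis using that by (simp add: f_def g_def dual_hahn_neg)
  qed
  \<comment> \<open>The recurrence has order two, so two neighbouring values are carried along. It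
    cannot start earlier: at \<open>m = - 1\<close> its factor \<open>m + 1\<close> is 0 and says
    nothing about the value at 0.\<close>
  have pos: "f (int n) = g (int n) \<and> f (int n - 1) = g (int n - 1)" for n
  proof (induction n)
    case 0
    have "inv_fact (int N + int b) = 1 / fact (N + b)"
      using inv_fact_of_nat[of "N + b"] by simp
    then have "f 0 = g 0"
      by (simp add: f_def g_def dual_hahn_0 row_weight_def shifted_hahn_minus_1[OF i] parity_sign_def)
    then show ?case using neg[of "- 1"] a by simp
  next
    case (Suc n)
    have "of_int (int n + 1) * f (int n + 1) = of_int (int n + 1) * g (int n + 1)"
      using fr[of "int n"] gr[of "int n"] Suc unfolding jacobi_op_def
      by (metis (no_types, lifting) add_right_cancel)
    moreover have "(of_int (int n + 1) :: complex) \<noteq> 0"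
      by (simp only: of_int_eq_0_iff)
    ultimately show ?case using Suc by (simp add: add.commute)
  qed
  show ?thesis
  proof (cases "m < 0")
    case True
    then show ?thesis using neg m by (simp add: f_def g_def L_def)
  next
    case False
    then show ?thesis using pos[of "nat m"] by (simp add: f_def g_def L_def)
  qed
qed

subsection \<open>The polynomials W\<close>

text \<open>Coefficients of \<open>phi\<close> without its prefactor, with \<open>- 2 - N\<close>
  already in place of \<open>N\<close>.\<close>

definition phi_coeff :: "nat \<Rightarrow> nat \<Rightarrow> nat \<Rightarrow> nat \<Rightarrow> nat \<Rightarrow> complex \<Rightarrow> complex" where
  "phi_coeff a b N u j s = pochhammer (- of_nat u) j * pochhammer (of_nat u - s - of_nat a - of_nat b + 1) j
     / (pochhammer (- of_nat a - s + 1) j * pochhammer (2 + of_nat N) j * fact j)"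

lemma phi_coeff_Suc:
  "phi_coeff a b N u (Suc j) s = phi_coeff a b N u j s
     * ((of_nat j - of_nat u) * (of_nat u - s - of_nat a - of_nat b + 1 + of_nat j)
        / ((- of_nat a - s + 1 + of_nat j) * (2 + of_nat N + of_nat j) * of_nat (Suc j)))"
  unfolding phi_coeff_def pochhammer_Suc fact_Suc by (simp add: mult_ac)

lemma phi_coeff_eq_0: "u < j \<Longrightarrow> phi_coeff a b N u j s = 0"
  by (simp add: phi_coeff_def pochhammer_of_nat_eq_0_iff)

definition phi_coeff_deriv :: "nat \<Rightarrow> nat \<Rightarrow> nat \<Rightarrow> nat \<Rightarrow> nat \<Rightarrow> complex" where
  "phi_coeff_deriv a b N u j = deriv (phi_coeff a b N u j) 0"

lemma phi_coeff_deriv_eq_0: "u < j \<Longrightarrow> phi_coeff_deriv a b N u j = 0"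
proof -
  assume "u < j"
  then have "phi_coeff a b N u j = (\<lambda>s. 0)" by (intro ext) (rule phi_coeff_eq_0)
  then show ?thesis by (simp add: phi_coeff_deriv_def)
qed

text \<open>The product rule for the ratio of consecutive coefficients. The denominator
  \<open>F - s\<close> of that ratio is nonzero at 0 below \<open>a\<close> and vanishes there for
  \<open>Suc j = a\<close>, which is why the derivatives are confined to indices below
  \<open>a\<close>.\<close>

lemma phi_coeff_Suc_deriv:
  assumes j: "Suc j < a" and D: "(phi_coeff a b N u j has_field_derivative D) (at 0)"
  defines "E \<equiv> (of_nat u - of_nat a - of_nat b + 1 + of_nat j :: complex)"
    and "F \<equiv> (1 + of_nat j - of_nat a :: complex)"
    and "G \<equiv> ((2 + of_nat N + of_nat j) * of_nat (Suc j) :: complex)"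
    and "c \<equiv> (of_nat j - of_nat u :: complex)"
  shows "(phi_coeff a b N u (Suc j) has_field_derivative
     (D * (c * E / (F * G)) + phi_coeff a b N u j 0 * (c * (E - F) / (F * F * G)))) (at 0)"
proof -
  have F: "F \<noteq> 0"
  proof -
    have "F = of_int (int j + 1 - int a)" by (simp add: F_def)
    then show ?thesis using j by (simp only: of_int_eq_0_iff)
  qed
  have "(of_nat (2 + N + j) :: complex) \<noteq> 0" by (simp only: of_nat_eq_0_iff)
  then have "(2 + of_nat N + of_nat j :: complex) \<noteq> 0" by (simp only: of_nat_add of_nat_numeral not_False_eq_True)
  then have G: "G \<noteq> 0" unfolding G_def by (simp add: of_nat_neq_0 del: of_nat_Suc)
  have e: "phi_coeff a b N u (Suc j) = (\<lambda>s. phi_coeff a b N u j s * (c * (E - s) / ((F - s) * G)))"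
    by (rule ext) (simp only: phi_coeff_Suc E_def F_def G_def c_def, simp add: algebra_simps)
  have "((\<lambda>s. c * (E - s) / ((F - s) * G)) has_field_derivative (c * (E - F) / (F * F * G))) (at 0)"
    using F G by (auto intro!: derivative_eq_intros simp: field_simps)
  from DERIV_mult[OF D this] show ?thesis
    unfolding e by (simp add: mult_ac add_ac)
qed

lemma phi_coeff_has_deriv: "j < a \<Longrightarrow> (phi_coeff a b N u j has_field_derivative phi_coeff_deriv a b N u j) (at 0)"
proof (induction j)
  case 0
  have "phi_coeff a b N u 0 = (\<lambda>s. 1)" by (rule ext) (simp add: phi_coeff_def)
  then show ?case by (simp add: phi_coeff_deriv_def)
next
  case (Suc j)
  then have "(phi_coeff a b N u j has_field_derivative phi_coeff_deriv a b N u j) (at 0)" by simp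
  from phi_coeff_Suc_deriv[OF Suc.prems this] show ?case
    unfolding phi_coeff_deriv_def by (metis DERIV_imp_deriv)
qed

text \<open>The derivative at \<open>s = 0\<close> of the two-term relation
  \<open>(F - s) * G * p (Suc j) = c * (E - s) * p j\<close>; the right-hand side comes from the two
  linear factors in \<open>s\<close>.\<close>

lemma phi_coeff_deriv_rec:
  assumes j: "Suc j < a"
  shows "(hahn_eigenvalue a b j - hahn_eigenvalue a b u) * phi_coeff_deriv a b N u j + hahn_subdiag a N (Suc j) * phi_coeff_deriv a b N u (Suc j)
    = (of_nat j - of_nat u) * phi_coeff a b N u j 0
      - (2 + of_nat N + of_nat j) * of_nat (Suc j) * phi_coeff a b N u (Suc j) 0"
proof -
  define E F G c where "E = (of_nat u - of_nat a - of_nat b + 1 + of_nat j :: complex)"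
    and "F = (1 + of_nat j - of_nat a :: complex)"
    and "G = ((2 + of_nat N + of_nat j) * of_nat (Suc j) :: complex)"
    and "c = (of_nat j - of_nat u :: complex)"
  have F: "F \<noteq> 0"
  proof -
    have "F = of_int (int j + 1 - int a)" by (simp add: F_def)
    then show ?thesis using j by (simp only: of_int_eq_0_iff)
  qed
  have "(of_nat (2 + N + j) :: complex) \<noteq> 0" by (simp only: of_nat_eq_0_iff)
  then have "(2 + of_nat N + of_nat j :: complex) \<noteq> 0" by (simp only: of_nat_add of_nat_numeral not_False_eq_True)
  then have G: "G \<noteq> 0" unfolding G_def by (simp add: of_nat_neq_0 del: of_nat_Suc)
  have d: "phi_coeff_deriv a b N u (Suc j) = phi_coeff_deriv a b N u j * (c * E / (F * G)) + phi_coeff a b N u j 0 * (c * (E - F) / (F * F * G))"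
    unfolding E_def F_def G_def c_def
    using phi_coeff_Suc_deriv[OF j phi_coeff_has_deriv] phi_coeff_has_deriv[OF j] j
    by (intro DERIV_unique) auto
  have q: "phi_coeff a b N u (Suc j) 0 = phi_coeff a b N u j 0 * (c * E / (F * G))"
    unfolding phi_coeff_Suc E_def F_def G_def c_def by (simp add: algebra_simps)
  have b: "hahn_subdiag a N (Suc j) = - (F * G)" by (simp add: hahn_subdiag_def F_def G_def algebra_simps)
  have l: "hahn_eigenvalue a b j - hahn_eigenvalue a b u = c * E"
    unfolding hahn_eigenvalue_diff c_def E_def by (simp add: algebra_simps)
  have "c * E * D + - (F * G) * (D * (c * E / (F * G)) + Q * (c * (E - F) / (F * F * G)))
      = c * Q - G * (Q * (c * E / (F * G)))" for D Q
    using F G by (simp add: field_simps)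
  then show ?thesis unfolding b l d q G_def[symmetric] c_def[symmetric] .
qed

lemma pochhammer_minus_nonzero:
  "t < a \<Longrightarrow> pochhammer (1 - of_nat a :: complex) t \<noteq> 0"
  using pochhammer_of_nat_eq_0_iff[of "a - 1" t, where 'a = complex] by (simp add: of_nat_diff)

lemma pochhammer_pos_nonzero: "pochhammer (2 + of_nat N :: complex) t \<noteq> 0"
proof -
  have "(2 + of_nat N :: complex) = of_nat (Suc N) + 1" by simp
  then show ?thesis
    by (simp only: pochhammer_Suc_of_nat divide_eq_0_iff fact_nonzero simp_thms)
qed

text \<open>For \<open>2 * t >= a + b\<close> both functions whose derivatives are subtracted in W
  have this prefactor, since the maximum in \<open>phi\<close> is \<open>t\<close> for either of
  them.\<close>

definition phi_scale :: "nat \<Rightarrow> nat \<Rightarrow> nat \<Rightarrow> complex" where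
  "phi_scale a N t = pochhammer (1 - of_nat a) t * pochhammer (2 + of_nat N) t"

lemma phi_scale_nonzero: "t < a \<Longrightarrow> phi_scale a N t \<noteq> 0"
  by (simp add: phi_scale_def pochhammer_minus_nonzero pochhammer_pos_nonzero)

text \<open>All \<open>t < a\<close> are covered: those with \<open>t < b\<close> are not rows by
  themselves but occur inside \<open>W_(a+i)\<close>, and together they form a triangular
  basis.\<close>

definition W_coeff :: "nat \<Rightarrow> nat \<Rightarrow> nat \<Rightarrow> nat \<Rightarrow> nat \<Rightarrow> complex" where
  "W_coeff a b N t j = (if a + b \<le> 2 * t
     then phi_scale a N t * (phi_coeff_deriv a b N t j - phi_coeff_deriv a b N (a + b - t - 1) j)
     else hahn_coeff (- of_nat a) (- of_nat b) (- 2 - of_nat N) t j)"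

lemma phi_deriv:
  assumes "u < a"
  shows "deriv (\<lambda>s. phi a b (- 2 - of_nat N) u s x) 0
    = phi_scale a N (max u (a + b - u - 1)) * poch_expansion (phi_coeff_deriv a b N u) a x"
proof -
  have e: "phi a b (- 2 - of_nat N) u s x
      = phi_scale a N (max u (a + b - u - 1)) * (\<Sum>j\<le>u. phi_coeff a b N u j s * pochhammer (- x) j)" for s
    by (simp add: phi_def phi_scale_def phi_coeff_def add_ac mult_ac)
  have "((\<lambda>s. phi a b (- 2 - of_nat N) u s x) has_field_derivative
     phi_scale a N (max u (a + b - u - 1)) * (\<Sum>j\<le>u. phi_coeff_deriv a b N u j * pochhammer (- x) j)) (at 0)"
    unfolding e using assms
    by (intro DERIV_cmult DERIV_sum DERIV_cmult_right phi_coeff_has_deriv) auto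
  moreover have "(\<Sum>j\<le>u. phi_coeff_deriv a b N u j * pochhammer (- x) j) = poch_expansion (phi_coeff_deriv a b N u) a x"
    unfolding poch_expansion_def using assms by (intro sum.mono_neutral_left) (auto simp: phi_coeff_deriv_eq_0)
  ultimately show ?thesis by (simp add: DERIV_imp_deriv)
qed

lemma ceiling_half_le_iff: "\<lceil>(real a + real b) / 2\<rceil> \<le> int g \<longleftrightarrow> a + b \<le> 2 * g"
  by (simp add: ceiling_le_iff) linarith

lemma W_fun_low:
  assumes "t < a" "1 \<le> b"
  shows "W_fun a b N M t x = poch_expansion (W_coeff a b N t) a x"
proof (cases "a + b \<le> 2 * t")
  case True
  then have m: "max t (a + b - t - 1) = t" and m': "max (a + b - t - 1) (a + b - (a + b - t - 1) - 1) = t"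
    and u: "a + b - t - 1 < a"
    using assms by auto
  have "W_fun a b N M t x = deriv (\<lambda>s. phi a b (- 2 - of_nat N) t s x) 0
        - deriv (\<lambda>s. phi a b (- 2 - of_nat N) (a + b - t - 1) s x) 0"
    using True assms unfolding W_fun_def ceiling_half_le_iff by auto
  also have "\<dots> = poch_expansion (W_coeff a b N t) a x"
    unfolding phi_deriv[OF assms(1)] phi_deriv[OF u] m m'
    using True by (simp add: poch_expansion_def W_coeff_def sum_distrib_left sum_subtractf algebra_simps)
  finally show ?thesis .
next
  case False
  then have "W_fun a b N M t x = hahn (- of_nat a) (- of_nat b) (- 2 - of_nat N) t x"
    using assms unfolding W_fun_def ceiling_half_le_iff by auto
  also have "\<dots> = poch_expansion (W_coeff a b N t) a x"
    using False assms hahn_eq_poch_expansion[OF assms(1)] by (simp add: W_coeff_def[abs_def])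
  finally show ?thesis .
qed

lemma W_coeff_above: "t < j \<Longrightarrow> W_coeff a b N t j = 0"
  by (auto simp: W_coeff_def hahn_coeff_eq_0 phi_coeff_deriv_eq_0)

text \<open>At \<open>s = 0\<close> the coefficients of \<open>phi\<close> are those of a Hahn
  polynomial in hypergeometric normalisation; below \<open>a\<close> the denominators
  \<open>pochhammer (1 - a) j\<close> are nonzero and can be cleared.\<close>

lemma hahn_coeff_eq_phi_coeff:
  assumes "t < a"
  shows "hahn_coeff (- of_nat a) (- of_nat b) (- 2 - of_nat N) t j = phi_scale a N t * phi_coeff a b N t j 0"
proof (cases "j \<le> t")
  case False
  then show ?thesis by (simp add: hahn_coeff_eq_0 phi_coeff_eq_0)
next
  case True
  have "pochhammer (1 - of_nat a :: complex) t = pochhammer (1 - of_nat a) j * pochhammer (1 - of_nat a + of_nat j) (t - j)"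
    "pochhammer (2 + of_nat N :: complex) t = pochhammer (2 + of_nat N) j * pochhammer (2 + of_nat N + of_nat j) (t - j)"
    using True by (rule pochhammer_product)+
  moreover have "pochhammer (1 - of_nat a :: complex) j \<noteq> 0" "pochhammer (2 + of_nat N :: complex) j \<noteq> 0"
    using True assms by (auto simp: pochhammer_minus_nonzero pochhammer_pos_nonzero)
  ultimately show ?thesis
    by (simp add: hahn_coeff_def phi_scale_def phi_coeff_def field_simps)
qed

text \<open>The quotient of scales compensates the different normalisations of \<open>W_t\<close>
  and its partner. The condition \<open>t < a\<close> gives 0 for the rows \<open>g >= a\<close>,
  which are true eigenfunctions.\<close>

definition jordan_entry :: "nat \<Rightarrow> nat \<Rightarrow> nat \<Rightarrow> nat \<Rightarrow> complex" where
  "jordan_entry a b N t = (if t < a \<and> a + b \<le> 2 * t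
     then (of_nat (a + b - t - 1) - of_nat t) * phi_scale a N t / phi_scale a N (a + b - t - 1) else 0)"

text \<open>
  Differentiating the two-term recurrence of the coefficients at \<open>s = 0\<close> and subtracting the
  versions for \<open>t\<close> and \<open>a + b - t - 1\<close>, which share the eigenvalue, gives a Jordan block.
\<close>
lemma W_coeff_rec:
  assumes t: "t < a" and b: "1 \<le> b"
  shows "(hahn_eigenvalue a b j - hahn_eigenvalue a b t) * W_coeff a b N t j + hahn_subdiag a N (Suc j) * W_coeff a b N t (Suc j)
    = jordan_entry a b N t * W_coeff a b N (a + b - t - 1) j"
proof (cases "a + b \<le> 2 * t")
  case False
  then show ?thesis
    using hahn_coeff_rec[of j "- of_nat a" "- 2 - of_nat N" "- of_nat b" t]
    unfolding hahn_eigenvalue_diff hahn_subdiag_def by (simp add: jordan_entry_def W_coeff_def algebra_simps)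
next
  case True
  define u where "u = a + b - t - 1"
  have u: "u < t" "u < a" "\<not> a + b \<le> 2 * u" using True t b by (auto simp: u_def)
  have tu: "(of_nat t :: complex) = of_nat a + of_nat b - 1 - of_nat u"
    using t b by (simp add: u_def of_nat_diff)
  have th: "jordan_entry a b N t = (of_nat u - of_nat t) * phi_scale a N t / phi_scale a N u"
    using True t by (simp add: jordan_entry_def u_def)
  have Yt: "W_coeff a b N t i = phi_scale a N t * (phi_coeff_deriv a b N t i - phi_coeff_deriv a b N u i)" for i
    using True by (simp add: W_coeff_def u_def)
  have Yu: "W_coeff a b N u j = phi_scale a N u * phi_coeff a b N u j 0"
    using u by (simp add: W_coeff_def hahn_coeff_eq_phi_coeff)
  \<comment> \<open>At \<open>s = 0\<close> the coefficients depend on \<open>t\<close> and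
    \<open>u\<close> only through \<open>pochhammer (- t) j * pochhammer (- u) j\<close>, hence
    symmetrically. The sources with index \<open>Suc j\<close> then cancel in the
    difference.\<close>
  have q: "phi_coeff a b N t i 0 = phi_coeff a b N u i 0" for i
  proof -
    have e: "of_nat t - 0 - of_nat a - of_nat b + 1 = (- of_nat u :: complex)"
      "of_nat u - 0 - of_nat a - of_nat b + 1 = (- of_nat t :: complex)"
      by (simp_all add: tu)
    show ?thesis unfolding phi_coeff_def e by (simp add: mult.commute)
  qed
  show ?thesis
  proof (cases "j < t")
    case True
    then have j: "Suc j < a" using t by simp
    have l: "hahn_eigenvalue a b u = hahn_eigenvalue a b t" by (simp add: hahn_eigenvalue_def lam_def tu algebra_simps)
    define G where "G = (2 + of_nat N + of_nat j) * of_nat (Suc j) * phi_coeff a b N u (Suc j) 0"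
    have e1: "(hahn_eigenvalue a b j - hahn_eigenvalue a b t) * phi_coeff_deriv a b N t j + hahn_subdiag a N (Suc j) * phi_coeff_deriv a b N t (Suc j)
        = (of_nat j - of_nat t) * phi_coeff a b N u j 0 - G"
      and e2: "(hahn_eigenvalue a b j - hahn_eigenvalue a b t) * phi_coeff_deriv a b N u j + hahn_subdiag a N (Suc j) * phi_coeff_deriv a b N u (Suc j)
        = (of_nat j - of_nat u) * phi_coeff a b N u j 0 - G"
      using phi_coeff_deriv_rec[OF j, of b t N] phi_coeff_deriv_rec[OF j, of b u N] unfolding l q G_def by auto
    have "(hahn_eigenvalue a b j - hahn_eigenvalue a b t) * (phi_coeff_deriv a b N t j - phi_coeff_deriv a b N u j)
        + hahn_subdiag a N (Suc j) * (phi_coeff_deriv a b N t (Suc j) - phi_coeff_deriv a b N u (Suc j))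
      = (of_nat u - of_nat t) * phi_coeff a b N u j 0"
      using arg_cong2[OF e1 e2, of "(-)"] by (simp add: algebra_simps)
    moreover have th2: "jordan_entry a b N t * W_coeff a b N u j = phi_scale a N t * ((of_nat u - of_nat t) * phi_coeff a b N u j 0)"
      using phi_scale_nonzero[OF u(2), of N] by (simp add: th Yu)
    ultimately show ?thesis
      unfolding u_def[symmetric] th2 Yt by (simp flip: distrib_left mult.left_commute[of "phi_scale a N t"])
  next
    case False
    then have "W_coeff a b N t (Suc j) = 0" "W_coeff a b N u j = 0" "j = t \<or> W_coeff a b N t j = 0"
      using u by (auto simp: W_coeff_above not_less le_less)
    then show ?thesis unfolding u_def[symmetric] by auto
  qed
qed

text \<open>For \<open>2 * t >= a + b\<close> the Hahn polynomial of degree \<open>t\<close> drops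
  to degree \<open>a + b - t - 1\<close>, because the coefficient of index \<open>t\<close> has a
  simple zero at \<open>s = 0\<close>. Differentiation turns that zero into a nonzero value, and the
  subtracted function has smaller degree.\<close>

lemma W_coeff_diag:
  assumes t: "t < a" and b: "1 \<le> b"
  shows "W_coeff a b N t t \<noteq> 0"
proof (cases "a + b \<le> 2 * t")
  case False
  define u where "u = a + b - t - 1"
  have "(pochhammer (- of_nat t) t :: complex) \<noteq> 0"
    by (simp add: pochhammer_of_nat_eq_0_iff)
  moreover have e: "(- of_nat a + - of_nat b + of_nat t + 1 :: complex) = - of_nat u"
    using t b by (simp add: u_def of_nat_diff)
  moreover have "(pochhammer (- of_nat u) t :: complex) \<noteq> 0"
  proof -
    have "t \<le> u" using False by (simp add: u_def)
    then show ?thesis by (simp add: pochhammer_of_nat_eq_0_iff)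
  qed
  ultimately show ?thesis using False unfolding W_coeff_def hahn_coeff_def e by simp
next
  case True
  define u where "u = a + b - t - 1"
  have u: "u < t" using True t b by (auto simp: u_def)
  define g where "g s = (\<Prod>i\<in>{..<t} - {u}. (of_nat i - of_nat u - s)) / pochhammer (- of_nat a - s + 1) t" for s :: complex
  define c where "c = pochhammer (- of_nat t) t / (pochhammer (2 + of_nat N) t * fact t :: complex)"
  have c: "c \<noteq> 0"
    by (simp add: c_def pochhammer_pos_nonzero pochhammer_of_nat_eq_0_iff)
  have tu: "(of_nat t - of_nat a - of_nat b + 1 :: complex) = - of_nat u"
    using t b by (simp add: u_def of_nat_diff)
  have "pochhammer (of_nat t - s - of_nat a - of_nat b + 1) t = (\<Prod>i<t. of_nat i - of_nat u - s)" for s :: complex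
    unfolding pochhammer_prod atLeast0LessThan using tu by (intro prod.cong) (auto simp: algebra_simps)
  \<comment> \<open>The factor with \<open>i = u\<close> is \<open>- s\<close>: the simple
    zero.\<close>
  also have "(\<Prod>i<t. of_nat i - of_nat u - s) = - s * (\<Prod>i\<in>{..<t} - {u}. (of_nat i - of_nat u - s))" for s :: complex
    using u by (subst prod.remove[of _ u]) auto
  finally have q: "phi_coeff a b N t t = (\<lambda>s. s * (- c * g s))"
    by (intro ext) (simp add: phi_coeff_def g_def c_def mult_ac)
  have nz: "pochhammer (- of_nat a - 0 + 1 :: complex) t \<noteq> 0"
    using pochhammer_minus_nonzero[OF t] by simp
  have g0: "g 0 \<noteq> 0" using nz by (auto simp: g_def)
  have "isCont g 0"
    unfolding g_def[abs_def] pochhammer_prod using nz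
    by (intro continuous_intros) (auto simp: pochhammer_prod)
  then have "isCont (\<lambda>s. - c * g s) 0" by (intro continuous_intros)
  then have "(phi_coeff a b N t t has_field_derivative (- c * g 0)) (at 0)"
    unfolding q CARAT_DERIV by (intro exI[of _ "\<lambda>s. - c * g s"]) (auto simp: mult_ac)
  then have "phi_coeff_deriv a b N t t = - c * g 0"
    by (simp add: phi_coeff_deriv_def DERIV_imp_deriv)
  then show ?thesis
    using True c g0 phi_scale_nonzero[OF t, of N] u by (simp add: W_coeff_def phi_coeff_deriv_eq_0 u_def)
qed


section \<open>The expansion of \<open>pochhammer (- x) (a - 1)\<close> and the span of the
  rows\<close>

lemma triangular_expansion:
  fixes Y :: "nat \<Rightarrow> nat \<Rightarrow> 'a :: field"
  assumes "\<And>t. t < n \<Longrightarrow> Y t t \<noteq> 0" "\<And>t j. t < n \<Longrightarrow> t < j \<Longrightarrow> Y t j = 0"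
    and "\<And>j. n \<le> j \<Longrightarrow> p j = 0"
  shows "\<exists>c. \<forall>j. p j = (\<Sum>t<n. c t * Y t j)"
  using assms
proof (induction n arbitrary: p)
  case 0
  then show ?case by auto
next
  case (Suc n)
  define k where "k = p n / Y n n"
  have "\<exists>c. \<forall>j. p j - k * Y n j = (\<Sum>t<n. c t * Y t j)"
  proof (rule Suc.IH)
    fix j assume "n \<le> j"
    then show "p j - k * Y n j = 0"
      using Suc.prems by (cases "j = n") (auto simp: k_def)
  qed (use Suc.prems in auto)
  then obtain c where c: "\<And>j. p j - k * Y n j = (\<Sum>t<n. c t * Y t j)" by blast
  show ?case
  proof (intro exI allI)
    fix j
    have "(\<Sum>t<n. (c(n := k)) t * Y t j) = (\<Sum>t<n. c t * Y t j)"
      by (intro sum.cong) auto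
    then show "p j = (\<Sum>t<Suc n. (c(n := k)) t * Y t j)"
      using c[of j] by (simp add: algebra_simps)
  qed
qed

text \<open>
  In the basis \<open>pochhammer (- x) j\<close> the Hahn operator is bidiagonal. Pairing coefficients with its left
  eigenvector kills every W of another eigenvalue, which isolates one coefficient of an expansion.
\<close>
definition left_eigenvector :: "nat \<Rightarrow> nat \<Rightarrow> nat \<Rightarrow> nat \<Rightarrow> nat \<Rightarrow> complex" where
  "left_eigenvector a b N d j = (if j < d then 0 else \<Prod>l\<in>{d<..j}. hahn_subdiag a N l / (hahn_eigenvalue a b d - hahn_eigenvalue a b l))"

lemma hahn_eigenvalue_neq:
  assumes "d + t + 1 < a + b" "d \<noteq> t"
  shows "hahn_eigenvalue a b d \<noteq> hahn_eigenvalue a b t"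
proof -
  have "(of_nat d + of_nat t + 1 - of_nat a - of_nat b :: complex) = of_int (int d + int t + 1 - int a - int b)"
    by simp
  also have "\<dots> \<noteq> 0" unfolding of_int_eq_0_iff using assms by linarith
  finally have "hahn_eigenvalue a b d - hahn_eigenvalue a b t \<noteq> 0"
    using assms unfolding hahn_eigenvalue_diff by simp
  then show ?thesis by simp
qed

lemma left_eigenvector_eq:
  assumes "d < b" "j < a" "b \<le> a"
  shows "hahn_eigenvalue a b j * left_eigenvector a b N d j + hahn_subdiag a N j * left_eigenvector a b N d (j - 1) = hahn_eigenvalue a b d * left_eigenvector a b N d j"
proof -
  consider "j < d" | "j = d" | "d < j" by linarith
  then show ?thesis
  proof cases
    case 3
    then obtain i where j: "j = Suc i" by (cases j) auto
    have "{d<..j} = insert j {d<..i}" using 3 j by auto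
    then have p: "left_eigenvector a b N d j = hahn_subdiag a N j / (hahn_eigenvalue a b d - hahn_eigenvalue a b j) * left_eigenvector a b N d i"
      using 3 j by (simp add: left_eigenvector_def)
    have "hahn_eigenvalue a b d \<noteq> hahn_eigenvalue a b j" using assms 3 by (intro hahn_eigenvalue_neq) auto
    then show ?thesis unfolding p by (simp add: j field_simps)
  next
    case 2
    then show ?thesis by (cases j) (auto simp: left_eigenvector_def hahn_subdiag_def)
  qed (auto simp: left_eigenvector_def)
qed

text \<open>The value at the top index \<open>j = a - 1\<close> is the one that enters
  \<open>unit_coefficient\<close>.\<close>

lemma left_eigenvector_formula:
  assumes "d \<le> j" "j < a" "d < b" "b \<le> a"
  shows "left_eigenvector a b N d j = fact j * fact (a - 1 - d) * fact (N + 1 + j) * fact (a + b - 2 - d - j)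
    / (fact d * fact (a - 1 - j) * fact (N + 1 + d) * fact (j - d) * fact (a + b - 2 - 2 * d))"
  using assms
proof (induction j rule: dec_induct)
  case base
  have "a + b - 2 - d - d = a + b - 2 - 2 * d" by simp
  then show ?case by (simp add: left_eigenvector_def del: fact_Suc)
next
  case (step j)
  \<comment> \<open>Offsets replace the truncated differences, so that each quotient of factorials
    is a single successor step.\<close>
  obtain e where a: "a = Suc (Suc (j + e))" using step by (metis less_imp_Suc_add add_Suc)
  obtain f where b: "b = Suc (d + f)" using step less_imp_Suc_add by blast
  obtain k where j: "j = d + k" using step le_Suc_ex by blast
  have p: "left_eigenvector a b N d (Suc j) = hahn_subdiag a N (Suc j) / (hahn_eigenvalue a b d - hahn_eigenvalue a b (Suc j)) * left_eigenvector a b N d j"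
  proof -
    have "{d<..Suc j} = insert (Suc j) {d<..j}" using step by auto
    then show ?thesis using step by (simp add: left_eigenvector_def)
  qed
  have b1: "hahn_subdiag a N (Suc j) = of_nat (Suc j) * of_nat (Suc e) * of_nat (N + 2 + j)"
    by (simp add: hahn_subdiag_def a algebra_simps)
  have l1: "hahn_eigenvalue a b d - hahn_eigenvalue a b (Suc j) = of_nat (Suc k) * of_nat (Suc (e + f))"
    unfolding hahn_eigenvalue_diff by (simp add: a b j algebra_simps)
  have IH: "left_eigenvector a b N d j = fact j * fact (a - 1 - d) * fact (N + 1 + j) * fact (Suc (e + f))
    / (fact d * fact (Suc e) * fact (N + 1 + d) * fact k * fact (a + b - 2 - 2 * d))"
    using step by (simp add: a b j)
  have r: "fact (Suc j) = of_nat (Suc j) * (fact j :: complex)"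
    "fact (N + 1 + Suc j) = of_nat (N + 2 + j) * (fact (N + 1 + j) :: complex)"
    "a + b - 2 - d - Suc j = e + f" "a - 1 - Suc j = e" "Suc j - d = Suc k"
    "fact (Suc k) = of_nat (Suc k) * (fact k :: complex)"
    "fact (Suc e) = of_nat (Suc e) * (fact e :: complex)"
    "fact (Suc (e + f)) = of_nat (Suc (e + f)) * (fact (e + f) :: complex)"
    by (simp_all add: a b j algebra_simps)
  have alg: "S * E * T / (K * H) * (x * y * z * (H * w) / (u * (E * v) * q * r * s))
     = S * x * y * (T * z) * w / (u * v * q * (K * r) * s)"
    if "E \<noteq> 0" "H \<noteq> 0" "K \<noteq> 0" for S E T K H x y z w u v q r s :: complex
    using that by (simp add: divide_simps)
  show ?case
    unfolding p b1 l1 IH r by (rule alg) (rule of_nat_neq_0)+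
qed

text \<open>The operator acts under the pairing as the eigenvalue of \<open>d\<close>, but on W as
  another one. In a Jordan block the partner is annihilated before \<open>W_t\<close>
  itself.\<close>

lemma left_eigenvector_W_coeff:
  assumes t: "t < a" and d: "d < b" and ba: "b \<le> a" and td: "t \<noteq> d"
  shows "(\<Sum>j<a. left_eigenvector a b N d j * W_coeff a b N t j) = 0"
proof -
  define \<Psi> where "\<Psi> p = (\<Sum>j<a. left_eigenvector a b N d j * p j)" for p :: "nat \<Rightarrow> complex"
  have T: "\<Psi> (\<lambda>j. hahn_eigenvalue a b j * p j + hahn_subdiag a N (Suc j) * p (Suc j)) = hahn_eigenvalue a b d * \<Psi> p" for p
  proof -
    have "\<Psi> (\<lambda>j. hahn_eigenvalue a b j * p j + hahn_subdiag a N (Suc j) * p (Suc j))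
        = (\<Sum>j<a. hahn_eigenvalue a b j * left_eigenvector a b N d j * p j) + (\<Sum>j<a. left_eigenvector a b N d j * hahn_subdiag a N (Suc j) * p (Suc j))"
      by (simp add: \<Psi>_def ring_distribs sum.distrib mult_ac)
    also have "(\<Sum>j<a. left_eigenvector a b N d j * hahn_subdiag a N (Suc j) * p (Suc j))
        = (\<Sum>j<Suc a. left_eigenvector a b N d (j - 1) * hahn_subdiag a N j * p j)"
      by (subst sum.lessThan_Suc_shift) (simp add: hahn_subdiag_def)
    \<comment> \<open>The term \<open>j = a\<close> drops by the zero of \<open>hahn_subdiag\<close>
      at \<open>a\<close>.\<close>
    also have "\<dots> = (\<Sum>j<a. left_eigenvector a b N d (j - 1) * hahn_subdiag a N j * p j)"
      by (simp add: hahn_subdiag_def)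
    also have "(\<Sum>j<a. hahn_eigenvalue a b j * left_eigenvector a b N d j * p j) + \<dots>
        = (\<Sum>j<a. (hahn_eigenvalue a b j * left_eigenvector a b N d j + hahn_subdiag a N j * left_eigenvector a b N d (j - 1)) * p j)"
      by (simp add: ring_distribs sum.distrib mult_ac)
    also have "\<dots> = (\<Sum>j<a. hahn_eigenvalue a b d * left_eigenvector a b N d j * p j)"
      by (intro sum.cong refl) (simp only: lessThan_iff left_eigenvector_eq[OF d _ ba])
    finally show ?thesis by (simp add: \<Psi>_def sum_distrib_left mult_ac)
  qed
  have key: "\<Psi> (W_coeff a b N t) = 0" if t: "t < a" "t \<noteq> d" and th: "jordan_entry a b N t * \<Psi> (W_coeff a b N (a + b - t - 1)) = 0" for t
  proof -
    have "hahn_eigenvalue a b d * \<Psi> (W_coeff a b N t) = \<Psi> (\<lambda>j. hahn_eigenvalue a b t * W_coeff a b N t j + jordan_entry a b N t * W_coeff a b N (a + b - t - 1) j)"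
      unfolding T[symmetric]
    proof (rule arg_cong[of _ _ \<Psi>], rule ext, goal_cases)
      case (1 j)
      show ?case using W_coeff_rec[of t a b j N] t d by (simp add: algebra_simps)
    qed
    also have "\<dots> = hahn_eigenvalue a b t * \<Psi> (W_coeff a b N t) + jordan_entry a b N t * \<Psi> (W_coeff a b N (a + b - t - 1))"
      by (simp add: \<Psi>_def ring_distribs sum.distrib sum_distrib_left mult_ac)
    finally have "(hahn_eigenvalue a b d - hahn_eigenvalue a b t) * \<Psi> (W_coeff a b N t) = 0"
      using th by (simp add: algebra_simps)
    moreover have "hahn_eigenvalue a b d \<noteq> hahn_eigenvalue a b t"
      using t d ba by (intro hahn_eigenvalue_neq) auto
    ultimately show ?thesis by simp
  qed
  \<comment> \<open>The partner has no Jordan entry of its own, and it differs from \<open>d\<close>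
    because \<open>a + b - t - 1 >= b > d\<close>.\<close>
  have "jordan_entry a b N t * \<Psi> (W_coeff a b N (a + b - t - 1)) = 0"
  proof (cases "a + b \<le> 2 * t")
    case True
    then have "\<Psi> (W_coeff a b N (a + b - t - 1)) = 0"
      using t d ba by (intro key) (auto simp: jordan_entry_def)
    then show ?thesis by simp
  qed (simp add: jordan_entry_def)
  with key[OF t td] show ?thesis by (simp add: \<Psi>_def)
qed

lemma hahn_coeff_diag:
  assumes "2 * d < a + b"
  shows "hahn_coeff (- of_nat a) (- of_nat b) (- 2 - of_nat N) d d = fact (a + b - 1 - d) / fact (a + b - 1 - 2 * d)"
proof -
  have e: "(- of_nat a + - of_nat b + of_nat d + 1 :: complex) = - of_nat (a + b - 1 - d)"
    using assms by (simp add: of_nat_diff)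
  have i: "int (a + b - 1 - d) - int d = int (a + b - 1 - 2 * d)"
    using assms by (simp add: of_nat_diff)
  show ?thesis
    unfolding hahn_coeff_def e pochhammer_minus_eq_inv_fact i by simp
qed

text \<open>Pairing the expansion with the left eigenvector of \<open>d\<close> leaves only
  \<open>W_d\<close>, and of it only the top coefficient, because the eigenvector starts at
  \<open>d\<close> and \<open>W_d\<close> ends there. For \<open>d = b - 1 - i\<close> this is the
  share of \<open>pochhammer (- x) (a - 1)\<close> that \<open>W_(a+i)\<close> has to carry.\<close>

lemma unit_coefficient:
  assumes d: "d < b" and ba: "b \<le> a"
    and c: "\<And>j. (if j = a - 1 then 1 else 0) = (\<Sum>t<a. c t * W_coeff a b N t j)"
  shows "c d * (fact (a + b - 1 - d) / fact (a + b - 1 - 2 * d))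
    = fact (a - 1) * fact (N + a) * fact (b - 1 - d) / (fact d * fact (N + 1 + d) * fact (a + b - 2 - 2 * d))"
proof -
  have "left_eigenvector a b N d (a - 1) = (\<Sum>j<a. left_eigenvector a b N d j * (if j = a - 1 then 1 else 0))"
    using d ba by (simp add: mult_delta_right)
  also have "\<dots> = (\<Sum>t<a. c t * (\<Sum>j<a. left_eigenvector a b N d j * W_coeff a b N t j))"
    unfolding c sum_distrib_left by (subst sum.swap) (simp add: mult_ac)
  also have "\<dots> = (\<Sum>t<a. if t = d then c d * (\<Sum>j<a. left_eigenvector a b N d j * W_coeff a b N d j) else 0)"
    using d ba by (intro sum.cong) (auto simp: left_eigenvector_W_coeff)
  also have "\<dots> = c d * (\<Sum>j<a. left_eigenvector a b N d j * W_coeff a b N d j)"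
    using d ba by simp
  also have "(\<Sum>j<a. left_eigenvector a b N d j * W_coeff a b N d j) = (\<Sum>j<a. if j = d then W_coeff a b N d d else 0)"
    by (intro sum.cong) (auto simp: W_coeff_above left_eigenvector_def not_less_iff_gr_or_eq)
  also have "\<dots> = W_coeff a b N d d" using d ba by simp
  also have "W_coeff a b N d d = fact (a + b - 1 - d) / fact (a + b - 1 - 2 * d)"
    using d ba by (simp add: W_coeff_def hahn_coeff_diag)
  finally have "c d * (fact (a + b - 1 - d) / fact (a + b - 1 - 2 * d)) = left_eigenvector a b N d (a - 1)" ..
  also have "\<dots> = fact (a - 1) * fact (a - 1 - d) * fact (N + 1 + (a - 1)) * fact (a + b - 2 - d - (a - 1))
    / (fact d * fact (a - 1 - (a - 1)) * fact (N + 1 + d) * fact (a - 1 - d) * fact (a + b - 2 - 2 * d))"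
    using d ba by (intro left_eigenvector_formula) auto
  finally show ?thesis
    using d ba by (simp del: fact_Suc add: Suc_diff_Suc mult_ac)
qed

lemma W_fun_high:
  assumes "i < b" "b \<le> a"
  shows "W_fun a b N M (a + i) x = (-1) ^ (b + (a + i)) * fact (a + i - b) *
          (fact (b - 1 - i) * shifted_hahn a b N i x
           + fact i * (fact (N + a + i + 1) / fact (N + b - i)) / (complex_of_real (M i) - 1)
             * poch_expansion (W_coeff a b N (b - 1 - i)) a x)"
proof -
  have p: "pochhammer (of_nat N + of_nat a + of_nat b + 1 - of_nat (a + i)) (2 * (a + i) - a - b + 1)
      = (fact (N + a + i + 1) / fact (N + b - i) :: complex)"
    using pochhammer_Suc_of_nat[of "N + b - i" "2 * (a + i) - a - b + 1"] assms
    by (simp add: of_nat_diff algebra_simps)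
  have Y: "hahn (- of_nat a) (- of_nat b) (- 2 - of_nat N) (b - 1 - i) x = poch_expansion (W_coeff a b N (b - 1 - i)) a x"
  proof -
    define d where "d = b - 1 - i"
    have d: "d < a" "\<not> a + b \<le> 2 * d" using assms by (auto simp: d_def)
    then have "W_coeff a b N d = hahn_coeff (- of_nat a) (- of_nat b) (- 2 - of_nat N) d"
      by (intro ext) (simp add: W_coeff_def)
    then show ?thesis using d unfolding d_def[symmetric] by (simp add: hahn_eq_poch_expansion)
  qed
  have "W_fun a b N M (a + i) x = (-1) ^ (b + (a + i)) * fact (a + i - b) *
          (fact (b - 1 - i) * shifted_hahn a b N i x
           + fact i * pochhammer (of_nat N + of_nat a + of_nat b + 1 - of_nat (a + i)) (2 * (a + i) - a - b + 1)
               / (complex_of_real (M i) - 1)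
             * hahn (- of_nat a) (- of_nat b) (- 2 - of_nat N) (b - 1 - i) x)"
    using assms by (auto simp: W_fun_def shifted_hahn_def add_ac)
  then show ?thesis unfolding p Y .
qed

lemma poch_expansion_W_coeff_op:
  assumes "t < a" "1 \<le> b"
  shows "hahn_op a b N (poch_expansion (W_coeff a b N t) a) x
    = hahn_eigenvalue a b t * poch_expansion (W_coeff a b N t) a x + jordan_entry a b N t * poch_expansion (W_coeff a b N (a + b - t - 1)) a x"
proof -
  have "hahn_op a b N (poch_expansion (W_coeff a b N t) a) x
    = hahn_eigenvalue a b t * poch_expansion (W_coeff a b N t) a x + poch_expansion (\<lambda>j. jordan_entry a b N t * W_coeff a b N (a + b - t - 1) j) a x"
    using assms by (intro hahn_op_poch_expansion W_coeff_rec) (auto simp: hahn_subdiag_def)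
  then show ?thesis by (simp add: poch_expansion_def sum_distrib_left mult_ac)
qed

text \<open>For \<open>g = a + i\<close> the two summands of W belong to the mirrored degrees
  \<open>a + i\<close> and \<open>b - 1 - i\<close>, hence to the same eigenvalue.\<close>

lemma hahn_op_W_fun:
  assumes "b \<le> g" "g < a + b" "1 \<le> b" "b \<le> a"
  shows "hahn_op a b N (W_fun a b N M g) x
    = hahn_eigenvalue a b g * W_fun a b N M g x + jordan_entry a b N g * W_fun a b N M (a + b - g - 1) x"
proof (cases "g < a")
  case True
  then have "a + b - g - 1 < a \<or> jordan_entry a b N g = 0" using assms by (auto simp: jordan_entry_def)
  moreover have "W_fun a b N M g = poch_expansion (W_coeff a b N g) a"
    using True assms by (intro ext W_fun_low) auto
  ultimately show ?thesis
    using poch_expansion_W_coeff_op[of g a b N x] True assms by (auto simp: W_fun_low)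
next
  case False
  then obtain i where g: "g = a + i" using le_Suc_ex not_less by blast
  have i: "i < b" using assms g by simp
  define d where "d = b - 1 - i"
  define s k where "s = (-1) ^ (b + (a + i)) * (fact (a + i - b) :: complex) * fact (b - 1 - i)"
    and "k = (-1) ^ (b + (a + i)) * fact (a + i - b) * (fact i * (fact (N + a + i + 1) / fact (N + b - i)) / (complex_of_real (M i) - 1))"
  have W: "W_fun a b N M g = (\<lambda>x. s * shifted_hahn a b N i x + k * poch_expansion (W_coeff a b N d) a x)"
    unfolding g s_def k_def d_def using i assms by (intro ext) (simp add: W_fun_high algebra_simps)
  have t: "jordan_entry a b N d = 0" "jordan_entry a b N g = 0" using i assms g by (auto simp: jordan_entry_def d_def)
  have l: "hahn_eigenvalue a b d = hahn_eigenvalue a b g" using i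
    by (simp add: g d_def hahn_eigenvalue_def lam_def of_nat_diff algebra_simps)
  have d: "d < a" using i assms by (simp add: d_def)
  have "hahn_op a b N (W_fun a b N M g) x = s * hahn_op a b N (shifted_hahn a b N i) x + k * hahn_op a b N (poch_expansion (W_coeff a b N d) a) x"
    unfolding W by (simp add: hahn_op_def algebra_simps)
  also have "\<dots> = hahn_eigenvalue a b g * W_fun a b N M g x"
    using d assms unfolding W
    by (simp add: hahn_op_shifted_hahn poch_expansion_W_coeff_op t l g[symmetric] algebra_simps)
  finally show ?thesis by (simp add: t)
qed

lemma sum_lessThan_add: "(\<Sum>i<m + n. f i) = (\<Sum>i<m. f i) + (\<Sum>i<n. f (m + i))"
  for m n :: nat
  by (induction n) (simp_all add: add_ac)

text \<open>The right-hand side is the zeroth moment sequence with \<open>row_weight\<close> divided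
  out: the part for unit parameters plus a correction at every free point.\<close>

lemma W_expansion:
  assumes b: "1 \<le> b" and ba: "b \<le> a" and M: "\<And>i. i < b \<Longrightarrow> M i \<noteq> 1"
  shows "\<exists>w. \<forall>x. (\<Sum>r<a. w r * W_fun a b N M (b + r) x)
    = (fact (N + b))\<^sup>2 / (fact (N + a) * fact (a - 1)) * pochhammer (- x) (a - 1)
      + (\<Sum>i<b. (complex_of_real (M i) - 1) * nu_weight a b N i
           * (fact (N + b - i) / fact (a + i)) * shifted_hahn a b N i x)"
proof -
  define C where "C = ((fact (N + b))\<^sup>2 / (fact (N + a) * fact (a - 1)) :: complex)"
  have "\<exists>c. \<forall>j. (if j = a - 1 then 1 else 0) = (\<Sum>t<a. c t * W_coeff a b N t j)"
    using b ba by (intro triangular_expansion) (auto simp: W_coeff_diag W_coeff_above)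
  then obtain c where c: "\<And>j. (if j = a - 1 then 1 else 0) = (\<Sum>t<a. c t * W_coeff a b N t j)" by blast
  define Y where "Y t x = poch_expansion (W_coeff a b N t) a x" for t x
  have poch: "pochhammer (- x) (a - 1) = (\<Sum>t<a. c t * Y t x)" for x
  proof -
    have "pochhammer (- x) (a - 1) = (\<Sum>j<a. (if j = a - 1 then 1 else 0) * pochhammer (- x) j)"
      using b ba by (simp add: mult_delta_left)
    also have "\<dots> = (\<Sum>t<a. c t * Y t x)"
      unfolding c Y_def poch_expansion_def sum_distrib_left sum_distrib_right
      by (subst sum.swap) (simp add: mult_ac)
    finally show ?thesis .
  qed
  \<comment> \<open>\<open>A i\<close> is forced by comparing the coefficients of
    \<open>shifted_hahn\<close>; the factor \<open>M i - 1\<close> then cancels from the other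
    summand of \<open>W_(a+i)\<close>.\<close>
  define A where "A i = nu_weight a b N i * (fact (N + b - i) / fact (a + i))
      / ((-1) ^ (b + (a + i)) * fact (a + i - b) * fact (b - 1 - i))" for i
  define w where "w r = (if b + r < a then C * c (b + r)
     else (complex_of_real (M (b + r - a)) - 1) * A (b + r - a))" for r
  have hi: "w (a - b + i) * W_fun a b N M (b + (a - b + i)) x
      = (complex_of_real (M i) - 1) * nu_weight a b N i * (fact (N + b - i) / fact (a + i)) * shifted_hahn a b N i x
        + C * c (b - 1 - i) * Y (b - 1 - i) x" if i: "i < b" for i x
  proof -
    define d where "d = b - 1 - i"
    have e: "b + (a - b + i) = a + i" "a + i - a = i" using ba by auto
    have m: "complex_of_real (M i) - 1 \<noteq> 0" using M[OF i] by simp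
    define sg where "sg = ((-1) ^ (b + (a + i)) * fact (a + i - b) :: complex)"
    have sg: "sg \<noteq> 0" by (simp add: sg_def)
    have d': "d < b" "b - 1 - d = i" "N + 1 + d = N + b - i" "a + b - 1 - d = a + i"
      "a + b - 1 - 2 * d = Suc (2 * i + (a - b))" "a + b - 2 - 2 * d = 2 * i + (a - b)"
      using i ba by (auto simp: d_def)
    have cd: "c d * (fact (a + i) / fact (Suc (2 * i + (a - b))))
      = fact (a - 1) * fact (N + a) * fact i / (fact d * fact (N + b - i) * fact (2 * i + (a - b)))"
      using unit_coefficient[OF d'(1) ba c] unfolding d' .
    have f: "fact (Suc (2 * i + (a - b))) = of_nat (2 * i + (a - b) + 1) * (fact (2 * i + (a - b)) :: complex)"
      by (simp add: algebra_simps)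
    have nz: "(of_nat (2 * i + (a - b) + 1) :: complex) \<noteq> 0" by (simp only: of_nat_eq_0_iff)
    \<comment> \<open>Here the measure and W fit together: once the \<open>shifted_hahn\<close> part
      is right, the remaining polynomial of degree \<open>d\<close> appears with precisely its
      coefficient in \<open>C * pochhammer (- x) (a - 1)\<close>.\<close>
    have nw: "nu_weight a b N i * (fact (N + b - i) / fact (a + i)) / fact d
       * (fact i * (fact (N + a + i + 1) / fact (N + b - i))) = C * c d"
    proof -
      have "c d = fact (a - 1) * fact (N + a) * fact i / (fact d * fact (N + b - i) * fact (2 * i + (a - b)))
         * (fact (Suc (2 * i + (a - b))) / fact (a + i))"
        unfolding cd[symmetric] by (simp del: fact_Suc)
      also have "\<dots> = of_nat (2 * i + (a - b) + 1) * fact (a - 1) * fact (N + a) * fact i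
          / (fact d * fact (N + b - i) * fact (a + i))"
        unfolding f by simp
      finally have c1: "c d = of_nat (2 * i + (a - b) + 1) * fact (a - 1) * fact (N + a) * fact i
          / (fact d * fact (N + b - i) * fact (a + i))" .
      show ?thesis unfolding c1 C_def nu_weight_def by (simp add: mult_ac del: fact_Suc)
    qed
    have "w (a - b + i) * W_fun a b N M (b + (a - b + i)) x = (complex_of_real (M i) - 1) * A i * W_fun a b N M (a + i) x"
      using ba unfolding w_def e by simp
    also have "\<dots> = (complex_of_real (M i) - 1) * nu_weight a b N i * (fact (N + b - i) / fact (a + i)) * shifted_hahn a b N i x
        + nu_weight a b N i * (fact (N + b - i) / fact (a + i)) / fact d
       * (fact i * (fact (N + a + i + 1) / fact (N + b - i))) * Y d x"
    proof -
      have "m * (v / (s * f)) * (s * (f * X + k / m * Z)) = m * v * X + v / f * k * Z"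
        if "m \<noteq> 0" "s \<noteq> 0" "f \<noteq> 0" for m v s f X k Z :: complex
        using that by (simp add: field_simps)
      from this[OF m sg fact_nonzero[of d]] show ?thesis
        unfolding W_fun_high[OF i ba] A_def Y_def d_def[symmetric] sg_def[symmetric]
        by (simp only: mult.assoc)
    qed
    finally show ?thesis unfolding nw unfolding d_def .
  qed
  have "(\<Sum>r<a. w r * W_fun a b N M (b + r) x)
    = C * pochhammer (- x) (a - 1)
      + (\<Sum>i<b. (complex_of_real (M i) - 1) * nu_weight a b N i
           * (fact (N + b - i) / fact (a + i)) * shifted_hahn a b N i x)" for x
  proof -
    have "(\<Sum>r<a. w r * W_fun a b N M (b + r) x)
        = (\<Sum>r<a - b. w r * W_fun a b N M (b + r) x) + (\<Sum>i<b. w (a - b + i) * W_fun a b N M (b + (a - b + i)) x)"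
      using ba sum_lessThan_add[of "\<lambda>r. w r * W_fun a b N M (b + r) x" "a - b" b] by simp
    also have "(\<Sum>r<a - b. w r * W_fun a b N M (b + r) x) = (\<Sum>r<a - b. C * c (b + r) * Y (b + r) x)"
      using b by (intro sum.cong) (auto simp: w_def W_fun_low Y_def)
    also have "(\<Sum>i<b. w (a - b + i) * W_fun a b N M (b + (a - b + i)) x)
        = (\<Sum>i<b. (complex_of_real (M i) - 1) * nu_weight a b N i
           * (fact (N + b - i) / fact (a + i)) * shifted_hahn a b N i x) + (\<Sum>i<b. C * c (b - 1 - i) * Y (b - 1 - i) x)"
      using hi by (simp add: sum.distrib)
    also have "(\<Sum>i<b. C * c (b - 1 - i) * Y (b - 1 - i) x) = (\<Sum>t<b. C * c t * Y t x)"
      using sum.nat_diff_reindex[of "\<lambda>t. C * c t * Y t x" b] by simp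
    finally have "(\<Sum>r<a. w r * W_fun a b N M (b + r) x)
      = ((\<Sum>t<b. C * c t * Y t x) + (\<Sum>r<a - b. C * c (b + r) * Y (b + r) x))
       + (\<Sum>i<b. (complex_of_real (M i) - 1) * nu_weight a b N i
           * (fact (N + b - i) / fact (a + i)) * shifted_hahn a b N i x)"
      by (simp add: add_ac)
    also have "(\<Sum>t<b. C * c t * Y t x) + (\<Sum>r<a - b. C * c (b + r) * Y (b + r) x) = (\<Sum>t<a. C * c t * Y t x)"
      using ba sum_lessThan_add[of "\<lambda>t. C * c t * Y t x" b "a - b"] by simp
    also have "\<dots> = C * pochhammer (- x) (a - 1)"
      unfolding poch sum_distrib_left by (simp add: mult_ac)
    finally show ?thesis .
  qed
  then show ?thesis unfolding C_def by blast
qed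

subsection \<open>Moments of the dual Hahn polynomials\<close>

text \<open>Writing each parameter as \<open>1 + (M y - 1)\<close> splits the integral into the case
  of unit parameters, known from \<open>dual_hahn_unit_moment\<close>, and evaluations at the free
  points.\<close>

lemma moment_0_of_nat:
  assumes b: "1 \<le> b" and ba: "b \<le> a"
  shows "moment a b N M 0 (int m)
    = row_weight (N + b) (int m) * ((fact (N + b))\<^sup>2 / (fact (N + a) * fact (a - 1)) * pochhammer (of_nat m + 1) (a - 1))
      + (\<Sum>i<b. (complex_of_real (M i) - 1) * nu_weight a b N i
           * poly (dual_hahn (of_nat a) (of_nat b) (of_nat N) (int m)) (lam (of_nat a) (of_nat b) (of_nat i - of_nat b)))"
proof -
  define R where "R y = poly (dual_hahn (of_nat a) (of_nat b) (of_nat N) (int m)) (lam (of_nat a) (of_nat b) (of_nat y - of_nat b))" for y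
  have "moment a b N M 0 (int m) = (\<Sum>y\<le>N + b. (if y < b then complex_of_real (M y) else 1) * nu_weight a b N y * R y)"
    unfolding moment_def nu_integral[OF ba] R_def by simp
  also have "\<dots> = (\<Sum>y\<le>N + b. nu_weight a b N y * R y) + (\<Sum>y\<le>N + b. if y < b then (complex_of_real (M y) - 1) * nu_weight a b N y * R y else 0)"
    unfolding sum.distrib[symmetric] by (intro sum.cong) (auto simp: algebra_simps)
  also have "(\<Sum>y\<le>N + b. if y < b then (complex_of_real (M y) - 1) * nu_weight a b N y * R y else 0)
      = (\<Sum>i<b. (complex_of_real (M i) - 1) * nu_weight a b N i * R i)"
    by (intro sum.mono_neutral_cong_right) auto
  also have "(\<Sum>y\<le>N + b. nu_weight a b N y * R y)
      = (fact (N + b))\<^sup>2 * ((-1) ^ m * pochhammer (of_nat a) m / (fact m * fact (N + a)) * inv_fact (int (N + b) - int m))"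
  proof -
    have e: "of_nat b + of_nat (a - b) = (of_nat a :: complex)" "of_nat (N + b) - of_nat b = (of_nat N :: complex)"
      "N + b + (a - b) = N + a"
      using ba by (simp_all add: of_nat_diff)
    have "nu_weight a b N y * R y = (fact (N + b))\<^sup>2
        * (of_nat (2 * y + (a - b) + 1) / (fact (N + b - y) * fact (N + a + y + 1)) * R y)" for y
      by (simp add: nu_weight_def mult_ac del: fact_Suc of_nat_Suc)
    then show ?thesis
      using dual_hahn_unit_moment[where b = "of_nat b" and K = "N + b" and c = "a - b" and m = m]
      unfolding e R_def[symmetric] by (simp only: sum_distrib_left[symmetric])
  qed
  also have "pochhammer (of_nat a) m = (fact (a - 1 + m) / fact (a - 1) :: complex)"
    using pochhammer_Suc_of_nat[of "a - 1" m] b ba by (simp add: of_nat_diff)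
  also have "(fact (N + b))\<^sup>2 * ((-1) ^ m * (fact (a - 1 + m) / fact (a - 1)) / (fact m * fact (N + a)) * inv_fact (int (N + b) - int m))
     = row_weight (N + b) (int m) * ((fact (N + b))\<^sup>2 / (fact (N + a) * fact (a - 1)) * pochhammer (of_nat m + 1) (a - 1))"
    unfolding pochhammer_Suc_of_nat row_weight_def parity_sign_simps by (simp add: add.commute mult_ac)
  finally show ?thesis unfolding R_def .
qed

text \<open>At \<open>k = 0\<close> this is minus the value of the rows at \<open>m = - a\<close>,
  where the moment is 0. For \<open>k < N + a\<close> each further step multiplies it by
  \<open>rec_C\<close> at \<open>m = k + 1 - a\<close>.\<close>

definition defect :: "nat \<Rightarrow> nat \<Rightarrow> nat \<Rightarrow> nat \<Rightarrow> complex" where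
  "defect a b N k = fact k * (fact (N + b))\<^sup>2 / (fact (N + a - k) * fact (N + a + b - k))"

text \<open>The Jordan partner of \<open>b + r\<close> is \<open>b + (a - b - 1 - r)\<close>, so the
  off-diagonal terms stay among the rows \<open>b, ..., a - 1\<close>.\<close>

lemma hahn_op_W_span:
  assumes "1 \<le> b" "b \<le> a"
  shows "\<exists>w'. \<forall>x. hahn_op a b N (\<lambda>x. \<Sum>r<a. w r * W_fun a b N M (b + r) x) x = (\<Sum>r<a. w' r * W_fun a b N M (b + r) x)"
proof (intro exI allI)
  fix x
  have "hahn_op a b N (\<lambda>x. \<Sum>r<a. w r * W_fun a b N M (b + r) x) x
      = (\<Sum>r<a. w r * hahn_op a b N (W_fun a b N M (b + r)) x)"
    by (rule hahn_op_sum)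
  also have "\<dots> = (\<Sum>r<a. w r * hahn_eigenvalue a b (b + r) * W_fun a b N M (b + r) x
      + (if r < a - b then w r * jordan_entry a b N (b + r) * W_fun a b N M (b + (a - b - Suc r)) x else 0))"
  proof (rule sum.cong, goal_cases)
    case (2 r)
    then have "r < a - b \<Longrightarrow> a + b - (b + r) - 1 = b + (a - b - Suc r)" and "\<not> r < a - b \<Longrightarrow> jordan_entry a b N (b + r) = 0"
      using assms by (auto simp: jordan_entry_def)
    then show ?case using 2 assms by (auto simp: hahn_op_W_fun algebra_simps)
  qed simp
  also have "\<dots> = (\<Sum>r<a. w r * hahn_eigenvalue a b (b + r) * W_fun a b N M (b + r) x)
      + (\<Sum>r<a. if r < a - b then w r * jordan_entry a b N (b + r) * W_fun a b N M (b + (a - b - Suc r)) x else 0)"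
    by (rule sum.distrib)
  also have "(\<Sum>r<a. if r < a - b then w r * jordan_entry a b N (b + r) * W_fun a b N M (b + (a - b - Suc r)) x else 0)
      = (\<Sum>r<a - b. w r * jordan_entry a b N (b + r) * W_fun a b N M (b + (a - b - Suc r)) x)"
    by (intro sum.mono_neutral_cong_right) auto
  also have "\<dots> = (\<Sum>r<a - b. w (a - b - Suc r) * jordan_entry a b N (b + (a - b - Suc r)) * W_fun a b N M (b + r) x)"
    by (subst sum.nat_diff_reindex[symmetric]) (auto intro!: sum.cong)
  also have "\<dots> = (\<Sum>r<a. (if r < a - b then w (a - b - Suc r) * jordan_entry a b N (b + (a - b - Suc r)) else 0) * W_fun a b N M (b + r) x)"
    by (intro sum.mono_neutral_cong_left) auto
  finally show "hahn_op a b N (\<lambda>x. \<Sum>r<a. w r * W_fun a b N M (b + r) x) x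
      = (\<Sum>r<a. (w r * hahn_eigenvalue a b (b + r)
        + (if r < a - b then w (a - b - Suc r) * jordan_entry a b N (b + (a - b - Suc r)) else 0)) * W_fun a b N M (b + r) x)"
    by (simp only: ring_distribs sum.distrib)
qed

text \<open>
  On \<open>m > k - a\<close> the moment sequence of \<open>y^k\<close> is a combination of the rows built from W.
  Both families obey the same recurrence, but the moments vanish for negative \<open>m\<close>; the mismatch
  first shows at \<open>m = k - a\<close>, where it produces the norms.
\<close>
lemma moment_rows:
  assumes b: "1 \<le> b" and ba: "b \<le> a" and M: "\<And>i. i < b \<Longrightarrow> M i \<noteq> 1" and k: "k \<le> N + a"
  shows "\<exists>w. \<forall>m \<ge> int k - int a. moment a b N M k m
    = (\<Sum>r<a. w r * (row_weight (N + b) m * W_fun a b N M (b + r) (of_int (- m - 1))))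
      + (if m = int k - int a then defect a b N k else 0)"
  using k
proof (induction k)
  case 0
  define C where "C = ((fact (N + b))\<^sup>2 / (fact (N + a) * fact (a - 1)) :: complex)"
  obtain w where w: "\<And>x. (\<Sum>r<a. w r * W_fun a b N M (b + r) x)
    = C * pochhammer (- x) (a - 1)
      + (\<Sum>i<b. (complex_of_real (M i) - 1) * nu_weight a b N i
           * (fact (N + b - i) / fact (a + i)) * shifted_hahn a b N i x)"
    using W_expansion[where M = M and N = N, OF b ba M] unfolding C_def by blast
  show ?case
  proof (intro exI allI impI)
    fix m assume m: "int 0 - int a \<le> m"
    define S where "S = (\<Sum>i<b. (complex_of_real (M i) - 1) * nu_weight a b N i
           * poly (dual_hahn (of_nat a) (of_nat b) (of_nat N) m) (lam (of_nat a) (of_nat b) (of_nat i - of_nat b)))"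
    have "(\<Sum>r<a. w r * (row_weight (N + b) m * W_fun a b N M (b + r) (of_int (- m - 1))))
        = row_weight (N + b) m * (\<Sum>r<a. w r * W_fun a b N M (b + r) (of_int (- m - 1)))"
      by (simp add: sum_distrib_left mult_ac)
    also have "\<dots> = row_weight (N + b) m * (C * pochhammer (of_int (m + 1)) (a - 1))
      + (\<Sum>i<b. (complex_of_real (M i) - 1) * nu_weight a b N i
           * (fact (N + b - i) / fact (a + i) * (row_weight (N + b) m * shifted_hahn a b N i (of_int (- m - 1)))))"
      unfolding w distrib_left sum_distrib_left
      by (intro arg_cong2[of _ _ _ _ "(+)"] sum.cong) (simp_all add: mult_ac add.commute)
    also have "\<dots> = row_weight (N + b) m * (C * pochhammer (of_int (m + 1)) (a - 1)) + S"
      unfolding S_def using b ba m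
      by (intro arg_cong2[of _ _ _ _ "(+)"] refl sum.cong) (auto simp: dual_hahn_eq_shifted_hahn)
    finally have rows: "(\<Sum>r<a. w r * (row_weight (N + b) m * W_fun a b N M (b + r) (of_int (- m - 1))))
      = row_weight (N + b) m * (C * pochhammer (of_int (m + 1)) (a - 1)) + S" .
    consider "0 \<le> m" | "m < 0" "- int a < m" | "m = - int a" using m by linarith
    then show "moment a b N M 0 m
       = (\<Sum>r<a. w r * (row_weight (N + b) m * W_fun a b N M (b + r) (of_int (- m - 1))))
         + (if m = int 0 - int a then defect a b N 0 else 0)"
    proof cases
      case 1
      then obtain n where n: "m = int n" using nonneg_int_cases by blast
      have n1: "of_int (int n + 1) = (of_nat n + 1 :: complex)" "int n \<noteq> int 0 - int a"
        using b ba by simp_all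
      show ?thesis unfolding rows S_def C_def unfolding n moment_0_of_nat[OF b ba] n1(1)
        using n1(2) by (simp only: if_False add_0_right)
    next
      \<comment> \<open>Here the Pochhammer product runs through zero, in agreement with
        \<open>R_m = 0\<close>. One step lower, at \<open>m = - a\<close>, it no longer
        does.\<close>
      case 2
      define j where "j = nat (- m - 1)"
      have j: "of_int (m + 1) = (- of_nat j :: complex)" "j < a - 1"
        using 2 by (auto simp: j_def)
      have "pochhammer (of_int (m + 1) :: complex) (a - 1) = 0"
        unfolding j(1) using j(2) by (simp only: pochhammer_of_nat_eq_0_iff)
      then show ?thesis unfolding rows S_def using 2 by (simp add: moment_neg dual_hahn_neg)
    next
      case 3
      have a: "0 < a" using b ba by simp
      have m1: "of_int (m + 1) = (- of_nat (a - 1) :: complex)"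
        using 3 a by (simp add: of_nat_diff)
      have p: "pochhammer (of_int (m + 1) :: complex) (a - 1) = (-1) ^ (a - 1) * fact (a - 1)"
        unfolding m1 pochhammer_minus_eq_inv_fact by simp
      have "int (N + b) - m = int (N + a + b)" using 3 by simp
      then have kp: "row_weight (N + b) m = - ((-1) ^ (a - 1)) / fact (N + a + b)"
        using 3 a by (simp only: row_weight_def inv_fact_of_nat) (cases a; simp add: parity_sign_def)
      have "S = 0" unfolding S_def using 3 a by (simp add: dual_hahn_neg)
      moreover have "((-1) ^ (a - 1) * (-1) ^ (a - 1) :: complex) = 1"
        by (simp flip: power_mult_distrib)
      ultimately show ?thesis unfolding rows unfolding p kp C_def using 3 a
        by (simp add: moment_neg defect_def field_simps)
    qed
  qed
next
  case (Suc k)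
  then obtain w where w: "\<And>m. int k - int a \<le> m \<Longrightarrow> moment a b N M k m
    = (\<Sum>r<a. w r * (row_weight (N + b) m * W_fun a b N M (b + r) (of_int (- m - 1))))
      + (if m = int k - int a then defect a b N k else 0)" by auto
  define f where "f x = (\<Sum>r<a. w r * W_fun a b N M (b + r) x)" for x
  obtain w' where w': "\<And>x. hahn_op a b N f x = (\<Sum>r<a. w' r * W_fun a b N M (b + r) x)"
    using hahn_op_W_span[OF b ba, of N w M] unfolding f_def by blast
  have wf: "moment a b N M k m = row_weight (N + b) m * f (of_int (- m - 1)) + (if m = int k - int a then defect a b N k else 0)"
    if "int k - int a \<le> m" for m
    unfolding w[OF that] f_def by (simp add: sum_distrib_left mult_ac)
  show ?case
  proof (intro exI allI impI)
    fix m assume m: "int (Suc k) - int a \<le> m"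
    \<comment> \<open>Of the three neighbours only \<open>m - 1\<close> can be the old exceptional
      index, so the error enters through \<open>rec_C\<close> alone.\<close>
    have "moment a b N M (Suc k) m = jacobi_op a b N (\<lambda>m. row_weight (N + b) m * f (of_int (- m - 1))) m
      + rec_C (of_nat a) (of_nat b) (of_nat N) (of_int m) * (if m - 1 = int k - int a then defect a b N k else 0)"
      unfolding moment_Suc unfolding jacobi_op_def using m
      by (simp add: wf del: of_int_add of_int_diff of_int_minus) (simp add: algebra_simps)
    also have "rec_C (of_nat a) (of_nat b) (of_nat N) (of_int m) * (if m - 1 = int k - int a then defect a b N k else 0)
      = (if m = int (Suc k) - int a then defect a b N (Suc k) else 0)"
    proof (cases "m = int (Suc k) - int a")
      case True
      obtain e where e: "N + a = Suc (k + e)" using Suc.prems by (metis Suc_le_lessD less_imp_Suc_add)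
      have c: "rec_C (of_nat a) (of_nat b) (of_nat N) (of_int m)
         = of_nat (Suc k) * (of_nat (Suc e) * of_nat (Suc (e + b)))"
      proof -
        have "(of_nat N :: complex) = of_nat (Suc (k + e)) - of_nat a"
          using e by (metis add_diff_cancel_right' of_nat_add)
        then show ?thesis unfolding rec_C_def True by (simp only:) (simp add: algebra_simps)
      qed
      have d: "N + a - k = Suc e" "N + a - Suc k = e" "N + a + b - k = Suc (e + b)" "N + a + b - Suc k = e + b"
        using e by auto
      have "x * (y * z) * (f * q / ((y * g) * (z * h))) = x * f * q / (g * h)"
        if "y \<noteq> 0" "z \<noteq> 0" for x y z f q g h :: complex
        using that by (simp add: field_simps)
      from this[OF of_nat_neq_0 of_nat_neq_0] show ?thesis
        unfolding c defect_def d using True by (simp del: of_nat_Suc)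
    qed auto
    also have "jacobi_op a b N (\<lambda>m. row_weight (N + b) m * f (of_int (- m - 1))) m
      = (\<Sum>r<a. w' r * (row_weight (N + b) m * W_fun a b N M (b + r) (of_int (- m - 1))))"
      unfolding jacobi_op_row_weight w' by (simp add: sum_distrib_left mult_ac)
    finally show "moment a b N M (Suc k) m
      = (\<Sum>r<a. w' r * (row_weight (N + b) m * W_fun a b N M (b + r) (of_int (- m - 1))))
      + (if m = int (Suc k) - int a then defect a b N (Suc k) else 0)" .
  qed
qed

text \<open>At the points \<open>0, ..., a - 1\<close> every \<open>shifted_hahn\<close> vanishes,
  so \<open>W_(a+i)\<close> reduces to a nonzero multiple of the polynomial of degree
  \<open>b - 1 - i\<close>. The rows thereby become a rescaled rearrangement of a triangular basis
  of the polynomials of degree below \<open>a\<close>.\<close>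

lemma W_rows_independent:
  assumes b: "1 \<le> b" and ba: "b \<le> a" and M: "\<And>i. i < b \<Longrightarrow> M i \<noteq> 1"
    and v: "\<And>x. x < a \<Longrightarrow> (\<Sum>r<a. v r * W_fun a b N M (b + r) (of_nat x)) = 0"
  shows "\<forall>r<a. v r = 0"
proof -
  define s where "s i = (-1) ^ (b + (a + i)) * fact (a + i - b) * (fact i * (fact (N + a + i + 1) / fact (N + b - i)) / (complex_of_real (M i) - 1))" for i
  have s: "s i \<noteq> 0" if "i < b" for i
    using M[OF that] by (simp add: s_def del: fact_Suc)
  \<comment> \<open>For \<open>t < b\<close> the row \<open>r = a - 1 - t\<close> satisfies
    \<open>b + r = a + i\<close> with \<open>i = b - 1 - t\<close>.\<close>
  define u where "u t = (if t < b then v (a - 1 - t) * s (b - 1 - t) else v (t - b))" for t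
  define p where "p j = (\<Sum>t<a. u t * W_coeff a b N t j)" for j
  have comb: "(\<Sum>r<a. v r * W_fun a b N M (b + r) (of_nat x)) = poch_expansion p a (of_nat x)" if x: "x < a" for x
  proof -
    define Y where "Y t = poch_expansion (W_coeff a b N t) a (of_nat x)" for t
    have hi: "v (a - b + i) * W_fun a b N M (b + (a - b + i)) (of_nat x) = u (b - Suc i) * Y (b - Suc i)" if i: "i < b" for i
    proof -
      have e: "b + (a - b + i) = a + i" "a - 1 - (b - Suc i) = a - b + i" "b - 1 - (b - Suc i) = i" "b - 1 - i = b - Suc i"
        using i ba by auto
      have u: "u (b - Suc i) = v (a - b + i) * s i" using i b unfolding u_def e by simp
      show ?thesis unfolding u unfolding e W_fun_high[OF i ba] shifted_hahn_eq_0[OF x] s_def Y_def by simp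
    qed
    have "(\<Sum>r<a. v r * W_fun a b N M (b + r) (of_nat x))
        = (\<Sum>r<a - b. v r * W_fun a b N M (b + r) (of_nat x)) + (\<Sum>i<b. v (a - b + i) * W_fun a b N M (b + (a - b + i)) (of_nat x))"
      using ba sum_lessThan_add[of "\<lambda>r. v r * W_fun a b N M (b + r) (of_nat x)" "a - b" b] by simp
    also have "(\<Sum>r<a - b. v r * W_fun a b N M (b + r) (of_nat x)) = (\<Sum>r<a - b. u (b + r) * Y (b + r))"
      using b by (intro sum.cong) (auto simp: u_def W_fun_low Y_def)
    also have "(\<Sum>i<b. v (a - b + i) * W_fun a b N M (b + (a - b + i)) (of_nat x)) = (\<Sum>t<b. u t * Y t)"
      using hi by (simp add: sum.nat_diff_reindex[of "\<lambda>t. u t * Y t" b])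
    finally have "(\<Sum>r<a. v r * W_fun a b N M (b + r) (of_nat x)) = (\<Sum>t<b. u t * Y t) + (\<Sum>r<a - b. u (b + r) * Y (b + r))"
      by (simp add: add.commute)
    also have "\<dots> = (\<Sum>t<a. u t * Y t)"
      using ba sum_lessThan_add[of "\<lambda>t. u t * Y t" b "a - b"] by simp
    also have "\<dots> = poch_expansion p a (of_nat x)"
      unfolding Y_def p_def poch_expansion_def sum_distrib_left sum_distrib_right
      by (subst sum.swap) (simp add: mult_ac)
    finally show ?thesis .
  qed
  \<comment> \<open>At \<open>x = j\<close> all terms of index above \<open>j\<close> vanish, which
    determines the coefficients from below. The triangular system for \<open>u\<close> is then
    solved from the top degree downward.\<close>
  have p0: "p j = 0" if "j < a" for j
    using that
  proof (induction j rule: less_induct)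
    case (less j)
    have "poch_expansion p a (of_nat j) = (\<Sum>i<a. if i = j then p j * pochhammer (- of_nat j) j else 0)"
      unfolding poch_expansion_def
    proof (intro sum.cong refl)
      fix i assume "i \<in> {..<a}"
      then show "p i * pochhammer (- of_nat j) i = (if i = j then p j * pochhammer (- of_nat j) j else 0)"
        using less.IH[of i] by (cases i j rule: linorder_cases) (auto simp: pochhammer_of_nat_eq_0_iff)
    qed
    then have "p j * pochhammer (- of_nat j) j = 0"
      using comb[OF less.prems] v[OF less.prems] less.prems by simp
    then show ?case by (simp add: pochhammer_of_nat_eq_0_iff)
  qed
  have u0: "u (a - Suc i) = 0" if "i < a" for i
    using that
  proof (induction i rule: less_induct)
    case (less i)
    define t where "t = a - Suc i"
    have t: "t < a" using less.prems by (simp add: t_def)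
    have "u t' = 0" if "t < t'" "t' < a" for t'
      using less.IH[of "a - Suc t'"] that less.prems by (auto simp: t_def)
    then have "p t = (\<Sum>t'<a. if t' = t then u t * W_coeff a b N t t else 0)"
      unfolding p_def
    proof (intro sum.cong refl)
      fix t' assume "t' \<in> {..<a}"
      then show "u t' * W_coeff a b N t' t = (if t' = t then u t * W_coeff a b N t t else 0)"
        using \<open>\<And>t'. t < t' \<Longrightarrow> t' < a \<Longrightarrow> u t' = 0\<close>[of t']
        by (cases t' t rule: linorder_cases) (auto simp: W_coeff_above)
    qed
    then have "u t * W_coeff a b N t t = 0" using p0[OF t] t by simp
    then show ?case using W_coeff_diag[OF t b, of N] by (simp add: t_def)
  qed
  show ?thesis
  proof (intro allI impI)
    fix r assume r: "r < a"
    show "v r = 0"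
    proof (cases "r < a - b")
      case True
      then have "u (b + r) = 0" using u0[of "a - Suc (b + r)"] by simp
      then show ?thesis by (simp add: u_def)
    next
      case False
      define t where "t = a - 1 - r"
      have "t < b" "a - 1 - t = r" "t < a" using False r b ba by (auto simp: t_def)
      moreover have "a - Suc (a - Suc t) = t" using \<open>t < a\<close> by simp
      ultimately have "v r * s (b - 1 - t) = 0" using u0[of "a - Suc t"] by (simp add: u_def)
      then show ?thesis using s[of "b - 1 - t"] \<open>t < b\<close> by simp
    qed
  qed
qed

subsection \<open>Determinants\<close>

lemma det_scale_rows:
  fixes f :: "nat \<Rightarrow> nat \<Rightarrow> 'a :: comm_ring_1"
  shows "Determinant.det (Matrix.mat n n (\<lambda>(i, j). d i * f i j))
    = (\<Prod>i<n. d i) * Determinant.det (Matrix.mat n n (\<lambda>(i, j). f i j))"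
proof -
  have "(\<Prod>i = 0..<n. Matrix.mat n n (\<lambda>(i, j). d i * f i j) $$ (i, p i))
      = (\<Prod>i<n. d i) * (\<Prod>i = 0..<n. Matrix.mat n n (\<lambda>(i, j). f i j) $$ (i, p i))"
    if "p permutes {0..<n}" for p
    unfolding atLeast0LessThan prod.distrib[symmetric]
  proof (rule prod.cong, goal_cases)
    case (2 i)
    then have "p i < n" using permutes_in_image[OF that, of i] by simp
    then show ?case using 2 by simp
  qed simp
  then show ?thesis
    unfolding det_def'[OF mat_carrier] sum_distrib_left
    by (intro sum.cong refl) (simp add: mult_ac del: index_mat)
qed

text \<open>Expanding with another row's entries gives a determinant with two equal rows; here this
  is read off from the adjugate.\<close>

lemma cofactor_orthogonal:
  fixes A :: "'a :: comm_ring_1 mat"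
  assumes A: "A \<in> carrier_mat n n" and r: "r < n" "r \<noteq> i" and i: "i < n"
  shows "(\<Sum>c<n. A $$ (r, c) * cofactor A i c) = 0"
proof -
  have "(A * adj_mat A) $$ (r, i) = 0"
    using adj_mat(2)[OF A] r i A by auto
  moreover have "(A * adj_mat A) $$ (r, i) = (\<Sum>c<n. A $$ (r, c) * cofactor A i c)"
    using A r i adj_mat(1)[OF A]
    by (simp add: scalar_prod_def adj_mat_def atLeast0LessThan)
  ultimately show ?thesis by simp
qed

text \<open>Zeros replace the polynomial first row so that the cofactors along it can be taken over
  the complex numbers. Column \<open>c\<close> belongs to the index
  \<open>m = n + card U - c\<close>.\<close>

definition bordered :: "nat \<Rightarrow> nat \<Rightarrow> nat \<Rightarrow> (nat \<Rightarrow> real) \<Rightarrow> complex set \<Rightarrow> nat \<Rightarrow> complex mat" where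
  "bordered a b N M U n = Matrix.mat (a + card U + 1) (a + card U + 1) (\<lambda>(r, c).
     if r = 0 then 0
     else if r \<le> a then
       pochhammer (of_int (int (N + b) - (int n + int (card U) - int c) + 1)) (a + card U - c)
         * W_fun a b N M (b + (r - 1)) (of_int (- (int n + int (card U) - int c) - 1))
     else
       (-1) ^ c * poly (dual_hahn (of_nat a) (of_nat b) (of_nat N) (int n + int (card U) - int c))
                     (lam (of_nat a) (of_nat b) (lex_list U ! (r - a - 1))))"

definition q_cofactor :: "nat \<Rightarrow> nat \<Rightarrow> nat \<Rightarrow> (nat \<Rightarrow> real) \<Rightarrow> complex set \<Rightarrow> nat \<Rightarrow> nat \<Rightarrow> complex" where
  "q_cofactor a b N M U n c = cofactor (bordered a b N M U n) 0 c"

lemma bordered_carrier: "bordered a b N M U n \<in> carrier_mat (a + card U + 1) (a + card U + 1)"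
  by (simp add: bordered_def)

lemma q_num_expand:
  "q_num a b N M U n = (\<Sum>c<a + card U + 1. smult ((-1) ^ c * q_cofactor a b N M U n c)
     (dual_hahn (of_nat a) (of_nat b) (of_nat N) (int n + int (card U) - int c)))"
proof -
  define m where "m = a + card U + 1"
  define Q where "Q = Matrix.mat m m (\<lambda>(r, c). let j = c + 1 in
       if r = 0 then
         (-1) ^ (j - 1) * dual_hahn (of_nat a) (of_nat b) (of_nat N) (int n + int (card U) - int j + 1)
       else if r \<le> a then
         [:pochhammer (of_int (int b + int N - int n - int (card U) + int j)) (a + card U + 1 - j)
             * W_fun a b N M (b + (r - 1)) (of_int (- int n - int (card U) + int j - 2)):]
       else
         [:(-1) ^ (j - 1)
             * poly (dual_hahn (of_nat a) (of_nat b) (of_nat N) (int n + int (card U) - int j + 1))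
                    (lam (of_nat a) (of_nat b) (lex_list U ! (r - a - 1))):])"
  have Q: "Q \<in> carrier_mat m m" by (simp add: Q_def)
  \<comment> \<open>Away from the first row all entries are constant polynomials, so this
    homomorphism carries the complex minors to the polynomial ones.\<close>
  interpret h: comm_ring_hom "\<lambda>c :: complex. [:c:]"
    by unfold_locales (auto simp: one_pCons)
  have entry: "Q $$ (r, c) = [: bordered a b N M U n $$ (r, c) :]" if "r < m" "c < m" "r \<noteq> 0" for r c
    using that by (simp add: Q_def bordered_def m_def Let_def algebra_simps)
  have dim: "dim_row Q = m" "dim_col Q = m" "dim_row (bordered a b N M U n) = m" "dim_col (bordered a b N M U n) = m"
    by (simp_all add: Q_def bordered_def m_def)
  have del: "mat_delete Q 0 c = map_mat (\<lambda>c. [:c:]) (mat_delete (bordered a b N M U n) 0 c)" if "c < m" for c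
    using that dim by (intro eq_matI) (auto simp: mat_delete_def entry)
  have "q_num a b N M U n = Determinant.det Q"
    by (simp add: q_num_def Q_def m_def Let_def)
  also have "\<dots> = (\<Sum>c<m. Q $$ (0, c) * cofactor Q 0 c)"
    using laplace_expansion_row[OF Q, of 0] by (simp add: m_def)
  also have "\<dots> = (\<Sum>c<m. smult ((-1) ^ c * q_cofactor a b N M U n c)
     (dual_hahn (of_nat a) (of_nat b) (of_nat N) (int n + int (card U) - int c)))"
  proof (rule sum.cong, goal_cases)
    case (2 c)
    then have c: "c < m" by simp
    have "cofactor Q 0 c = [:q_cofactor a b N M U n c:]"
      unfolding q_cofactor_def cofactor_def del[OF c] h.hom_det by (cases "even c") simp_all
    moreover have "Q $$ (0, c) = smult ((-1) ^ c) (dual_hahn (of_nat a) (of_nat b) (of_nat N) (int n + int (card U) - int c))"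
      using c by (cases "even c") (simp_all add: Q_def Let_def algebra_simps)
    ultimately show ?case by (simp add: mult_ac)
  qed simp
  finally show ?thesis unfolding m_def .
qed


lemma bordered_row_orthogonal:
  assumes "r < a + card U"
  shows "(\<Sum>c<a + card U + 1. bordered a b N M U n $$ (Suc r, c) * q_cofactor a b N M U n c) = 0"
  unfolding q_cofactor_def using cofactor_orthogonal[OF bordered_carrier, of "Suc r" a U 0] assms by simp

lemma q_cofactor_first: "q_cofactor a b N M U n 0 = Phi a b N M U n"
proof -
  have "mat_delete (bordered a b N M U n) 0 0 = Matrix.mat (a + card U) (a + card U) (\<lambda>(r, c). let j = c + 1 in
       if r < a then
         pochhammer (of_int (int b + int N - int n - int (card U) + int j + 1)) (a + card U - j)
           * W_fun a b N M (b + r) (of_int (- int n - int (card U) + int j - 1))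
       else
         (-1) ^ j * poly (dual_hahn (of_nat a) (of_nat b) (of_nat N) (int n + int (card U) - int j))
                         (lam (of_nat a) (of_nat b) (lex_list U ! (r - a))))"
    by (intro eq_matI) (auto simp: mat_delete_def bordered_def Let_def Suc_le_eq algebra_simps)
  then show ?thesis by (simp add: q_cofactor_def cofactor_def Phi_def Let_def)
qed

text \<open>Without the last column the matrix is that of \<open>Phi (n + 1)\<close> up to row
  factors. Each Pochhammer product here is longer by its last factor \<open>N + a + b - n\<close>,
  the same in every column, and the rows from \<open>U\<close> differ by a sign.\<close>

lemma q_cofactor_last:
  assumes "n \<le> N + a + b"
  shows "q_cofactor a b N M U n (a + card U)
    = (-1) ^ (a + card U) * (of_nat (N + a + b - n) ^ a * (-1) ^ card U * Phi a b N M U (Suc n))"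
proof -
  define nU where "nU = card U"
  define d where "d r = (if r < a then of_nat (N + a + b - n) else - 1 :: complex)" for r
  define f where "f r c = (let j = c + 1 in
       if r < a then
         pochhammer (of_int (int b + int N - int (Suc n) - int nU + int j + 1)) (a + nU - j)
           * W_fun a b N M (b + r) (of_int (- int (Suc n) - int nU + int j - 1))
       else
         (-1) ^ j * poly (dual_hahn (of_nat a) (of_nat b) (of_nat N) (int (Suc n) + int nU - int j))
                         (lam (of_nat a) (of_nat b) (lex_list U ! (r - a))))" for r c
  have entry: "bordered a b N M U n $$ (Suc r, c) = d r * f r c" if r: "r < a + nU" and c: "c < a + nU" for r c
  proof (cases "r < a")
    case True
    obtain t where t: "a + nU = Suc (c + t)" using c less_imp_Suc_add by blast
    have e: "a + nU - c = Suc t" "a + nU - (c + 1) = t" using t by auto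
    have i: "int (N + b) - (int n + int nU - int c) + 1 = int b + int N - int (Suc n) - int nU + int (c + 1) + 1"
      "- (int n + int nU - int c) - 1 = - int (Suc n) - int nU + int (c + 1) - 1"
      by simp_all
    have l: "of_int (int b + int N - int (Suc n) - int nU + int (c + 1) + 1) + of_nat t = (of_nat (N + a + b - n) :: complex)"
    proof -
      have "int b + int N - int (Suc n) - int nU + int (c + 1) + 1 + int t = int (N + a + b - n)"
        using t assms by linarith
      then show ?thesis by (metis of_int_add of_int_of_nat_eq)
    qed
    have "bordered a b N M U n $$ (Suc r, c) =
       pochhammer (of_int (int (N + b) - (int n + int nU - int c) + 1)) (a + nU - c)
         * W_fun a b N M (b + r) (of_int (- (int n + int nU - int c) - 1))"
      using True r c by (simp add: bordered_def nU_def)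
    moreover have "f r c = pochhammer (of_int (int b + int N - int (Suc n) - int nU + int (c + 1) + 1)) t
         * W_fun a b N M (b + r) (of_int (- int (Suc n) - int nU + int (c + 1) - 1))"
      unfolding f_def Let_def e using True by (simp only: if_True)
    moreover have "d r = of_nat (N + a + b - n)" using True by (simp add: d_def)
    ultimately show ?thesis
      unfolding i e pochhammer_Suc l by (simp only: mult_ac)
  next
    case False
    then show ?thesis using r c
      by (simp add: bordered_def f_def d_def nU_def Suc_le_eq algebra_simps)
  qed
  have dim: "dim_row (bordered a b N M U n) = a + nU + 1" "dim_col (bordered a b N M U n) = a + nU + 1"
    by (simp_all add: bordered_def nU_def)
  have "mat_delete (bordered a b N M U n) 0 (a + nU) = Matrix.mat (a + nU) (a + nU) (\<lambda>(r, c). d r * f r c)"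
    using dim by (intro eq_matI) (auto simp: mat_delete_def entry)
  moreover have "Phi a b N M U (Suc n) = Determinant.det (Matrix.mat (a + nU) (a + nU) (\<lambda>(r, c). f r c))"
    unfolding Phi_def Let_def f_def nU_def ..
  ultimately have "q_cofactor a b N M U n (a + nU) = (-1) ^ (a + nU) * ((\<Prod>r<a + nU. d r) * Phi a b N M U (Suc n))"
    by (simp only: q_cofactor_def cofactor_def det_scale_rows add_0)
  also have "(\<Prod>r<a + nU. d r) = of_nat (N + a + b - n) ^ a * (-1) ^ nU"
  proof -
    have "(\<Prod>r<a + k. d r) = of_nat (N + a + b - n) ^ a * (-1) ^ k" for k
      by (induction k) (simp_all add: d_def)
    then show ?thesis .
  qed
  finally show ?thesis unfolding nU_def .
qed

subsection \<open>Orthogonality\<close>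

text \<open>The columns run from \<open>m = n + card U\<close> down to \<open>n - a\<close>. For
  \<open>k <= n\<close> they all lie in the range of \<open>moment_rows\<close>, and the exceptional
  index \<open>k - a\<close> is met only by the last column and only for
  \<open>k = n\<close>.\<close>

lemma pm_integral_q_num:
  assumes b: "1 \<le> b" and ba: "b \<le> a" and M: "\<And>i. i < b \<Longrightarrow> M i \<noteq> 1"
    and n: "n \<le> N + a" and k: "k \<le> n"
  shows "pm_integral (nu a b N M) (\<lambda>y. y ^ k * poly (q_num a b N M U n) y)
    = (if k = n then defect a b N n * (of_nat (N + a + b - n) ^ a * (-1) ^ card U * Phi a b N M U (Suc n)) else 0)"
proof -
  define nU where "nU = card U"
  define m where "m c = int n + int nU - int c" for c
  define al where "al = q_cofactor a b N M U n"
  obtain w where w: "\<And>m. int k - int a \<le> m \<Longrightarrow> moment a b N M k m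
    = (\<Sum>r<a. w r * (row_weight (N + b) m * W_fun a b N M (b + r) (of_int (- m - 1))))
      + (if m = int k - int a then defect a b N k else 0)"
    using moment_rows[where N = N and M = M and k = k, OF b ba M] n k by auto
  \<comment> \<open>The upper end of the Pochhammer product is independent of the column, and so is
    the sign once \<open>(-1) ^ c\<close> is included; weighted rows and matrix rows thus differ by
    one constant.\<close>
  have row: "(-1) ^ c * (row_weight (N + b) (m c) * W_fun a b N M (b + r) (of_int (- m c - 1)))
      = (-1) ^ (n + nU) / fact (N + a + b - n) * bordered a b N M U n $$ (Suc r, c)"
    if r: "r < a" and c: "c < a + nU + 1" for r c
  proof -
    have p: "pochhammer (of_int (int (N + b) - m c + 1) :: complex) (a + nU - c)
        = fact (N + a + b - n) * inv_fact (int (N + b) - m c)"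
    proof -
      have "int (N + b) - m c + int (a + nU - c) = int (N + a + b - n)"
        using c n by (simp add: m_def of_nat_diff)
      then show ?thesis by (subst pochhammer_eq_inv_fact) simp_all
    qed
    have s: "parity_sign (m c) = (-1) ^ (n + nU) * (-1) ^ c"
      by (auto simp: parity_sign_def m_def minus_one_power_iff)
    have bd: "bordered a b N M U n $$ (Suc r, c)
        = fact (N + a + b - n) * inv_fact (int (N + b) - m c) * W_fun a b N M (b + r) (of_int (- m c - 1))"
      unfolding p[symmetric] using r c by (simp add: bordered_def m_def nU_def)
    have "((-1) ^ c * (-1) ^ c :: complex) = 1" by (simp flip: power_mult_distrib)
    then show ?thesis unfolding bd row_weight_def s by (simp add: mult_ac)
  qed
  have "pm_integral (nu a b N M) (\<lambda>y. y ^ k * poly (q_num a b N M U n) y)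
      = (\<Sum>c<a + nU + 1. (-1) ^ c * al c * moment a b N M k (m c))"
    unfolding moment_def q_num_expand nU_def al_def m_def pm_integral_linear[symmetric]
    by (simp add: poly_sum sum_distrib_left mult_ac del: sum.lessThan_Suc)
  also have "\<dots> = (\<Sum>c<a + nU + 1. (\<Sum>r<a. w r * ((-1) ^ (n + nU) / fact (N + a + b - n) * (bordered a b N M U n $$ (Suc r, c) * al c)))
      + (if c = a + nU \<and> k = n then (-1) ^ c * al c * defect a b N n else 0))"
  proof (rule sum.cong, goal_cases)
    case (2 c)
    then have c: "c < a + nU + 1" by simp
    have "moment a b N M k (m c) = (\<Sum>r<a. w r * (row_weight (N + b) (m c) * W_fun a b N M (b + r) (of_int (- m c - 1))))
      + (if m c = int k - int a then defect a b N k else 0)"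
      using c k by (intro w) (simp add: m_def)
    moreover have "m c = int k - int a \<longleftrightarrow> c = a + nU \<and> k = n" using c k by (auto simp: m_def)
    ultimately have "(-1) ^ c * al c * moment a b N M k (m c)
       = (\<Sum>r<a. w r * (((-1) ^ c * (row_weight (N + b) (m c) * W_fun a b N M (b + r) (of_int (- m c - 1)))) * al c))
        + (if c = a + nU \<and> k = n then (-1) ^ c * al c * defect a b N n else 0)"
      by (simp add: sum_distrib_left mult_ac distrib_left)
    then show ?case using row[OF _ c] by (simp add: mult_ac)
  qed simp
  also have "\<dots> = (\<Sum>r<a. w r * ((-1) ^ (n + nU) / fact (N + a + b - n) * (\<Sum>c<a + nU + 1. bordered a b N M U n $$ (Suc r, c) * al c)))
      + (\<Sum>c<a + nU + 1. if c = a + nU \<and> k = n then (-1) ^ c * al c * defect a b N n else 0)"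
    unfolding sum.distrib sum_distrib_left by (subst sum.swap) simp
  also have "(\<Sum>r<a. w r * ((-1) ^ (n + nU) / fact (N + a + b - n) * (\<Sum>c<a + nU + 1. bordered a b N M U n $$ (Suc r, c) * al c))) = 0"
  proof (intro sum.neutral ballI)
    fix r assume "r \<in> {..<a}"
    then have "(\<Sum>c<a + nU + 1. bordered a b N M U n $$ (Suc r, c) * al c) = 0"
      unfolding al_def nU_def by (intro bordered_row_orthogonal) simp
    then show "w r * ((-1) ^ (n + nU) / fact (N + a + b - n)
        * (\<Sum>c<a + nU + 1. bordered a b N M U n $$ (Suc r, c) * al c)) = 0"
      by (simp only: mult_zero_right)
  qed
  also have "(\<Sum>c<a + nU + 1. if c = a + nU \<and> k = n then (-1) ^ c * al c * defect a b N n else 0)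
     = (if k = n then (-1) ^ (a + nU) * al (a + nU) * defect a b N n else 0)"
    by auto
  also have "al (a + nU) = (-1) ^ (a + nU) * (of_nat (N + a + b - n) ^ a * (-1) ^ nU * Phi a b N M U (Suc n))"
    unfolding al_def nU_def using n by (intro q_cofactor_last) simp
  also have "((-1) ^ (a + nU) * ((-1) ^ (a + nU) * X)) = X" for X :: complex
    by (simp flip: mult.assoc power_mult_distrib)
  finally show ?thesis unfolding nU_def by (simp add: mult_ac)
qed

section \<open>Nonvanishing of the determinant at \<open>n = 0\<close>\<close>

lemma lex_list_distinct: "finite U \<Longrightarrow> distinct (lex_list U)"
  by (metis lex_list(1,3) card_distinct)

text \<open>The difference of two values of \<open>lam\<close> factors as
  \<open>(u - v) * (u + v + a + b + 1)\<close>.\<close>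

lemma lam_inj_on:
  assumes "\<And>u v. u \<in> U \<Longrightarrow> v \<in> U \<Longrightarrow> u + v \<noteq> - of_nat a - of_nat b - 1"
  shows "inj_on (lam (of_nat a) (of_nat b)) U"
proof (rule inj_onI)
  fix u v assume uv: "u \<in> U" "v \<in> U" and e: "lam (of_nat a) (of_nat b) u = lam (of_nat a) (of_nat b) v"
  have "(u - v) * (u + v - (- of_nat a - of_nat b - 1)) = 0"
    using e by (simp add: lam_def algebra_simps)
  moreover have "u + v - (- of_nat a - of_nat b - 1) \<noteq> 0" using assms[OF uv] by simp
  ultimately show "u = v" by simp
qed

lemma prod_linear_dvd:
  fixes g :: "'b \<Rightarrow> 'a :: idom"
  assumes "finite U" "inj_on g U" "\<And>u. u \<in> U \<Longrightarrow> poly p (g u) = 0"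
  shows "(\<Prod>u\<in>U. [:- g u, 1:]) dvd p"
  using assms
proof (induction U arbitrary: p rule: finite_induct)
  case (insert u U)
  obtain q where p: "p = [:- g u, 1:] * q"
    using insert.prems(2)[of u] by (auto simp: poly_eq_0_iff_dvd)
  have "(\<Prod>u\<in>U. [:- g u, 1:]) dvd q"
  proof (rule insert.IH)
    show "inj_on g U" using insert.prems(1) by (simp add: inj_on_insert)
    fix v assume v: "v \<in> U"
    then have "g v \<noteq> g u" using insert.prems(1) insert.hyps(2) by (auto simp: inj_on_def)
    then show "poly q (g v) = 0" using insert.prems(2)[of v] v by (simp add: p)
  qed
  then show ?case using insert.hyps by (simp add: p mult_dvd_mono del: mult_pCons_left)
qed simp

text \<open>Polynomials of exact degrees \<open>0, ..., n - 1\<close> span, so top coefficients can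
  be stripped off one by one. It is applied to a combination of point evaluations and to the pairing
  with a fixed polynomial.\<close>

lemma linear_functional_zero:
  fixes F :: "'a :: field poly \<Rightarrow> 'a" and p :: "nat \<Rightarrow> 'a poly"
  assumes add: "\<And>s t. F (s + t) = F s + F t" and smult: "\<And>c s. F (smult c s) = c * F s"
    and p: "\<And>k. k < n \<Longrightarrow> coeff (p k) k \<noteq> 0" "\<And>k j. k < n \<Longrightarrow> k < j \<Longrightarrow> coeff (p k) j = 0"
      "\<And>k. k < n \<Longrightarrow> F (p k) = 0"
    and s: "\<And>j. n \<le> j \<Longrightarrow> coeff s j = 0"
  shows "F s = 0"
  using p s
proof (induction n arbitrary: s)
  case 0
  then have "s = 0" by (intro poly_eqI) simp
  then show ?case using smult[of 0 0] by simp
next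
  case (Suc n)
  define c where "c = coeff s n / coeff (p n) n"
  have "F (s + smult (- c) (p n)) = 0"
  proof (rule Suc.IH)
    fix j assume "n \<le> j"
    then show "coeff (s + smult (- c) (p n)) j = 0"
      using Suc.prems by (cases "j = n") (auto simp: c_def)
  qed (use Suc.prems in auto)
  then show ?case using Suc.prems(3)[of n] by (simp only: add smult lessI) simp
qed

text \<open>For \<open>n = 0\<close> the matrix is block triangular: in the last \<open>a\<close>
  columns the index \<open>m\<close> is negative, so the rows from \<open>U\<close> vanish there,
  while W is evaluated at \<open>0, ..., a - 1\<close>. The other block is of Vandermonde type in
  the distinct points \<open>lam u\<close>.\<close>

lemma Phi_0_nonzero:
  assumes b: "1 \<le> b" and ba: "b \<le> a" and M: "\<And>i. i < b \<Longrightarrow> M i \<noteq> 1"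
    and U: "finite U" and inj: "inj_on (lam (of_nat a) (of_nat b)) U"
  shows "Phi a b N M U 0 \<noteq> 0"
proof
  assume "Phi a b N M U 0 = 0"
  define nU where "nU = card U"
  define l where "l i = lam (of_nat a) (of_nat b) (lex_list U ! i)" for i
  define f where "f r c = (let j = c + 1 in
       if r < a then
         pochhammer (of_int (int b + int N - int 0 - int nU + int j + 1)) (a + nU - j)
           * W_fun a b N M (b + r) (of_int (- int 0 - int nU + int j - 1))
       else
         (-1) ^ j * poly (dual_hahn (of_nat a) (of_nat b) (of_nat N) (int 0 + int nU - int j))
                         (lam (of_nat a) (of_nat b) (lex_list U ! (r - a))))" for r c
  define A where "A = Matrix.mat (a + nU) (a + nU) (\<lambda>(r, c). f r c)"
  have A: "A \<in> carrier_mat (a + nU) (a + nU)" by (simp add: A_def)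
  have "Determinant.det A = 0"
    using \<open>Phi a b N M U 0 = 0\<close> unfolding Phi_def Let_def A_def f_def nU_def by simp
  then have "Determinant.det (transpose_mat A) = 0" by (simp add: det_transpose[OF A])
  then obtain v where v: "v \<in> carrier_vec (a + nU)" "v \<noteq> 0\<^sub>v (a + nU)"
    and Av: "transpose_mat A *\<^sub>v v = 0\<^sub>v (a + nU)"
    using det_0_iff_vec_prod_zero[of "transpose_mat A" "a + nU"] A by auto
  have col: "(\<Sum>r<a + nU. f r c * v $ r) = 0" if c: "c < a + nU" for c
  proof -
    have "(transpose_mat A *\<^sub>v v) $ c = 0" using Av c by simp
    then show ?thesis using c v A by (simp add: A_def scalar_prod_def atLeast0LessThan)
  qed
  have v1: "\<forall>r<a. v $ r = 0"
  proof (rule W_rows_independent[OF b ba M])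
    fix x assume x: "x < a"
    define p where "p = (pochhammer (of_int (int (b + N + x + 2))) (a - 1 - x) :: complex)"
    have "p = fact (b + N + x + 1 + (a - 1 - x)) / fact (b + N + x + 1)"
      using pochhammer_Suc_of_nat[of "b + N + x + 1" "a - 1 - x"] by (simp add: p_def add_ac)
    then have p: "p \<noteq> 0" by (simp del: fact_Suc)
    have W: "f r (nU + x) = p * W_fun a b N M (b + r) (of_nat x)" if "r < a" for r
    proof -
      have e: "int b + int N - int 0 - int nU + int (nU + x + 1) + 1 = int (b + N + x + 2)"
        "a + nU - (nU + x + 1) = a - 1 - x" "- int 0 - int nU + int (nU + x + 1) - 1 = int x" by auto
      show ?thesis unfolding f_def Let_def e p_def using that by simp
    qed
    have R: "f r (nU + x) = 0" if "\<not> r < a" for r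
      using that by (simp add: f_def dual_hahn_neg)
    have "0 = (\<Sum>r<a + nU. f r (nU + x) * v $ r)" using col x by simp
    also have "\<dots> = (\<Sum>r<a. f r (nU + x) * v $ r)"
      using R by (intro sum.mono_neutral_right) auto
    also have "\<dots> = p * (\<Sum>r<a. v $ r * W_fun a b N M (b + r) (of_nat x))"
      unfolding sum_distrib_left by (intro sum.cong) (auto simp: W)
    finally show "(\<Sum>r<a. v $ r * W_fun a b N M (b + r) (of_nat x)) = 0" using p by simp
  qed auto
  \<comment> \<open>The \<open>U\<close> part of the row dependency, seen as a functional: it
    annihilates every \<open>R_k\<close> with \<open>k < card U\<close>, hence all polynomials of
    degree below \<open>card U\<close>.\<close>
  define F where "F p = (\<Sum>i<nU. v $ (a + i) * poly p (l i))" for p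
  have lex: "length (lex_list U) = nU" "set (lex_list U) = U" "distinct (lex_list U)"
    using lex_list[OF U] lex_list_distinct[OF U] by (simp_all add: nU_def)
  have l_inj: "l i = l j \<longleftrightarrow> i = j" if "i < nU" "j < nU" for i j
    using inj lex that by (auto simp: l_def inj_on_def nth_eq_iff_index_eq) (metis nth_mem nth_eq_iff_index_eq)
  have FR: "F (dual_hahn (of_nat a) (of_nat b) (of_nat N) (int k)) = 0" if k: "k < nU" for k
  proof -
    define c where "c = nU - 1 - k"
    have c: "c < a + nU" "int 0 + int nU - int (c + 1) = int k" using k by (auto simp: c_def)
    have "0 = (\<Sum>r<a + nU. f r c * v $ r)" using col c by simp
    also have "\<dots> = (\<Sum>r<a. f r c * v $ r) + (\<Sum>i<nU. f (a + i) c * v $ (a + i))"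
      by (rule sum_lessThan_add)
    also have "(\<Sum>r<a. f r c * v $ r) = 0" using v1 by simp
    also have "(\<Sum>i<nU. f (a + i) c * v $ (a + i)) = (-1) ^ (c + 1) * F (dual_hahn (of_nat a) (of_nat b) (of_nat N) (int k))"
      unfolding F_def sum_distrib_left f_def Let_def c(2) l_def by (intro sum.cong refl) (simp add: mult_ac)
    finally show ?thesis by simp
  qed
  have v2: "v $ (a + i) = 0" if i: "i < nU" for i
  proof -
    \<comment> \<open>The Lagrange polynomial that isolates the node \<open>l i\<close>.\<close>
    define L where "L = (\<Prod>k\<in>{..<nU} - {i}. [:- l k, 1:])"
    have "degree L = (\<Sum>k\<in>{..<nU} - {i}. 1)"
      unfolding L_def by (subst degree_prod_eq_sum_degree) auto
    also have "\<dots> = nU - 1" using i by simp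
    finally have dL: "degree L < nU" using i by simp
    have "F L = 0"
    proof (rule linear_functional_zero[where p = "\<lambda>k. dual_hahn (of_nat a) (of_nat b) (of_nat N) (int k)" and n = nU])
      fix k j :: nat assume "k < j"
      then show "coeff (dual_hahn (of_nat a) (of_nat b) (of_nat N) (int k)) j = 0"
        using dual_hahn_degree_le[of "of_nat a" "of_nat b" "of_nat N" "int k"] by (intro coeff_eq_0) simp
    next
      fix j assume "nU \<le> j"
      then show "coeff L j = 0" using dL by (intro coeff_eq_0) simp
    qed (simp_all add: FR[unfolded F_def] dual_hahn_coeff F_def distrib_left sum.distrib sum_distrib_left mult_ac)
    moreover have "F L = v $ (a + i) * (\<Prod>k\<in>{..<nU} - {i}. (l i - l k))"
    proof -
      have "F L = (\<Sum>j<nU. if j = i then v $ (a + i) * poly L (l i) else 0)"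
        unfolding F_def
      proof (intro sum.cong refl)
        fix j assume "j \<in> {..<nU}"
        then show "v $ (a + j) * poly L (l j) = (if j = i then v $ (a + i) * poly L (l i) else 0)"
          by (auto simp: L_def poly_prod)
      qed
      then show ?thesis using i by (simp add: L_def poly_prod)
    qed
    moreover have "(\<Prod>k\<in>{..<nU} - {i}. (l i - l k)) \<noteq> 0" using l_inj i by auto
    ultimately show ?thesis by simp
  qed
  have "v = 0\<^sub>v (a + nU)"
  proof (rule eq_vecI)
    fix r assume "r < dim_vec (0\<^sub>v (a + nU) :: complex vec)"
    then show "v $ r = 0\<^sub>v (a + nU) $ r"
      using v1 v2[of "r - a"] by (cases "r < a") auto
  qed (use v in auto)
  then show False using v(2) by simp
qed

section \<open>Division by the Christoffel polynomial\<close>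

lemma christoffel_poly_lead:
  "degree (christoffel_poly a b U) = card U" "coeff (christoffel_poly a b U) (card U) = 1"
proof -
  show d: "degree (christoffel_poly a b U) = card U"
    unfolding christoffel_poly_def by (subst degree_prod_eq_sum_degree) auto
  have "lead_coeff (christoffel_poly a b U) = 1"
    unfolding christoffel_poly_def by (simp add: lead_coeff_prod)
  then show "coeff (christoffel_poly a b U) (card U) = 1" by (simp add: d)
qed

text \<open>Evaluation at \<open>lam u\<close> makes the first row equal to a row from
  \<open>U\<close>.\<close>

lemma q_num_root:
  assumes U: "finite U" and u: "u \<in> U"
  shows "poly (q_num a b N M U n) (lam (of_nat a) (of_nat b) u) = 0"
proof -
  obtain i where i: "i < card U" "lex_list U ! i = u"
    using lex_list[OF U] u by (metis in_set_conv_nth)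
  have "poly (q_num a b N M U n) (lam (of_nat a) (of_nat b) u)
      = (\<Sum>c<a + card U + 1. bordered a b N M U n $$ (Suc (a + i), c) * q_cofactor a b N M U n c)"
    unfolding q_num_expand poly_sum
    by (intro sum.cong refl) (simp add: bordered_def i mult_ac)
  also have "\<dots> = 0" using i by (intro bordered_row_orthogonal) simp
  finally show ?thesis .
qed

lemma christoffel_poly_dvd:
  assumes "finite U" "inj_on (lam (of_nat a) (of_nat b)) U"
  shows "christoffel_poly a b U dvd q_num a b N M U n"
  unfolding christoffel_poly_def using assms
  by (intro prod_linear_dvd) (auto simp: q_num_root)

lemma q_num_degree: "degree (q_num a b N M U n) \<le> n + card U"
  unfolding q_num_expand
proof (rule degree_sum_le, goal_cases)
  case (2 c)
  show ?case
    using order_trans[OF degree_smult_le dual_hahn_degree_le, of "(-1) ^ c * q_cofactor a b N M U n c"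
        "of_nat a" "of_nat b" "of_nat N" "int n + int (card U) - int c"]
    by linarith
qed simp

lemma q_num_coeff: "coeff (q_num a b N M U n) (n + card U) = Phi a b N M U n / fact (n + card U)"
proof -
  have "coeff (q_num a b N M U n) (n + card U)
      = (\<Sum>c<a + card U + 1. if c = 0 then Phi a b N M U n / fact (n + card U) else 0)"
    unfolding q_num_expand coeff_sum
  proof (rule sum.cong, goal_cases)
    case (2 c)
    show ?case
    proof (cases "c = 0")
      case True
      then show ?thesis
        using dual_hahn_coeff[of "of_nat a" "of_nat b" "of_nat N" "n + card U"] by (simp add: q_cofactor_first)
    next
      case False
      have "coeff (dual_hahn (of_nat a) (of_nat b) (of_nat N) (int n + int (card U) - int c)) (n + card U) = 0"
      \<comment> \<open>The bound \<open>nat k\<close> on the degree does not distinguish index 0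
        from negative ones; for \<open>n + card U = 0\<close> the later columns hold the zero
        polynomial.\<close>
      proof (cases "n + card U = 0")
        case True
        then show ?thesis using False by (simp add: dual_hahn_neg)
      next
        case nz: False
        then show ?thesis
          using False dual_hahn_degree_le[of "of_nat a" "of_nat b" "of_nat N" "int n + int (card U) - int c"]
          by (intro coeff_eq_0) linarith
      qed
      then show ?thesis using False by simp
    qed
  qed simp
  then show ?thesis by (simp del: sum.lessThan_Suc)
qed

text \<open>Phrased with the coefficient at \<open>n\<close> instead of the leading one, because the
  degree of the quotient drops when \<open>Phi n\<close> is 0.\<close>

lemma degree_mult_quotient:
  fixes p q :: "'a :: idom poly"
  assumes "degree p = k" "coeff p k = 1" "degree (p * q) \<le> n + k"
  shows "degree q \<le> n" "coeff q n = coeff (p * q) (n + k)"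
proof -
  have p: "p \<noteq> 0" using assms by auto
  show d: "degree q \<le> n"
    using assms p by (cases "q = 0") (auto simp: degree_mult_eq)
  show "coeff q n = coeff (p * q) (n + k)"
  proof (cases "degree q = n")
    case True
    then show ?thesis using coeff_mult_degree_sum[of p q] assms by (simp add: add.commute)
  next
    case False
    then have "degree (p * q) < n + k"
      using d assms p by (cases "q = 0") (auto simp: degree_mult_eq)
    moreover have "degree q < n" using False d by simp
    ultimately show ?thesis by (simp add: coeff_eq_0)
  qed
qed


text \<open>It keeps every index below \<open>n_S\<close> at most \<open>N + b\<close>, hence at
  most \<open>N + a\<close>, the range in which the moments are controlled.\<close>

lemma n_S_le: "n_S a b N U \<le> N + b + 1"
proof -
  have "n_S a b N U \<le> card ((\<lambda>i. lam (of_nat a) (of_nat b) (of_int i)) ` {- int b..int N})"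
    unfolding n_S_def by (intro card_mono) auto
  also have "\<dots> \<le> card {- int b..int N}" by (rule card_image_le) simp
  finally show ?thesis by simp
qed

lemma pairing_add_left: "pairing \<mu> (p + q) r = pairing \<mu> p r + pairing \<mu> q r"
  and pairing_smult_left: "pairing \<mu> (smult c p) r = c * pairing \<mu> p r"
  by (simp_all add: pairing_def pm_integral_def algebra_simps sum.distrib sum_distrib_left)

theorem theorem5p1:
  fixes a b N :: nat and M :: "nat \<Rightarrow> real" and U :: "complex set"
  assumes "1 \<le> b" and "b \<le> a" and "a \<le> N"
    and "\<And>i. i < b \<Longrightarrow> M i \<noteq> 0 \<and> M i \<noteq> 1"
    and "finite U"
    and "\<And>u v. u \<in> U \<Longrightarrow> v \<in> U \<Longrightarrow> u + v \<noteq> - of_nat a - of_nat b - 1"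
    and "n_S a b N U > 0"
  shows "((\<exists>p. orthogonal_seq (nu_U a b N M U) (n_S a b N U - 1) p)
           \<longleftrightarrow> (\<forall>n\<le>n_S a b N U. Phi a b N M U n \<noteq> 0)) \<and>
         ((\<forall>n\<le>n_S a b N U. Phi a b N M U n \<noteq> 0) \<longrightarrow>
           (\<forall>n<n_S a b N U. christoffel_poly a b U dvd q_num a b N M U n) \<and>
           orthogonal_seq (nu_U a b N M U) (n_S a b N U - 1) (q_poly a b N M U) \<and>
           (\<forall>n<n_S a b N U.
              pairing (nu_U a b N M U) (q_poly a b N M U n) (q_poly a b N M U n) =
                (-1) ^ card U * fact n * (fact (N + b))\<^sup>2 * of_nat (N + a + b - n) ^ a
                / (fact (n + card U) * fact (N + a - n) * fact (N + a + b - n))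
                * Phi a b N M U n * Phi a b N M U (n + 1)))"
proof -
  note b = assms(1) and ba = assms(2)
  have M: "\<And>i. i < b \<Longrightarrow> M i \<noteq> 1" using assms(4) by blast
  have inj: "inj_on (lam (of_nat a) (of_nat b)) U" by (rule lam_inj_on) (rule assms(6))
  define nS where "nS = n_S a b N U"
  define q where "q = q_poly a b N M U"
  define ph where "ph = Phi a b N M U"
  define \<nu> where "\<nu> = nu_U a b N M U"
  define T where "T n = defect a b N n * (of_nat (N + a + b - n) ^ a * (-1) ^ card U * ph (Suc n))" for n
  have nS: "0 < nS" "nS \<le> N + b + 1" using assms(7) n_S_le by (simp_all add: nS_def)
  have dvd: "christoffel_poly a b U dvd q_num a b N M U n" for n
    by (rule christoffel_poly_dvd[OF assms(5) inj])
  have qn: "christoffel_poly a b U * q n = q_num a b N M U n" for n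
    using dvd by (simp add: q_def q_poly_def)
  have q_deg: "degree (q n) \<le> n" and q_coeff: "coeff (q n) n = ph n / fact (n + card U)" for n
    using degree_mult_quotient[OF christoffel_poly_lead, of a b U "q n" n]
    unfolding qn by (simp_all add: q_num_degree q_num_coeff ph_def)
  \<comment> \<open>The density cancels the division in \<open>q_poly\<close>, so this is an
    integral of \<open>q_num\<close> against \<open>nu\<close>, and among the powers up to
    \<open>n\<close> only the top one contributes.\<close>
  have pair: "pairing \<nu> (q n) r = coeff r n * T n" if n: "n < nS" and r: "\<And>j. n < j \<Longrightarrow> coeff r j = 0" for n r
  proof -
    have n': "n \<le> N + a" using n nS ba by simp
    have "poly r y = (\<Sum>k\<le>n. coeff r k * y ^ k)" for y
    proof -
      have "degree r \<le> n" using r by (intro degree_le) auto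
      then show ?thesis
        unfolding poly_altdef by (intro sum.mono_neutral_left) (auto simp: coeff_eq_0)
    qed
    then have "pairing \<nu> (q n) r = pm_integral (nu a b N M) (\<lambda>y. \<Sum>k\<le>n. coeff r k * (y ^ k * poly (q_num a b N M U n) y))"
      unfolding pairing_def \<nu>_def nu_U_def pm_integral_density qn[symmetric]
      by (simp add: sum_distrib_left mult_ac)
    also have "\<dots> = (\<Sum>k\<le>n. coeff r k * (if k = n then T n else 0))"
      unfolding pm_integral_linear
      by (intro sum.cong refl) (simp add: pm_integral_q_num[OF b ba M n'] T_def ph_def)
    also have "\<dots> = coeff r n * T n" by (simp add: mult_delta_right)
    finally show ?thesis .
  qed
  have norm: "pairing \<nu> (q n) (q n) = ph n / fact (n + card U) * T n" if "n < nS" for n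
    using pair[OF that, of "q n"] q_deg[of n] by (simp add: q_coeff coeff_eq_0)
  \<comment> \<open>\<open>n <= N + b\<close> together with \<open>1 <= a\<close> keeps the base of
    the power nonzero.\<close>
  have T_nz: "T n \<noteq> 0 \<longleftrightarrow> ph (Suc n) \<noteq> 0" if "n < nS" for n
  proof -
    have "N + a + b - n \<noteq> 0" using that nS b ba by simp
    then have "(of_nat (N + a + b - n) :: complex) \<noteq> 0" by (simp only: of_nat_eq_0_iff simp_thms)
    then show ?thesis by (simp add: T_def defect_def del: of_nat_diff)
  qed
  have orth: "orthogonal_seq \<nu> (nS - 1) q" if ph: "\<forall>n\<le>nS. ph n \<noteq> 0"
  proof -
    have deg: "degree (q n) = n" if "n < nS" for n
      using q_deg[of n] q_coeff[of n] ph that by (intro antisym le_degree) auto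
    have low: "pairing \<nu> (q n) (q m) = 0" if "m < n" "n < nS" for m n
      using pair[of n "q m"] deg[of m] that by (simp add: coeff_eq_0)
    have "pairing \<nu> (q n) (q m) = 0" if "n \<noteq> m" "n < nS" "m < nS" for n m
    proof (cases "m < n")
      case False
      then have "pairing \<nu> (q m) (q n) = 0" using that by (intro low) auto
      then show ?thesis by (simp add: pairing_def mult.commute)
    qed (use that low in auto)
    moreover have "pairing \<nu> (q n) (q n) \<noteq> 0" if "n < nS" for n
      using norm[OF that] T_nz[OF that] ph that by simp
    moreover have "n \<le> nS - 1 \<longleftrightarrow> n < nS" for n using nS(1) by auto
    ultimately show ?thesis using deg by (simp add: orthogonal_seq_def)
  qed
  \<comment> \<open>If \<open>Phi (n + 1)\<close> were 0 and \<open>Phi n\<close> were not,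
    \<open>q n\<close> would have exact degree \<open>n\<close> and be orthogonal to every
    polynomial of degree at most \<open>n\<close>. It differs from a nonzero multiple of
    \<open>p n\<close> by lower degrees only, so \<open>p n\<close> would be orthogonal to
    itself.\<close>
  have nonzero: "ph n \<noteq> 0" if p: "orthogonal_seq \<nu> (nS - 1) p" and "n \<le> nS" for p n
    using that(2)
  proof (induction n)
    case 0
    show ?case unfolding ph_def by (rule Phi_0_nonzero[OF b ba M assms(5) inj])
  next
    case (Suc n)
    then have n: "n < nS" and phn: "ph n \<noteq> 0" by simp_all
    have deg: "degree (p k) = k" and orth: "\<And>m. m \<le> n \<Longrightarrow> k \<noteq> m \<Longrightarrow> pairing \<nu> (p k) (p m) = 0"
      and nz: "pairing \<nu> (p k) (p k) \<noteq> 0" if "k \<le> n" for k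
      using p n that by (auto simp: orthogonal_seq_def)
    have lead: "coeff (p k) k \<noteq> 0" if "k \<le> n" for k
    proof -
      have "p k \<noteq> 0" using nz[OF that] by (auto simp: pairing_def pm_integral_def)
      then show ?thesis using deg[OF that] by (metis leading_coeff_neq_0)
    qed
    show ?case
    proof
      assume "ph (Suc n) = 0"
      then have T0: "T n = 0" by (simp add: T_def)
      define c where "c = coeff (q n) n / coeff (p n) n"
      define r where "r = q n + smult (- c) (p n)"
      have c: "c \<noteq> 0" using phn lead[of n] by (simp add: c_def q_coeff)
      have "pairing \<nu> r (p n) = 0"
      proof (rule linear_functional_zero[where p = p and n = n and F = "\<lambda>s. pairing \<nu> s (p n)"])
        fix j assume "n \<le> j"
        then show "coeff r j = 0"
          using q_deg[of n] deg[of n] lead[of n]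
          by (cases "j = n") (auto simp: r_def c_def coeff_eq_0)
      qed (use lead deg orth in \<open>auto simp: pairing_add_left pairing_smult_left coeff_eq_0\<close>)
      moreover have "pairing \<nu> (q n) (p n) = 0"
        using pair[OF n, of "p n"] deg[of n] T0 by (simp add: coeff_eq_0)
      ultimately have "c * pairing \<nu> (p n) (p n) = 0"
        unfolding r_def pairing_add_left pairing_smult_left by simp
      then show False using c nz[of n] by simp
    qed
  qed
  have iff: "(\<exists>p. orthogonal_seq \<nu> (nS - 1) p) \<longleftrightarrow> (\<forall>n\<le>nS. ph n \<noteq> 0)"
    using orth nonzero by blast
  have "pairing \<nu> (q n) (q n) =
                (-1) ^ card U * fact n * (fact (N + b))\<^sup>2 * of_nat (N + a + b - n) ^ a
                / (fact (n + card U) * fact (N + a - n) * fact (N + a + b - n))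
                * ph n * ph (n + 1)" if "n < nS" for n
    unfolding norm[OF that] T_def defect_def by (simp add: mult_ac del: of_nat_diff)
  then show ?thesis
    using iff orth dvd unfolding q_def ph_def \<nu>_def nS_def by blast
qed

end
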